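(* Consider one of the following theories of a Dirac field of mass $M$ on $\mathrm{AdS}_2$: (i) $0<M<1/2$ with the Dirichlet type III condition $\widetilde{\Phi^{(1)}}(\frac\pi2)=0=\widetilde{\Phi^{(1)}}(-\frac\pi2)$; (ii) $0<M<1/2$ with the Dirichlet type IV condition $\widetilde{\Phi^{(2)}}(\frac\pi2)=0=\widetilde{\Phi^{(2)}}(-\frac\pi2)$; (iii) $M=0$ with the condition $\cos\beta_\pm\,\Phi^{(1)}(\pm\frac\pi2)=\mp\sin\beta_\pm\,\Phi^{(2)}(\pm\frac\pi2)$, where $\beta_\pm\in[0,\pi)$ and $\beta_++\beta_-\in\{0,\pi\}$ (equivalently, the frequency spectrum contains $0$). In each case the frequency spectrum is $\mathbb{Z}$. Let $\hat L_\pm$ be the quantum charges on Fock space defined in the context and $|0\rangle$ the Fock vacuum. Then $$[\hat L_+,\hat L_-]=2\hat L_0,\qquad \hat L_0=\sum_{n=1}^\infty n\left(a_n^\dagger a_n+b_n^\dagger b_n\right)+\tfrac12\left(\tfrac14-M^2\right)\mathbb{I},$$ and both $|0\rangle$ and $a_0^\dagger|0\rangle$ are annihilated by $\hat L_-$ and are eigenvectors of $\hat L_0$ with eigenvalue $\frac12(\frac14-M^2)$. Consequently, for every $\alpha\in\mathbb{C}$ with $|\alpha|\le1$, the normalized vacuum state $$|0;\alpha\rangle=\alpha|0\rangle+\left(1-|\alpha|^2\right)^{1/2}a_0^\dagger|0\rangle$$ generates, under $\hat L_0,\hat L_\pm$, a lowest-weight representation isomorphic to the discrete series representation $\mathsc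r{D}^+_{(1/4-M^2)/2}$.
   Context: Modes. Let $\mathbb{D}=\begin{pmatrix}0&-\frac{d}{d\rho}+M\sec\rho\\ \frac{d}{d\rho}+M\sec\rho&0\end{pmatrix}$ on $(-\pi/2,\pi/2)$, $\Phi=(\Phi^{(1)},\Phi^{(2)})^T$, $\sigma(\rho)=\left(\frac{1-\sin\rho}{1+\sin\rho}\right)^{1/2}$, $\widetilde{\Phi^{(1)}}=\sigma^{-M}\Phi^{(1)}$, $\widetilde{\Phi^{(2)}}=\sigma^M\Phi^{(2)}$ (values at $\pm\pi/2$ are limits). With any of the stated boundary conditions, the eigenvalues of $\mathbb{D}\Phi=\omega\Phi$ are the integers, each simple; let $\Psi_n(t,\rho)=\Phi_n(\rho)e^{-int}$, $n\in\mathbb{Z}$, be the corresponding modes, normalized with respect to $\langle\Psi,\Psi'\rangle=\int_{-\pi/2}^{\pi/2}\Psi^\dagger\Psi'\,d\rho$ (they are orthonormal). The infinitesimal $\widetilde{\mathrm{SL}}(2,\mathbb{R})$ action is $L_0=i\partial_t$ and $$L_\pm=e^{\mp it}\Big(\pm i\cos\rho\,\partial_\rho\mp\tfrac{i}{2}\sin\rho+\sin\rho\,\partial_t+\cos\rho\,\Sigma^{01}\Big),\qquad \Sigma^{01}=\tfrac12\begin{pmatrix}0&i\\-i&0\end{pmatrix},$$ with $[L_0,L_\pm]=\pm L_\pm$, $[L_+,L_-]=2L_0$; $L_\pm\Psi_n$ is a multiple of $\Psi_{n\pm1}$. Fock space. Let $a_n$ ($n\ge0$), $b_n$ ($n\ge1$)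 and their adjoints satisfy $\{a_n,a_m^\dagger\}=\delta_{nm}$, $\{b_n,b_m^\dagger\}=\delta_{nm}$ with all other anticommutators zero, acting on the algebraic fermionic Fock space generated by the vacuum $|0\rangle$ with $a_n|0\rangle=0$ ($n\ge0$), $b_n|0\rangle=0$ ($n\ge1$). The quantum field is $\Psi=\sum_{n\ge1}(a_n\Psi_n+b_n^\dagger\Psi_{-n})+a_0\Psi_0=\sum_{n\in\mathbb{Z}}c_n\Psi_n$, with $c_n=a_n$ for $n\ge0$ and $c_{-n}=b_n^\dagger$ for $n\ge1$. The charges are $\hat L_\pm=\langle\Psi,L_\pm\Psi\rangle:=\sum_{m,n\in\mathbb{Z}}\langle\Psi_m,L_\pm\Psi_n\rangle\,c_m^\dagger c_n$. For $\lambda>0$, $\mathscr{D}^+_\lambda$ denotes the irreducible unitary representation (with raising/lowering operators satisfying $L_\pm^\dagger=-L_\mp$) whose $L_0$-eigenvalues are $\lambda+n$, $n\in\mathbb{N}\cup\{0\}$, each of multiplicity one, the eigenvector of eigenvalue $\lambda$ being annihilated by the lowering operator. *)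

theory Defs
  imports "HOL-Analysis.Analysis" "HOL-Library.Groups_Big_Fun"
begin

section \<open>Modes of the Dirac field on AdS2\<close>

text \<open>Two-spinors are elements of \<open>complex ^ 2\<close>.  Spinor functions of \<open>\<rho>\<close> are total functions
  on the reals, but only their restriction to the open interval below ever matters.\<close>

abbreviation strip :: "real set" where
  "strip \<equiv> {- (pi / 2) <..< pi / 2}"

definition dirac_op :: "real \<Rightarrow> (real \<Rightarrow> complex ^ 2) \<Rightarrow> real \<Rightarrow> complex ^ 2" where
  "dirac_op M \<Phi> \<rho> =
     vector [- vector_derivative (\<lambda>x. \<Phi> x $ 2) (at \<rho>) + of_real (M / cos \<rho>) * \<Phi> \<rho> $ 2,
             vector_derivative (\<lambda>x. \<Phi> x $ 1) (at \<rho>) + of_real (M / cos \<rho>) * \<Phi> \<rho> $ 1]"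

definition sigma :: "real \<Rightarrow> real" where
  "sigma \<rho> = sqrt ((1 - sin \<rho>) / (1 + sin \<rho>))"

definition tilde1 :: "real \<Rightarrow> (real \<Rightarrow> complex ^ 2) \<Rightarrow> real \<Rightarrow> complex" where
  "tilde1 M \<Phi> \<rho> = of_real (sigma \<rho> powr (- M)) * \<Phi> \<rho> $ 1"

definition tilde2 :: "real \<Rightarrow> (real \<Rightarrow> complex ^ 2) \<Rightarrow> real \<Rightarrow> complex" where
  "tilde2 M \<Phi> \<rho> = of_real (sigma \<rho> powr M) * \<Phi> \<rho> $ 2"

text \<open>\<open>Angles bp bm\<close> is the condition of the massless theory with parameters
  \<open>\<beta>\<^sub>+ = bp\<close> and \<open>\<beta>\<^sub>- = bm\<close>.\<close>

datatype boundary_condition = DirichletIII | DirichletIV | Angles real real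

text \<open>Boundary values are one-sided limits.\<close>

fun satisfies_bc :: "real \<Rightarrow> boundary_condition \<Rightarrow> (real \<Rightarrow> complex ^ 2) \<Rightarrow> bool" where
  "satisfies_bc M DirichletIII \<Phi> \<longleftrightarrow>
     (tilde1 M \<Phi> \<longlongrightarrow> 0) (at_left (pi / 2)) \<and> (tilde1 M \<Phi> \<longlongrightarrow> 0) (at_right (- (pi / 2)))"
| "satisfies_bc M DirichletIV \<Phi> \<longleftrightarrow>
     (tilde2 M \<Phi> \<longlongrightarrow> 0) (at_left (pi / 2)) \<and> (tilde2 M \<Phi> \<longlongrightarrow> 0) (at_right (- (pi / 2)))"
| "satisfies_bc M (Angles bp bm) \<Phi> \<longleftrightarrow>
     (\<exists>u w. (\<Phi> \<longlongrightarrow> u) (at_left (pi / 2)) \<and> (\<Phi> \<longlongrightarrow> w) (at_right (- (pi / 2))) \<and>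
        of_real (cos bp) * u $ 1 = - (of_real (sin bp) * u $ 2) \<and>
        of_real (cos bm) * w $ 1 = of_real (sin bm) * w $ 2)"

fun admissible_theory :: "real \<Rightarrow> boundary_condition \<Rightarrow> bool" where
  "admissible_theory M DirichletIII \<longleftrightarrow> 0 < M \<and> M < 1 / 2"
| "admissible_theory M DirichletIV \<longleftrightarrow> 0 < M \<and> M < 1 / 2"
| "admissible_theory M (Angles bp bm) \<longleftrightarrow>
     M = 0 \<and> bp \<in> {0..<pi} \<and> bm \<in> {0..<pi} \<and> bp + bm \<in> {0, pi}"

definition eigenfunction ::
    "real \<Rightarrow> boundary_condition \<Rightarrow> complex \<Rightarrow> (real \<Rightarrow> complex ^ 2) \<Rightarrow> bool" where
  "eigenfunction M bc \<omega> \<Phi> \<longleftrightarrow>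
     \<Phi> differentiable_on strip \<and>
     (\<forall>\<rho>\<in>strip. dirac_op M \<Phi> \<rho> = \<omega> *s \<Phi> \<rho>) \<and>
     set_integrable lborel strip (\<lambda>\<rho>. (norm (\<Phi> \<rho>))\<^sup>2) \<and>
     (\<exists>\<rho>\<in>strip. \<Phi> \<rho> \<noteq> 0) \<and>
     satisfies_bc M bc \<Phi>"

definition frequency_spectrum :: "real \<Rightarrow> boundary_condition \<Rightarrow> complex set" where
  "frequency_spectrum M bc = {\<omega>. \<exists>\<Phi>. eigenfunction M bc \<omega> \<Phi>}"

text \<open>Spacetime spinors take the arguments \<open>t\<close> and \<open>\<rho>\<close> in this order.\<close>

type_synonym spinor = "real \<Rightarrow> real \<Rightarrow> complex ^ 2"

definition spinor_ip :: "real \<Rightarrow> spinor \<Rightarrow> spinor \<Rightarrow> complex" where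
  "spinor_ip t \<Psi> \<Psi>' =
     set_lebesgue_integral lborel strip (\<lambda>\<rho>. \<Sum>i\<in>UNIV. cnj (\<Psi> t \<rho> $ i) * \<Psi>' t \<rho> $ i)"

definition mode :: "(int \<Rightarrow> real \<Rightarrow> complex ^ 2) \<Rightarrow> int \<Rightarrow> spinor" where
  "mode \<Phi> n t \<rho> = exp (- \<i> * of_int n * of_real t) *s \<Phi> n \<rho>"

definition normalized_modes ::
    "real \<Rightarrow> boundary_condition \<Rightarrow> (int \<Rightarrow> real \<Rightarrow> complex ^ 2) \<Rightarrow> bool" where
  "normalized_modes M bc \<Phi> \<longleftrightarrow>
     (\<forall>n. eigenfunction M bc (of_int n) (\<Phi> n) \<and> (\<forall>t. spinor_ip t (mode \<Phi> n) (mode \<Phi> n) = 1))"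

definition Sigma01 :: "complex ^ 2 ^ 2" where
  "Sigma01 = vector [vector [0, \<i> / 2], vector [- \<i> / 2, 0]]"

text \<open>The two operators \<open>L\<^sub>\<plusminus>\<close> are the cases \<open>s = 1\<close> and \<open>s = -1\<close>.\<close>

definition ladder :: "complex \<Rightarrow> spinor \<Rightarrow> spinor" where
  "ladder s \<Psi> t \<rho> = exp (- s * \<i> * of_real t) *s
     ((s * \<i> * of_real (cos \<rho>)) *s vector_derivative (\<lambda>x. \<Psi> t x) (at \<rho>)
      - (s * \<i> / 2 * of_real (sin \<rho>)) *s \<Psi> t \<rho>
      + of_real (sin \<rho>) *s vector_derivative (\<lambda>\<tau>. \<Psi> \<tau> \<rho>) (at t)
      + of_real (cos \<rho>) *s (Sigma01 *v \<Psi> t \<rho>))"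

abbreviation L_plus :: "spinor \<Rightarrow> spinor" where "L_plus \<equiv> ladder 1"
abbreviation L_minus :: "spinor \<Rightarrow> spinor" where "L_minus \<equiv> ladder (- 1)"


section \<open>Complex inner products\<close>

definition inner_product_on ::
    "(complex \<Rightarrow> 'v \<Rightarrow> 'v) \<Rightarrow> 'v set \<Rightarrow> ('v::ab_group_add \<Rightarrow> 'v \<Rightarrow> complex) \<Rightarrow> bool" where
  "inner_product_on sc V ip \<longleftrightarrow>
     (\<forall>x\<in>V. \<forall>y\<in>V. \<forall>z\<in>V. ip x (y + z) = ip x y + ip x z) \<and>
     (\<forall>c. \<forall>x\<in>V. \<forall>y\<in>V. ip x (sc c y) = c * ip x y) \<and>
     (\<forall>x\<in>V. \<forall>y\<in>V. ip y x = cnj (ip x y)) \<and>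
     (\<forall>x\<in>V. x \<noteq> 0 \<longrightarrow> 0 < Re (ip x x))"

definition linear_from_to ::
    "(complex \<Rightarrow> 'v \<Rightarrow> 'v) \<Rightarrow> (complex \<Rightarrow> 'w \<Rightarrow> 'w) \<Rightarrow> 'v set \<Rightarrow> 'w set
      \<Rightarrow> ('v::ab_group_add \<Rightarrow> 'w::ab_group_add) \<Rightarrow> bool" where
  "linear_from_to sc sc' V W f \<longleftrightarrow>
     f ` V \<subseteq> W \<and>
     (\<forall>x\<in>V. \<forall>y\<in>V. f (x + y) = f x + f y) \<and>
     (\<forall>c. \<forall>x\<in>V. f (sc c x) = sc' c (f x))"

definition invariant :: "('v \<Rightarrow> 'v) set \<Rightarrow> 'v set \<Rightarrow> bool" where
  "invariant S W \<longleftrightarrow> (\<forall>A\<in>S. A ` W \<subseteq> W)"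


section \<open>Fermionic Fock space\<close>

text \<open>The Fock space is the whole type \<open>'v\<close>.  The values of \<open>ann_b\<close> and \<open>cre_b\<close> at index \<open>0\<close> are
  irrelevant.\<close>

record 'v fock =
  fscale :: "complex \<Rightarrow> 'v \<Rightarrow> 'v"
  fip :: "'v \<Rightarrow> 'v \<Rightarrow> complex"
  ann_a :: "nat \<Rightarrow> 'v \<Rightarrow> 'v"
  cre_a :: "nat \<Rightarrow> 'v \<Rightarrow> 'v"
  ann_b :: "nat \<Rightarrow> 'v \<Rightarrow> 'v"
  cre_b :: "nat \<Rightarrow> 'v \<Rightarrow> 'v"
  vac :: 'v

definition anticomm :: "('v \<Rightarrow> 'v) \<Rightarrow> ('v \<Rightarrow> 'v) \<Rightarrow> 'v \<Rightarrow> 'v::ab_group_add" where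
  "anticomm A B = (\<lambda>x. A (B x) + B (A x))"

definition comm :: "('v \<Rightarrow> 'v) \<Rightarrow> ('v \<Rightarrow> 'v) \<Rightarrow> 'v \<Rightarrow> 'v::ab_group_add" where
  "comm A B = (\<lambda>x. A (B x) - B (A x))"

definition fock_operators :: "'v fock \<Rightarrow> ('v \<Rightarrow> 'v) set" where
  "fock_operators F =
     range (ann_a F) \<union> range (cre_a F) \<union> ann_b F ` {1..} \<union> cre_b F ` {1..}"

definition fermionic_fock :: "'v::ab_group_add fock \<Rightarrow> bool" where
  "fermionic_fock F \<longleftrightarrow>
     vector_space (fscale F) \<and>
     inner_product_on (fscale F) UNIV (fip F) \<and>
     (\<forall>A\<in>fock_operators F. linear_from_to (fscale F) (fscale F) UNIV UNIV A) \<and>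
     (\<forall>n x y. fip F (cre_a F n x) y = fip F x (ann_a F n y)) \<and>
     (\<forall>n\<ge>1. \<forall>x y. fip F (cre_b F n x) y = fip F x (ann_b F n y)) \<and>
     (\<forall>n m. anticomm (ann_a F n) (cre_a F m) = (if n = m then (\<lambda>x. x) else (\<lambda>_. 0))) \<and>
     (\<forall>n m. anticomm (ann_a F n) (ann_a F m) = (\<lambda>_. 0)) \<and>
     (\<forall>n m. anticomm (cre_a F n) (cre_a F m) = (\<lambda>_. 0)) \<and>
     (\<forall>n\<ge>1. \<forall>m\<ge>1. anticomm (ann_b F n) (cre_b F m) = (if n = m then (\<lambda>x. x) else (\<lambda>_. 0))) \<and>
     (\<forall>n\<ge>1. \<forall>m\<ge>1. anticomm (ann_b F n) (ann_b F m) = (\<lambda>_. 0)) \<and>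
     (\<forall>n\<ge>1. \<forall>m\<ge>1. anticomm (cre_b F n) (cre_b F m) = (\<lambda>_. 0)) \<and>
     (\<forall>n. \<forall>m\<ge>1. anticomm (ann_a F n) (ann_b F m) = (\<lambda>_. 0)) \<and>
     (\<forall>n. \<forall>m\<ge>1. anticomm (ann_a F n) (cre_b F m) = (\<lambda>_. 0)) \<and>
     (\<forall>n. \<forall>m\<ge>1. anticomm (cre_a F n) (ann_b F m) = (\<lambda>_. 0)) \<and>
     (\<forall>n. \<forall>m\<ge>1. anticomm (cre_a F n) (cre_b F m) = (\<lambda>_. 0)) \<and>
     fip F (vac F) (vac F) = 1 \<and>
     (\<forall>n. ann_a F n (vac F) = 0) \<and>
     (\<forall>n\<ge>1. ann_b F n (vac F) = 0) \<and>
     (\<forall>W. module.subspace (fscale F) W \<and> vac F \<in> W \<and> invariant (fock_operators F) W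
        \<longrightarrow> W = UNIV)"

definition c_op :: "'v fock \<Rightarrow> int \<Rightarrow> 'v \<Rightarrow> 'v" where
  "c_op F n = (if 0 \<le> n then ann_a F (nat n) else cre_b F (nat (- n)))"

definition c_dag :: "'v fock \<Rightarrow> int \<Rightarrow> 'v \<Rightarrow> 'v" where
  "c_dag F n = (if 0 \<le> n then cre_a F (nat n) else ann_b F (nat (- n)))"

text \<open>The bilinear charge of a one-particle operator \<open>L\<close> at time \<open>t\<close>.  The double series is
  understood vectorwise: \<open>Sum_any\<close> is the sum of the nonzero terms (and \<open>0\<close> by convention if
  there are infinitely many).  For \<open>L_plus\<close> and \<open>L_minus\<close> only finitely many terms are nonzero
  on any given Fock vector, because only \<open>m = n \<plusminus> 1\<close> contributes.\<close>

definition charge ::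
    "'v::ab_group_add fock \<Rightarrow> (int \<Rightarrow> real \<Rightarrow> complex ^ 2) \<Rightarrow> real \<Rightarrow> (spinor \<Rightarrow> spinor) \<Rightarrow> 'v \<Rightarrow> 'v"
  where
  "charge F \<Phi> t L x =
     Sum_any (\<lambda>(m, n). fscale F (spinor_ip t (mode \<Phi> m) (L (mode \<Phi> n))) (c_dag F m (c_op F n x)))"

definition Lhat_plus where "Lhat_plus F \<Phi> t = charge F \<Phi> t L_plus"

definition Lhat_minus where "Lhat_minus F \<Phi> t = charge F \<Phi> t L_minus"

text \<open>The unordered series for \<open>L\<^sub>0\<close> diverges, so the quantum operator, including its additive
  constant, is fixed by the commutation relation.\<close>

definition Lhat_zero where
  "Lhat_zero F \<Phi> t = (\<lambda>x. fscale F (1 / 2) (comm (Lhat_plus F \<Phi> t) (Lhat_minus F \<Phi> t) x))"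

definition number_energy :: "'v::ab_group_add fock \<Rightarrow> 'v \<Rightarrow> 'v" where
  "number_energy F x =
     Sum_any (\<lambda>n::nat. if 1 \<le> n
       then fscale F (of_nat n) (cre_a F n (ann_a F n x) + cre_b F n (ann_b F n x)) else 0)"

definition vacuum_state :: "'v::ab_group_add fock \<Rightarrow> complex \<Rightarrow> 'v" where
  "vacuum_state F \<alpha> =
     fscale F \<alpha> (vac F) + fscale F (of_real (sqrt (1 - (cmod \<alpha>)\<^sup>2))) (cre_a F 0 (vac F))"


section \<open>Representations of sl(2,R)\<close>

record 'v sl2_rep =
  rscale :: "complex \<Rightarrow> 'v \<Rightarrow> 'v"
  rip :: "'v \<Rightarrow> 'v \<Rightarrow> complex"
  rspace :: "'v set"
  r0 :: "'v \<Rightarrow> 'v"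
  rplus :: "'v \<Rightarrow> 'v"
  rminus :: "'v \<Rightarrow> 'v"

definition unitary_sl2_rep :: "'v::ab_group_add sl2_rep \<Rightarrow> bool" where
  "unitary_sl2_rep R \<longleftrightarrow>
     vector_space (rscale R) \<and>
     module.subspace (rscale R) (rspace R) \<and>
     inner_product_on (rscale R) (rspace R) (rip R) \<and>
     (\<forall>A\<in>{r0 R, rplus R, rminus R}.
        linear_from_to (rscale R) (rscale R) (rspace R) (rspace R) A) \<and>
     (\<forall>x\<in>rspace R.
        comm (r0 R) (rplus R) x = rplus R x \<and>
        comm (r0 R) (rminus R) x = - rminus R x \<and>
        comm (rplus R) (rminus R) x = rscale R 2 (r0 R x)) \<and>
     (\<forall>x\<in>rspace R. \<forall>y\<in>rspace R.
        rip R (rplus R x) y = - rip R x (rminus R y) \<and>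
        rip R (r0 R x) y = rip R x (r0 R y))"

definition irreducible_rep :: "'v::ab_group_add sl2_rep \<Rightarrow> bool" where
  "irreducible_rep R \<longleftrightarrow>
     rspace R \<noteq> {0} \<and>
     (\<forall>W. module.subspace (rscale R) W \<and> W \<subseteq> rspace R \<and> invariant {r0 R, rplus R, rminus R} W
        \<longrightarrow> W = {0} \<or> W = rspace R)"

definition weight_space :: "'v sl2_rep \<Rightarrow> complex \<Rightarrow> 'v set" where
  "weight_space R \<mu> = {x \<in> rspace R. r0 R x = rscale R \<mu> x}"

text \<open>\<open>R\<close> is (a realization of) the discrete series representation with lowest weight \<open>l\<close>.\<close>

definition discrete_series_plus :: "real \<Rightarrow> 'v::ab_group_add sl2_rep \<Rightarrow> bool" where
  "discrete_series_plus l R \<longleftrightarrow>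
     0 < l \<and> unitary_sl2_rep R \<and> irreducible_rep R \<and>
     {\<mu>. \<exists>x\<in>weight_space R \<mu>. x \<noteq> 0} = {of_real l + of_nat n | n :: nat. True} \<and>
     (\<forall>n::nat. vector_space.dim (rscale R) (weight_space R (of_real l + of_nat n)) = 1) \<and>
     (\<forall>x\<in>weight_space R (of_real l). rminus R x = 0)"

definition isomorphic_reps :: "'v::ab_group_add sl2_rep \<Rightarrow> 'w::ab_group_add sl2_rep \<Rightarrow> bool" where
  "isomorphic_reps R R' \<longleftrightarrow>
     (\<exists>U. linear_from_to (rscale R) (rscale R') (rspace R) (rspace R') U \<and>
        bij_betw U (rspace R) (rspace R') \<and>
        (\<forall>x\<in>rspace R. \<forall>y\<in>rspace R. rip R' (U x) (U y) = rip R x y) \<and>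
        (\<forall>x\<in>rspace R. U (r0 R x) = r0 R' (U x) \<and>
           U (rplus R x) = rplus R' (U x) \<and> U (rminus R x) = rminus R' (U x)))"

text \<open>The representation generated by a Fock vector under the three charges.\<close>

definition generated_rep ::
    "'v::ab_group_add fock \<Rightarrow> (int \<Rightarrow> real \<Rightarrow> complex ^ 2) \<Rightarrow> real \<Rightarrow> 'v \<Rightarrow> 'v sl2_rep" where
  "generated_rep F \<Phi> t v =
     \<lparr>rscale = fscale F, rip = fip F,
      rspace = \<Inter>{W. module.subspace (fscale F) W \<and> v \<in> W \<and>
        invariant {Lhat_zero F \<Phi> t, Lhat_plus F \<Phi> t, Lhat_minus F \<Phi> t} W},
      r0 = Lhat_zero F \<Phi> t, rplus = Lhat_plus F \<Phi> t, rminus = Lhat_minus F \<Phi> t\<rparr>"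

end

theory Submission
  imports Defs
begin

text \<open>
  A constant rotation of the spinor components turns every admissible theory into the Dirichlet
  type III problem for a mass of absolute value below \<open>1/2\<close>: type IV with mass \<open>M\<close> becomes type III with mass
  \<open>- M\<close>, and the massless boundary conditions become type III with mass \<open>0\<close>.

  Integrating the equation against the functions \<open>\<sigma>\<^bsup>-M\<^esup> cos \<rho> sin\<^bsup>k\<^esup> \<rho>\<close> gives a triangular recurrence for the
  moments \<open>\<integral> u cos \<rho> sin\<^bsup>k\<^esup> \<rho> d\<rho>\<close> of \<open>u = \<sigma>\<^bsup>-M\<^esup> \<Phi>\<^sup>(\<^sup>1\<^sup>)\<close>, whose diagonal coefficient is \<open>\<omega>\<^sup>2 - (k + 1)\<^sup>2\<close>.  By
  Weierstrass approximation a nonzero solution has a nonzero moment, so \<open>\<omega>\<close> is an integer, and a single moment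
  determines the solution.  On solutions the ladder operators act algebraically, by matrices with
  \<open>L\<^sub>- L\<^sub>+ = - ((n + 1/2)\<^sup>2 - M\<^sup>2)\<close>; this yields modes for all \<open>n\<close>, starting from the explicit one for \<open>n = 0\<close>,
  and the moduli of the matrix elements of \<open>L\<^sub>\<plusminus>\<close>.

  On Fock space an operator that commutes with all creation and annihilation operators and kills the vacuum is zero.
  Applied to \<open>[L\<^sub>+, L\<^sub>-] - 2 L\<^sub>0\<close> this gives the normal ordered energy, whose constant is the vacuum matrix element
  \<open>(1/4 - M\<^sup>2) / 2\<close>.  A lowest weight vector in a unitary representation determines the representation it generates,
  because its raised vectors are orthogonal with norms fixed by the weight.
\<close>

section \<open>Powers of \<open>\<sigma>\<close> on the strip\<close>

text \<open>The boundary condition controls one component only: u = sigma^(-M) U vanishes at the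
  ends, while V may grow like sigma^(-M). Each boundary term therefore pairs u with v = sigma^M V or
  carries a factor cos; |M| < 1/2 enters because sigma^(2M) is then integrable, which keeps v
  bounded, and because cos sigma^(-2M) then vanishes at the ends. Moments take the place of explicit
  hypergeometric eigenfunctions. Normalized modes have arbitrary phases, so the matrix element l n
  of \<open>L_plus\<close> from mode n to mode n + 1 is known only through |l n|^2 = (n + 1/2)^2 -
  M^2. This suffices: consecutive values differ by even integers, free of M, and the vacuum value of
  [L+, L-] comes from the single transition from the last filled level -1 to the empty level 0,
  where |l (-1)|^2 = 1/4 - M^2. Filling level 0 costs no energy, and lowering from it is blocked by
  the filled level -1; hence all superpositions of the two vacua are lowest weight vectors.\<close>

lemma strip_cos_pos: "\<rho> \<in> strip \<Longrightarrow> 0 < cos \<rho>"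
  by (simp add: cos_gt_zero_pi)

lemma strip_sin_bounds:
  assumes "\<rho> \<in> strip" shows "-1 < sin \<rho>" "sin \<rho> < 1"
proof -
  have "(sin \<rho>)\<^sup>2 < 1"
    using strip_cos_pos[OF assms] sin_cos_squared_add[of \<rho>] by (smt (verit) zero_less_power)
  then have "\<bar>sin \<rho>\<bar> < 1" by (simp add: abs_square_less_1)
  then show "-1 < sin \<rho>" "sin \<rho> < 1" by auto
qed

lemma sigma_eq:
  assumes "\<rho> \<in> strip" shows "sigma \<rho> = cos \<rho> / (1 + sin \<rho>)"
  unfolding sigma_def
proof (rule real_sqrt_unique)
  have "(1 + sin \<rho>) \<noteq> 0" using strip_sin_bounds[OF assms] by simp
  moreover have "(cos \<rho>)\<^sup>2 = (1 - sin \<rho>) * (1 + sin \<rho>)"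
    by (simp add: cos_squared_eq algebra_simps power2_eq_square)
  ultimately show "(cos \<rho> / (1 + sin \<rho>))\<^sup>2 = (1 - sin \<rho>) / (1 + sin \<rho>)"
    by (simp add: power_divide power2_eq_square)
  show "0 \<le> cos \<rho> / (1 + sin \<rho>)"
    using strip_sin_bounds[OF assms] strip_cos_pos[OF assms] by simp
qed

lemma sigma_pos: "\<rho> \<in> strip \<Longrightarrow> 0 < sigma \<rho>"
  using strip_sin_bounds strip_cos_pos by (fastforce simp: sigma_eq)

lemma sigma_deriv:
  assumes r: "\<rho> \<in> strip"
  shows "(sigma has_real_derivative - (sigma \<rho> / cos \<rho>)) (at \<rho>)"
proof (rule has_field_derivative_transform_within_open[where S=strip])
  have s: "1 + sin \<rho> \<noteq> 0" using strip_sin_bounds[OF r] by simp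
  have "- sin \<rho> * (1 + sin \<rho>) - cos \<rho> * cos \<rho> = - (1 + sin \<rho>)"
    using sin_cos_squared_add[of \<rho>] by (simp add: power2_eq_square algebra_simps)
  then have "(- sin \<rho> * (1 + sin \<rho>) - cos \<rho> * cos \<rho>) / ((1 + sin \<rho>) * (1 + sin \<rho>)) = - (sigma \<rho> / cos \<rho>)"
    using s strip_cos_pos[OF r] by (simp add: sigma_eq[OF r]) (simp add: divide_simps)
  then show "((\<lambda>\<rho>. cos \<rho> / (1 + sin \<rho>)) has_real_derivative - (sigma \<rho> / cos \<rho>)) (at \<rho>)"
    using s by (auto intro!: derivative_eq_intros)
qed (use r sigma_eq in auto)

lemma sigma_powr_deriv:
  assumes r: "\<rho> \<in> strip"
  shows "((\<lambda>x. sigma x powr p) has_real_derivative - (p * sigma \<rho> powr p / cos \<rho>)) (at \<rho>)"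
  using DERIV_fun_powr[OF sigma_deriv[OF r] sigma_pos[OF r], of p] sigma_pos[OF r]
  by (simp add: powr_diff)

lemma sigma_powr_continuous: "continuous_on strip (\<lambda>x. sigma x powr p)"
  using sigma_powr_deriv DERIV_isCont by (intro continuous_at_imp_continuous_on) blast

text \<open>From cos^2 = (1 - sin)(1 + sin), every factor is a power of 1 - sin or 1 + sin. For |p|
  < 1 both exponents are positive, so the product extends continuously to the closed interval and
  vanishes at its ends.\<close>

lemma cos_sigma_powr:
  assumes r: "\<rho> \<in> strip"
  shows "cos \<rho> * sigma \<rho> powr p = (1 - sin \<rho>) powr ((1 + p) / 2) * (1 + sin \<rho>) powr ((1 - p) / 2)"
proof -
  have a: "1 - sin \<rho> > 0" "1 + sin \<rho> > 0" using strip_sin_bounds[OF r] by auto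
  have "cos \<rho> = sqrt ((1 - sin \<rho>) * (1 + sin \<rho>))"
    using strip_cos_pos[OF r] by (intro real_sqrt_unique[symmetric])
      (simp_all add: cos_squared_eq algebra_simps power2_eq_square)
  also have "\<dots> = (1 - sin \<rho>) powr (1/2) * (1 + sin \<rho>) powr (1/2)"
    using a by (simp add: powr_half_sqrt real_sqrt_mult)
  finally have c: "cos \<rho> = (1 - sin \<rho>) powr (1/2) * (1 + sin \<rho>) powr (1/2)" .
  have s: "sigma \<rho> = (1 - sin \<rho>) powr (1/2) * (1 + sin \<rho>) powr (-1/2)"
    using a unfolding sigma_def by (simp add: powr_half_sqrt real_sqrt_divide powr_minus_divide)
  have "sigma \<rho> powr p = (1 - sin \<rho>) powr (p/2) * (1 + sin \<rho>) powr (-p/2)"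
    unfolding s using a by (simp add: powr_mult powr_powr)
  then have "cos \<rho> * sigma \<rho> powr p =
      ((1 - sin \<rho>) powr (1/2) * (1 - sin \<rho>) powr (p/2)) *
      ((1 + sin \<rho>) powr (1/2) * (1 + sin \<rho>) powr (-p/2))"
    by (subst c) simp
  also have "\<dots> = (1 - sin \<rho>) powr ((1 + p) / 2) * (1 + sin \<rho>) powr ((1 - p) / 2)"
    using a by (simp add: powr_add[symmetric] add_divide_distrib diff_divide_distrib)
  finally show ?thesis .
qed

section \<open>Limits and integrals over the open strip\<close>

text \<open>For u = sigma^(-M) U this is the Dirichlet type III condition; for a primitive it says
  that the boundary terms drop out.\<close>

definition ends0 :: "(real \<Rightarrow> 'a::real_normed_vector) \<Rightarrow> bool" where
  "ends0 f \<longleftrightarrow> (f \<longlongrightarrow> 0) (at_left (pi / 2)) \<and> (f \<longlongrightarrow> 0) (at_right (- (pi / 2)))"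

lemma eventually_strip:
  "eventually (\<lambda>\<rho>. \<rho> \<in> strip) (at_left (pi / 2))"
  "eventually (\<lambda>\<rho>. \<rho> \<in> strip) (at_right (- (pi / 2)))"
  using eventually_at_left_real[of "-(pi/2)" "pi/2"] eventually_at_right_real[of "-(pi/2)" "pi/2"]
  by auto

lemma ends0_cong:
  assumes "\<And>\<rho>. \<rho> \<in> strip \<Longrightarrow> f \<rho> = g \<rho>"
  shows "ends0 f \<longleftrightarrow> ends0 g"
proof -
  have "eventually (\<lambda>\<rho>. f \<rho> = g \<rho>) (at_left (pi / 2))"
       "eventually (\<lambda>\<rho>. f \<rho> = g \<rho>) (at_right (-(pi / 2)))"
    using eventually_strip assms by (auto elim!: eventually_mono)
  then show ?thesis unfolding ends0_def by (simp only: tendsto_cong)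
qed

lemma ends0_bounded_mult:
  fixes f g :: "real \<Rightarrow> complex"
  assumes "ends0 f" and "\<And>\<rho>. \<rho> \<in> strip \<Longrightarrow> norm (g \<rho>) \<le> C"
  shows "ends0 (\<lambda>\<rho>. f \<rho> * g \<rho>)"
proof -
  have b: "Bfun g (at_left (pi / 2))" "Bfun g (at_right (-(pi / 2)))"
    using eventually_strip assms(2)
    by (auto intro!: BfunI[where K=C] elim!: eventually_mono)
  show ?thesis
    using assms(1) b unfolding ends0_def tendsto_Zfun_iff
    by (auto intro!: bounded_bilinear.Zfun_prod_Bfun[OF bounded_bilinear_mult])
qed

lemma ends0_cos_sigma:
  assumes "\<bar>p\<bar> < 1"
  shows "ends0 (\<lambda>\<rho>. cos \<rho> * sigma \<rho> powr p)"
proof -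
  let ?F = "\<lambda>\<rho>::real. (1 - sin \<rho>) powr ((1 + p) / 2) * (1 + sin \<rho>) powr ((1 - p) / 2)"
  have c: "isCont ?F x" for x
  proof -
    \<comment> \<open>Continuity of \<open>powr\<close> where the base reaches 0, as it does at the
      end points, requires a nonnegative base and a positive exponent.\<close>
    have "0 \<le> 1 + sin y" for y :: real using sin_ge_minus_one[of y] by linarith
    then have "continuous_on UNIV ?F"
      using assms by (intro continuous_on_mult continuous_on_powr') (auto intro!: continuous_intros)
    then show ?thesis by (simp add: continuous_on_eq_continuous_at)
  qed
  have "(?F \<longlongrightarrow> ?F (pi/2)) (at_left (pi / 2))" "(?F \<longlongrightarrow> ?F (-(pi/2))) (at_right (-(pi / 2)))"
    using c[of "pi/2"] c[of "-(pi/2)"] unfolding isCont_def filterlim_at_split by blast+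
  then have "ends0 ?F" using assms unfolding ends0_def by simp
  then show ?thesis by (subst ends0_cong[OF cos_sigma_powr])
qed

text \<open>Moves a function with limits to a compact interval, where boundedness, the fundamental
  theorem and Weierstrass approximation are available.\<close>

lemma strip_continuous_extension:
  fixes f :: "real \<Rightarrow> complex"
  assumes "continuous_on strip f" "(f \<longlongrightarrow> l) (at_left (pi / 2))" "(f \<longlongrightarrow> r) (at_right (- (pi / 2)))"
  shows "\<exists>g. continuous_on {-(pi/2)..pi/2} g \<and> g (pi/2) = l \<and> g (-(pi/2)) = r \<and> (\<forall>\<rho>\<in>strip. g \<rho> = f \<rho>)"
proof -
  define g where "g x = (if x = pi/2 then l else if x = -(pi/2) then r else f x)" for x
  have eq: "g \<rho> = f \<rho>" if "\<rho> \<in> strip" for \<rho> using that by (auto simp: g_def)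
  have e: "eventually (\<lambda>\<rho>. f \<rho> = g \<rho>) (at_left (pi / 2))"
       "eventually (\<lambda>\<rho>. f \<rho> = g \<rho>) (at_right (-(pi / 2)))"
    using eventually_strip eq by (auto elim!: eventually_mono)
  have "continuous_on {-(pi/2)..pi/2} g"
  proof (rule continuous_on_IccI)
    show "(g \<longlongrightarrow> g (- (pi / 2))) (at_right (- (pi / 2)))"
      using assms(3) unfolding tendsto_cong[OF e(2)] by (simp add: g_def)
    show "(g \<longlongrightarrow> g (pi / 2)) (at_left (pi / 2))"
      using assms(2) unfolding tendsto_cong[OF e(1)] by (simp add: g_def)
    fix x assume x: "- (pi / 2) < x" "x < pi/2"
    have "continuous_on strip g" using assms(1) eq by (metis continuous_on_cong)
    then show "g \<midarrow>x\<rightarrow> g x" using x continuous_on_eq_continuous_at[of strip g] by (simp add: isCont_def)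
  qed (use pi_gt_zero in linarith)
  moreover have "g (pi/2) = l" "g (-(pi/2)) = r" by (simp_all add: g_def)
  ultimately show ?thesis using eq by blast
qed

lemma strip_bounded:
  fixes f :: "real \<Rightarrow> complex"
  assumes "continuous_on strip f" "(f \<longlongrightarrow> l) (at_left (pi / 2))" "(f \<longlongrightarrow> r) (at_right (- (pi / 2)))"
  obtains C where "\<And>\<rho>. \<rho> \<in> strip \<Longrightarrow> norm (f \<rho>) \<le> C"
proof -
  obtain g where g: "continuous_on {-(pi/2)..pi/2} g" "\<forall>\<rho>\<in>strip. g \<rho> = f \<rho>"
    using strip_continuous_extension[OF assms] by blast
  have "bounded (g ` {-(pi/2)..pi/2})"
    using g(1) compact_continuous_image compact_imp_bounded compact_Icc by blast
  then obtain C where "\<forall>x\<in>{-(pi/2)..pi/2}. norm (g x) \<le> C" unfolding bounded_iff by blast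
  then have "norm (f \<rho>) \<le> C" if "\<rho> \<in> strip" for \<rho>
    using that bspec[OF g(2) that] greaterThanLessThan_subseteq_atLeastAtMost_iff
    by (metis greaterThanLessThan_iff atLeastAtMost_iff order_less_imp_le)
  then show ?thesis by (rule that)
qed

text \<open>Every integration by parts below has this form: the integrand is exhibited as the
  derivative of some \<open>B\<close> that vanishes at the ends. The gauge integral yields existence
  together with the value, and \<open>set_integral_strip_eqI\<close> carries the value over to the
  Lebesgue integral.\<close>

lemma strip_has_integral_zero:
  fixes B :: "real \<Rightarrow> complex"
  assumes d: "\<And>\<rho>. \<rho> \<in> strip \<Longrightarrow> (B has_vector_derivative B' \<rho>) (at \<rho>)" and "ends0 B"
  shows "(B' has_integral 0) {-(pi/2)..pi/2}"
proof -
  have "continuous_on strip B"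
    using d by (intro continuous_at_imp_continuous_on) (blast intro: has_vector_derivative_continuous)
  then obtain g where g: "continuous_on {-(pi/2)..pi/2} g" "g (pi/2) = 0" "g (-(pi/2)) = 0"
    "\<forall>\<rho>\<in>strip. g \<rho> = B \<rho>"
    using assms(2) strip_continuous_extension[of B 0 0] unfolding ends0_def by blast
  have "(B' has_integral (g (pi/2) - g (-(pi/2)))) {-(pi/2)..pi/2}"
  proof (rule fundamental_theorem_of_calculus_interior)
    fix x assume "x \<in> strip"
    then show "(g has_vector_derivative B' x) (at x)"
      using d g(4) by (auto intro!: has_vector_derivative_transform_within_open[of B "B' x" x strip g])
  qed (use g pi_gt_zero in auto)
  then show ?thesis using g by simp
qed

lemma set_integral_strip_eqI:
  fixes f :: "real \<Rightarrow> complex"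
  assumes "set_integrable lborel strip f" "(f has_integral I) {-(pi/2)..pi/2}"
  shows "set_lebesgue_integral lborel strip f = I"
proof -
  have "(f has_integral (set_lebesgue_integral lborel strip f)) strip"
    using has_integral_set_lebesgue[of strip f] set_borel_integral_eq_integral[OF assms(1)]
    by (simp add: has_integral_iff)
  then show ?thesis
    using assms(2) has_integral_unique has_integral_Icc_iff_Ioo by blast
qed

section \<open>Integrability of powers of sigma\<close>

text \<open>With x = pi/4 + y/2, half-angle formulas give cos y / (1 + sin y) = cot x, and x <= tan
  x gives cot x <= 1/x. The second bound is the first one at the reflected point, since reflection
  inverts sigma.\<close>

lemma sigma_bounds:
  assumes r: "\<rho> \<in> strip"
  shows "sigma \<rho> \<le> 2 / (pi / 2 + \<rho>)" "1 / sigma \<rho> \<le> 2 / (pi / 2 - \<rho>)"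
proof -
  have key: "cos y / (1 + sin y) \<le> 2 / (pi / 2 + y)" if y: "y \<in> strip" for y
  proof -
    define x where "x = pi/4 + y/2"
    have x: "0 < x" "x < pi/2" using y by (auto simp: x_def)
    have yx: "y = 2 * x - pi/2" by (simp add: x_def)
    have sn: "sin x > 0" "cos x > 0" using x by (auto intro: sin_gt_zero cos_gt_zero)
    have "x \<le> tan x" using x abs_tan_ge[of x] tan_gt_zero[of x] by simp
    then have "x * cos x \<le> sin x" using sn by (simp add: tan_def field_simps)
    moreover have "cos y = 2 * sin x * cos x" "1 + sin y = 2 * (sin x)^2"
      unfolding yx by (simp_all add: cos_diff sin_diff sin_double cos_double_sin)
    ultimately have "cos y / (1 + sin y) \<le> 1 / x"
      using sn x by (simp add: field_simps power2_eq_square)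
    also have "1 / x = 2 / (pi/2 + y)" unfolding x_def using y by (simp add: field_simps)
    finally show ?thesis .
  qed
  show "sigma \<rho> \<le> 2 / (pi / 2 + \<rho>)" using key[OF r] by (simp add: sigma_eq[OF r])
  have m: "-\<rho> \<in> strip" using r by auto
  have "1 / sigma \<rho> = cos (-\<rho>) / (1 + sin (-\<rho>))"
  proof -
    have "(1 + sin \<rho>) * (1 - sin \<rho>) = cos \<rho> * cos \<rho>"
      using sin_cos_squared_add[of \<rho>] by (simp add: power2_eq_square algebra_simps)
    then show ?thesis using strip_sin_bounds[OF r] strip_cos_pos[OF r] by (simp add: sigma_eq[OF r] field_simps)
  qed
  then show "1 / sigma \<rho> \<le> 2 / (pi / 2 - \<rho>)" using key[OF m] by simp
qed

lemma strip_measurable: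
  fixes f :: "real \<Rightarrow> 'a::{banach, second_countable_topology}"
  assumes "continuous_on strip f"
  shows "set_borel_measurable lborel strip f"
  unfolding set_borel_measurable_def using assms
  by (simp add: borel_measurable_continuous_on_indicator)

lemma set_integrable_powr_strip:
  fixes p :: real assumes "-1 < p"
  shows "set_integrable lborel strip (\<lambda>x. (pi/2 + x) powr p)"
        "set_integrable lborel strip (\<lambda>x. (pi/2 - x) powr p)"
proof -
  have i: "((\<lambda>x. x powr p) has_integral (pi powr (p+1) / (p+1))) {0..pi}"
    using has_integral_powr_from_0[of p pi] assms by simp
  have a: "(\<lambda>x. x powr p) absolutely_integrable_on {0..pi}"
    using i by (intro nonnegative_absolutely_integrable_1) (auto simp: integrable_on_def)
  \<comment> \<open>Absolute integrability refers to the completed measure; Borel measurability of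
    the power function brings it down to \<open>lborel\<close>.\<close>
  have 1: "integrable lborel (\<lambda>x. indicator {0..pi} x *\<^sub>R x powr p)"
  proof -
    have "(\<lambda>x. indicator {0..pi} x *\<^sub>R x powr p) \<in> borel_measurable borel" by measurable
    then show ?thesis using a unfolding set_integrable_def
      by (subst (asm) integrable_completion) simp_all
  qed
  have "set_integrable lborel {-(pi/2)..pi/2} (\<lambda>x. (pi/2 + x) powr p)"
    unfolding set_integrable_def
    using lborel_integrable_real_affine[OF 1, of 1 "pi/2"]
    by (rule Bochner_Integration.integrable_cong[THEN iffD1, rotated 2]) (auto simp: indicator_def)
  then show "set_integrable lborel strip (\<lambda>x. (pi/2 + x) powr p)"
    by (rule set_integrable_subset) auto
  have "set_integrable lborel {-(pi/2)..pi/2} (\<lambda>x. (pi/2 - x) powr p)"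
    unfolding set_integrable_def
    using lborel_integrable_real_affine[OF 1, of "-1" "pi/2"]
    by (rule Bochner_Integration.integrable_cong[THEN iffD1, rotated 2]) (auto simp: indicator_def)
  then show "set_integrable lborel strip (\<lambda>x. (pi/2 - x) powr p)"
    by (rule set_integrable_subset) auto
qed

text \<open>Only one end is singular, -pi/2 for p > 0 and pi/2 for p < 0, and there the growth is at
  most that of the distance to the power -|p|.\<close>

lemma sigma_powr_integrable:
  assumes "\<bar>p\<bar> < 1" shows "set_integrable lborel strip (\<lambda>x. sigma x powr p)"
proof -
  have dominated: "set_integrable lborel strip (\<lambda>x. sigma x powr p)"
    if "set_integrable lborel strip g" "\<And>x. x \<in> strip \<Longrightarrow> sigma x powr p \<le> 2 powr \<bar>p\<bar> * g x" for g :: "real \<Rightarrow> real"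
  proof (rule set_integrable_bound)
    show "set_integrable lborel strip (\<lambda>x. 2 powr \<bar>p\<bar> * g x)" using that(1) by simp
    show "set_borel_measurable lborel strip (\<lambda>x. sigma x powr p)"
      by (rule strip_measurable[OF sigma_powr_continuous])
    have "norm (sigma x powr p) \<le> norm (2 powr \<bar>p\<bar> * g x)" if "x \<in> strip" for x
      unfolding real_norm_def abs_of_nonneg[OF powr_ge_zero]
      by (rule order_trans[OF \<open>\<And>x. x \<in> strip \<Longrightarrow> sigma x powr p \<le> 2 powr \<bar>p\<bar> * g x\<close>[OF that] abs_ge_self])
    then show "AE x in lborel. x \<in> strip \<longrightarrow> norm (sigma x powr p) \<le> norm (2 powr \<bar>p\<bar> * g x)" by blast
  qed
  show ?thesis
  proof (cases "p \<ge> 0")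
    case True
    show ?thesis
    proof (rule dominated[of "\<lambda>x. (pi/2 + x) powr (- p)"])
      fix x assume x: "x \<in> strip"
      have "sigma x powr p \<le> (2 / (pi / 2 + x)) powr p"
        using sigma_bounds[OF x] sigma_pos[OF x] True by (intro powr_mono2) auto
      also have "\<dots> = 2 powr \<bar>p\<bar> * (pi/2 + x) powr (- p)"
        using x True by (simp add: powr_divide powr_minus_divide)
      finally show "sigma x powr p \<le> 2 powr \<bar>p\<bar> * (pi/2 + x) powr (- p)" .
    qed (rule set_integrable_powr_strip, use assms in simp)
  next
    case False
    show ?thesis
    proof (rule dominated[of "\<lambda>x. (pi/2 - x) powr p"])
      fix x assume x: "x \<in> strip"
      have "sigma x powr p = (1 / sigma x) powr (- p)"
        using sigma_pos[OF x] by (simp add: powr_divide powr_minus_divide)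
      also have "\<dots> \<le> (2 / (pi / 2 - x)) powr (- p)"
        using sigma_bounds[OF x] sigma_pos[OF x] False by (intro powr_mono2) auto
      also have "\<dots> = 2 powr \<bar>p\<bar> * (pi/2 - x) powr p"
        using x False by (simp add: powr_divide powr_minus_divide)
      finally show "sigma x powr p \<le> 2 powr \<bar>p\<bar> * (pi/2 - x) powr p" .
    qed (rule set_integrable_powr_strip, use assms in simp)
  qed
qed

section \<open>The reduced Dirac equation\<close>

definition csig :: "real \<Rightarrow> real \<Rightarrow> complex" where
  "csig p \<rho> = of_real (sigma \<rho> powr p)"

lemma csig_add: "csig p \<rho> * csig q \<rho> = csig (p + q) \<rho>"
  by (simp add: csig_def powr_add)

lemma csig_add': "csig p \<rho> * (csig q \<rho> * z) = csig (p + q) \<rho> * z"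
  by (simp add: csig_def powr_add)

lemma csig_0: "\<rho> \<in> strip \<Longrightarrow> csig 0 \<rho> = 1"
  using sigma_pos[of \<rho>] by (simp add: csig_def)

lemma csig_nonzero: "\<rho> \<in> strip \<Longrightarrow> csig p \<rho> \<noteq> 0"
  using sigma_pos[of \<rho>] by (simp add: csig_def)

lemma csig_deriv:
  "\<rho> \<in> strip \<Longrightarrow> (csig p has_vector_derivative - of_real (p / cos \<rho>) * csig p \<rho>) (at \<rho>)"
  unfolding csig_def
  by (rule has_vector_derivative_eq_rhs, rule has_vector_derivative_of_real[OF sigma_powr_deriv]) simp_all

text \<open>The eigenvalue equation solved for the derivatives, with the type III condition. M may
  be negative, which covers type IV, and U and V may vanish identically, so that the solutions at a
  given w form a vector space.\<close>

definition dirac_pair :: "real \<Rightarrow> complex \<Rightarrow> (real \<Rightarrow> complex) \<Rightarrow> (real \<Rightarrow> complex) \<Rightarrow> bool" where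
  "dirac_pair M w U V \<longleftrightarrow>
     (\<forall>\<rho>\<in>strip. (U has_vector_derivative (w * V \<rho> - of_real (M / cos \<rho>) * U \<rho>)) (at \<rho>) \<and>
       (V has_vector_derivative (of_real (M / cos \<rho>) * V \<rho> - w * U \<rho>)) (at \<rho>)) \<and>
     ends0 (\<lambda>\<rho>. csig (- M) \<rho> * U \<rho>)"

lemma dirac_pairD:
  assumes "dirac_pair M w U V"
  shows "\<And>\<rho>. \<rho> \<in> strip \<Longrightarrow> (U has_vector_derivative (w * V \<rho> - of_real (M / cos \<rho>) * U \<rho>)) (at \<rho>)"
    "\<And>\<rho>. \<rho> \<in> strip \<Longrightarrow> (V has_vector_derivative (of_real (M / cos \<rho>) * V \<rho> - w * U \<rho>)) (at \<rho>)"
    "ends0 (\<lambda>\<rho>. csig (- M) \<rho> * U \<rho>)"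
  using assms by (auto simp: dirac_pair_def simp del: greaterThanLessThan_iff)

text \<open>sigma^(-M) is an integrating factor: its logarithmic derivative M / cos cancels the mass
  term.\<close>

lemma csig_mult_deriv_U:
  assumes "dirac_pair M w U V" "\<rho> \<in> strip"
  shows "((\<lambda>\<rho>. csig (- M) \<rho> * U \<rho>) has_vector_derivative w * (csig (- M) \<rho> * V \<rho>)) (at \<rho>)"
  by (rule has_vector_derivative_eq_rhs,
      rule has_vector_derivative_mult[OF csig_deriv[OF assms(2)] dirac_pairD(1)[OF assms]])
    (simp add: algebra_simps)

text \<open>The value p = M cancels the mass term of the second component; p = -M, the weight that
  suits U, doubles it.\<close>

lemma csig_mult_deriv_V:
  assumes "dirac_pair M w U V" "\<rho> \<in> strip"
  shows "((\<lambda>\<rho>. csig p \<rho> * V \<rho>) has_vector_derivative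
    of_real ((M - p) / cos \<rho>) * (csig p \<rho> * V \<rho>) - w * (csig p \<rho> * U \<rho>)) (at \<rho>)"
  by (rule has_vector_derivative_eq_rhs,
      rule has_vector_derivative_mult[OF csig_deriv[OF assms(2)] dirac_pairD(2)[OF assms]])
    (simp add: algebra_simps diff_divide_distrib)

lemma continuous_on_strip_of_deriv:
  assumes "\<And>\<rho>. \<rho> \<in> strip \<Longrightarrow> (f has_vector_derivative f' \<rho>) (at \<rho>)"
  shows "continuous_on strip f"
  using assms by (intro continuous_at_imp_continuous_on) (blast intro: has_vector_derivative_continuous)

lemmas dirac_pair_continuous =
  continuous_on_strip_of_deriv[OF dirac_pairD(1)] continuous_on_strip_of_deriv[OF dirac_pairD(2)]

lemma csig_continuous: "continuous_on strip (csig p)"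
  by (rule continuous_on_strip_of_deriv[OF csig_deriv])

lemma csig_integrable: "\<bar>p\<bar> < 1 \<Longrightarrow> set_integrable lborel strip (csig p)"
  unfolding csig_def using sigma_powr_integrable[of p]
  by (simp add: set_integrable_def scaleR_conv_of_real flip: of_real_mult)

lemma strip_mult_bounded_integrable:
  fixes f g h :: "real \<Rightarrow> complex"
  assumes "set_integrable lborel strip h" "continuous_on strip f"
    "\<And>\<rho>. \<rho> \<in> strip \<Longrightarrow> f \<rho> = h \<rho> * g \<rho>" "\<And>\<rho>. \<rho> \<in> strip \<Longrightarrow> norm (g \<rho>) \<le> C"
  shows "set_integrable lborel strip f"
proof -
  have "set_integrable lborel strip (\<lambda>\<rho>. of_real C * h \<rho>)" using assms(1) by simp
  then show ?thesis
  proof (rule set_integrable_bound)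
    show "set_borel_measurable lborel strip f" by (rule strip_measurable[OF assms(2)])
    have "norm (f x) \<le> norm (complex_of_real C * h x)" if x: "x \<in> strip" for x
    proof -
      have "0 \<le> C" using assms(4)[OF x] norm_ge_zero order_trans by blast
      then show ?thesis using assms(3,4)[OF x]
        by (simp add: norm_mult mult.commute mult_right_mono)
    qed
    then show "AE x in lborel. x \<in> strip \<longrightarrow> norm (f x) \<le> norm (complex_of_real C * h x)" by blast
  qed
qed

section \<open>Behaviour of solutions at the ends\<close>

lemma dirac_pair_u_bounded:
  assumes "dirac_pair M w U V"
  obtains C where "\<And>\<rho>. \<rho> \<in> strip \<Longrightarrow> norm (csig (- M) \<rho> * U \<rho>) \<le> C"
  using strip_bounded[OF continuous_on_strip_of_deriv[OF csig_mult_deriv_U[OF assms]]]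
    dirac_pairD(3)[OF assms] unfolding ends0_def by blast

text \<open>\<open>v = \<sigma>\<^sup>M V\<close> has derivative \<open>- w \<sigma>\<^bsup>2M\<^esup> u\<close> with \<open>u\<close> bounded, and \<open>\<sigma>\<^bsup>2M\<^esup>\<close> is integrable.\<close>

lemma dirac_pair_v_limits:
  assumes d: "dirac_pair M w U V" and M: "\<bar>M\<bar> < 1 / 2"
  shows "\<exists>l r. ((\<lambda>\<rho>. csig M \<rho> * V \<rho>) \<longlongrightarrow> l) (at_left (pi / 2)) \<and>
    ((\<lambda>\<rho>. csig M \<rho> * V \<rho>) \<longlongrightarrow> r) (at_right (- (pi / 2)))"
proof -
  let ?a = "-(pi/2)" and ?b = "pi/2"
  define g where "g \<rho> = - (w * (csig M \<rho> * U \<rho>))" for \<rho>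
  let ?v = "\<lambda>\<rho>. csig M \<rho> * V \<rho>"
  have ab: "?a < ?b" using pi_gt_zero by linarith
  have vd: "(?v has_vector_derivative g \<rho>) (at \<rho>)" if "\<rho> \<in> strip" for \<rho>
    using csig_mult_deriv_V[OF d that, of M] by (simp add: g_def)
  obtain C where C: "\<And>\<rho>. \<rho> \<in> strip \<Longrightarrow> norm (csig (- M) \<rho> * U \<rho>) \<le> C"
    using dirac_pair_u_bounded[OF d] by blast
  have gc: "continuous_on strip g" unfolding g_def
    by (intro continuous_intros csig_continuous dirac_pair_continuous(1)[OF d])
  have "set_integrable lborel strip g"
  proof (rule strip_mult_bounded_integrable[where h="csig (2*M)" and g="\<lambda>\<rho>. - w * (csig (- M) \<rho> * U \<rho>)" and C="norm w * C"])
    show "set_integrable lborel strip (csig (2 * M))" using M by (intro csig_integrable) auto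
    show "g \<rho> = csig (2 * M) \<rho> * (- w * (csig (- M) \<rho> * U \<rho>))" for \<rho>
    proof -
      have "csig (2 * M) \<rho> * (- w * (csig (- M) \<rho> * U \<rho>)) = - w * ((csig (2 * M) \<rho> * csig (- M) \<rho>) * U \<rho>)"
        by (simp only: mult_ac)
      then show ?thesis using csig_add[of "2 * M" \<rho> "- M"] unfolding g_def by simp
    qed
    show "norm (- w * (csig (- M) \<rho> * U \<rho>)) \<le> norm w * C" if "\<rho> \<in> strip" for \<rho>
      using C[OF that] by (simp add: norm_mult mult_left_mono)
  qed (rule gc)
  then have gi: "g integrable_on {?a..?b}"
    using set_borel_integral_eq_integral(1) integrable_on_Icc_iff_Ioo by blast
  define G where "G x = integral {?a..x} g" for x
  have Gc: "continuous_on {?a..?b} G" unfolding G_def by (rule indefinite_integral_continuous_1[OF gi])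
  have Gd: "(G has_vector_derivative g x) (at x)" if x: "x \<in> strip" for x
  proof -
    have "isCont g x" using gc x continuous_on_eq_continuous_at open_greaterThanLessThan by blast
    then have "(G has_vector_derivative g x) (at x within ({?a..?b} - {}))"
      unfolding G_def using x
      by (intro integral_has_vector_derivative_continuous_at[OF gi]) (auto intro: continuous_at_imp_continuous_at_within)
    then show ?thesis using x at_within_Icc_at[of ?a x ?b] by simp
  qed
  have "((\<lambda>x. ?v x - G x) has_vector_derivative 0) (at x within strip)" if "x \<in> strip" for x
    using has_vector_derivative_diff[OF vd[OF that] Gd[OF that]]
    by (auto intro: has_vector_derivative_at_within)
  then obtain c where c: "\<And>x. x \<in> strip \<Longrightarrow> ?v x - G x = c"
    using has_vector_derivative_zero_constant[of strip "\<lambda>x. ?v x - G x"] by auto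
  have vG: "?v x = G x + c" if "x \<in> strip" for x using c[OF that] by (simp add: algebra_simps)
  have e: "eventually (\<lambda>x. G x + c = ?v x) (at_left ?b)" "eventually (\<lambda>x. G x + c = ?v x) (at_right ?a)"
    using eventually_strip vG by (auto elim!: eventually_mono)
  have "((\<lambda>x. G x + c) \<longlongrightarrow> G ?b + c) (at_left ?b)"
    using Gc ab continuous_on_Icc_at_leftD by (intro tendsto_intros) blast
  moreover have "((\<lambda>x. G x + c) \<longlongrightarrow> G ?a + c) (at_right ?a)"
    using Gc ab continuous_on_Icc_at_rightD by (intro tendsto_intros) blast
  ultimately show ?thesis unfolding tendsto_cong[OF e(1)] tendsto_cong[OF e(2)] by blast
qed

lemma dirac_pair_v_bounded:
  assumes d: "dirac_pair M w U V" and M: "\<bar>M\<bar> < 1 / 2"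
  obtains C where "\<And>\<rho>. \<rho> \<in> strip \<Longrightarrow> norm (csig M \<rho> * V \<rho>) \<le> C"
proof -
  have "continuous_on strip (\<lambda>\<rho>. csig M \<rho> * V \<rho>)"
    by (intro continuous_intros csig_continuous dirac_pair_continuous(2)[OF d])
  then show ?thesis using dirac_pair_v_limits[OF d M] strip_bounded that by blast
qed

lemma dirac_pair_bounded:
  assumes d: "dirac_pair M w U V" and M: "\<bar>M\<bar> < 1 / 2"
  obtains C where "\<And>\<rho>. \<rho> \<in> strip \<Longrightarrow> norm (csig (- M) \<rho> * U \<rho>) \<le> C"
    "\<And>\<rho>. \<rho> \<in> strip \<Longrightarrow> norm (csig M \<rho> * V \<rho>) \<le> C"
proof -
  obtain C1 where 1: "\<And>\<rho>. \<rho> \<in> strip \<Longrightarrow> norm (csig (- M) \<rho> * U \<rho>) \<le> C1"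
    using dirac_pair_u_bounded[OF d] by blast
  obtain C2 where 2: "\<And>\<rho>. \<rho> \<in> strip \<Longrightarrow> norm (csig M \<rho> * V \<rho>) \<le> C2"
    using dirac_pair_v_bounded[OF assms] by blast
  show ?thesis
    by (rule that[of "max C1 C2"]) (blast intro: order_trans[OF 1 max.cobounded1] order_trans[OF 2 max.cobounded2])+
qed

text \<open>The function is cos sigma^(-2M) times the bounded v = sigma^M V, and cos wins over
  sigma^(-2M) because |2M| < 1. This is why the test functions carry a factor cos.\<close>

lemma dirac_pair_cos_y_ends0:
  assumes d: "dirac_pair M w U V" and M: "\<bar>M\<bar> < 1 / 2"
  shows "ends0 (\<lambda>\<rho>. of_real (cos \<rho>) * (csig (- M) \<rho> * V \<rho>))"
proof -
  obtain C where C: "\<And>\<rho>. \<rho> \<in> strip \<Longrightarrow> norm (csig M \<rho> * V \<rho>) \<le> C"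
    using dirac_pair_v_bounded[OF assms] by blast
  have "ends0 (\<lambda>\<rho>. cos \<rho> * sigma \<rho> powr (- 2 * M))" using M by (intro ends0_cos_sigma) auto
  then have "ends0 (\<lambda>\<rho>. complex_of_real (cos \<rho> * sigma \<rho> powr (- 2 * M)))"
    unfolding ends0_def by (auto dest!: tendsto_of_real[where 'a=complex])
  then have "ends0 (\<lambda>\<rho>. complex_of_real (cos \<rho> * sigma \<rho> powr (- 2 * M)) * (csig M \<rho> * V \<rho>))"
    using C by (rule ends0_bounded_mult)
  moreover have "complex_of_real (cos \<rho> * sigma \<rho> powr (- 2 * M)) * (csig M \<rho> * V \<rho>) =
    of_real (cos \<rho>) * (csig (- M) \<rho> * V \<rho>)" for \<rho>
  proof -
    have "complex_of_real (cos \<rho> * sigma \<rho> powr (- 2 * M)) * (csig M \<rho> * V \<rho>) =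
      of_real (cos \<rho>) * ((csig (- 2 * M) \<rho> * csig M \<rho>) * V \<rho>)"
      by (simp add: csig_def)
    then show ?thesis unfolding csig_add by simp
  qed
  ultimately show ?thesis by (simp only:)
qed

text \<open>U is sigma^M times a bounded function and V is sigma^(-M) times one, so the products are
  dominated by multiples of sigma^(2M) and sigma^(-2M).\<close>

lemma dirac_pair_prod_integrable:
  assumes d: "dirac_pair M w U V" and d': "dirac_pair M w' U' V'" and M: "\<bar>M\<bar> < 1 / 2"
  shows "set_integrable lborel strip (\<lambda>\<rho>. cnj (U \<rho>) * U' \<rho>)"
    "set_integrable lborel strip (\<lambda>\<rho>. cnj (V \<rho>) * V' \<rho>)"
proof -
  obtain C where C: "\<And>\<rho>. \<rho> \<in> strip \<Longrightarrow> norm (csig (- M) \<rho> * U \<rho>) \<le> C"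
    "\<And>\<rho>. \<rho> \<in> strip \<Longrightarrow> norm (csig M \<rho> * V \<rho>) \<le> C"
    using dirac_pair_bounded[OF d M] by blast
  obtain C' where C': "\<And>\<rho>. \<rho> \<in> strip \<Longrightarrow> norm (csig (- M) \<rho> * U' \<rho>) \<le> C'"
    "\<And>\<rho>. \<rho> \<in> strip \<Longrightarrow> norm (csig M \<rho> * V' \<rho>) \<le> C'"
    using dirac_pair_bounded[OF d' M] by blast
  have gen: "set_integrable lborel strip (\<lambda>\<rho>. cnj (f \<rho>) * f' \<rho>)"
    if p: "\<bar>p\<bar> < 1/2" and f: "continuous_on strip f" "\<And>\<rho>. \<rho> \<in> strip \<Longrightarrow> norm (csig p \<rho> * f \<rho>) \<le> C"
    and f': "continuous_on strip f'" "\<And>\<rho>. \<rho> \<in> strip \<Longrightarrow> norm (csig p \<rho> * f' \<rho>) \<le> C'" for f f' p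
  proof (rule strip_mult_bounded_integrable[where h="csig (-2*p)" and C="C * C'"
        and g="\<lambda>\<rho>. cnj (csig p \<rho> * f \<rho>) * (csig p \<rho> * f' \<rho>)"])
    show "set_integrable lborel strip (csig (- 2 * p))" using p by (intro csig_integrable) auto
    show "continuous_on strip (\<lambda>\<rho>. cnj (f \<rho>) * f' \<rho>)" using f f' by (intro continuous_intros)
    fix \<rho> assume r: "\<rho> \<in> strip"
    have *: "csig (-2*p) \<rho> * cnj (csig p \<rho>) * csig p \<rho> = csig 0 \<rho>"
      using csig_add[of "-2*p" \<rho> p] csig_add[of "-p" \<rho> p] by (simp add: csig_def)
    show "cnj (f \<rho>) * f' \<rho> = csig (- 2 * p) \<rho> * (cnj (csig p \<rho> * f \<rho>) * (csig p \<rho> * f' \<rho>))"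
    proof -
      have "csig (- 2 * p) \<rho> * (cnj (csig p \<rho> * f \<rho>) * (csig p \<rho> * f' \<rho>)) =
        (csig (-2*p) \<rho> * cnj (csig p \<rho>) * csig p \<rho>) * (cnj (f \<rho>) * f' \<rho>)"
        by (simp only: mult_ac complex_cnj_mult)
      then show ?thesis unfolding * csig_0[OF r] by simp
    qed
    show "norm (cnj (csig p \<rho> * f \<rho>) * (csig p \<rho> * f' \<rho>)) \<le> C * C'"
      unfolding norm_mult[of "cnj _"] complex_mod_cnj
      using f(2)[OF r] f'(2)[OF r] order_trans[OF norm_ge_zero f(2)[OF r]]
      by (intro mult_mono norm_ge_zero)
  qed
  show "set_integrable lborel strip (\<lambda>\<rho>. cnj (U \<rho>) * U' \<rho>)"
    using gen[of "-M" U U'] M C C' dirac_pair_continuous(1)[OF d] dirac_pair_continuous(1)[OF d'] by simp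
  show "set_integrable lborel strip (\<lambda>\<rho>. cnj (V \<rho>) * V' \<rho>)"
    using gen[of "M" V V'] M C C' dirac_pair_continuous(2)[OF d] dirac_pair_continuous(2)[OF d'] by simp
qed

section \<open>Completeness of the moments\<close>

text \<open>In the variable s = sin \<rho> the weight cos becomes ds, so r(arcsin s) is orthogonal
  to all polynomials on [-1, 1]. Subtracting a polynomial approximation from one factor r leaves the
  integral E of r^2 cos unchanged and shows that it is arbitrarily small.\<close>

lemma real_moments_zero:
  fixes r :: "real \<Rightarrow> real"
  assumes c: "continuous_on {-(pi/2)..pi/2} r"
    and mom: "\<And>k. ((\<lambda>\<rho>. r \<rho> * (cos \<rho> * sin \<rho> ^ k)) has_integral 0) {-(pi/2)..pi/2}"
    and \<rho>: "\<rho> \<in> strip"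
  shows "r \<rho> = 0"
proof -
  let ?I = "{-(pi/2)..pi/2}"
  have cos0: "0 \<le> cos x" if "x \<in> ?I" for x using that by (intro cos_ge_zero) auto
  define E where "E = integral ?I (\<lambda>x. (r x)\<^sup>2 * cos x)"
  define K where "K = integral ?I (\<lambda>x. \<bar>r x\<bar> * cos x)"
  have cE: "continuous_on ?I (\<lambda>x. (r x)\<^sup>2 * cos x)" by (intro continuous_intros c)
  have K0: "0 \<le> K" unfolding K_def using cos0 by (intro integral_nonneg integrable_continuous_interval continuous_intros c) auto
  have bound: "\<bar>E\<bar> \<le> e * K" if e: "e > 0" for e
  proof -
    have "continuous_on {-1..1} (\<lambda>x. r (arcsin x))"
    proof (rule continuous_on_compose2[OF c])
      show "arcsin ` {-1..1} \<subseteq> ?I" using arcsin_bounded by fastforce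
    qed (auto intro!: continuous_intros)
    then obtain g where g: "real_polynomial_function g" "\<And>x. x \<in> {-1..1} \<Longrightarrow> \<bar>r (arcsin x) - g x\<bar> < e"
      using Stone_Weierstrass_real_polynomial_function[of "{-1..1}" _ e] e by auto
    obtain a n where gn: "g = (\<lambda>x. \<Sum>i\<le>n. a i * x ^ i)"
      using g(1) real_polynomial_function_iff_sum by auto
    have close: "\<bar>r x - g (sin x)\<bar> \<le> e" if "x \<in> ?I" for x
      using g(2)[of "sin x"] that by (simp add: arcsin_sin less_imp_le)
    have "((\<lambda>x. \<Sum>i\<le>n. a i * (r x * (cos x * sin x ^ i))) has_integral (\<Sum>i\<le>n. a i * 0)) ?I"
      by (intro has_integral_sum has_integral_mult_right mom) auto
    moreover have "(\<lambda>x. \<Sum>i\<le>n. a i * (r x * (cos x * sin x ^ i))) = (\<lambda>x. r x * cos x * g (sin x))"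
      unfolding gn by (simp add: sum_distrib_left mult_ac)
    ultimately have 0: "((\<lambda>x. r x * cos x * g (sin x)) has_integral 0) ?I" by simp
    have "((\<lambda>x. (r x)\<^sup>2 * cos x) has_integral E) ?I" unfolding E_def
      by (rule integrable_integral[OF integrable_continuous_interval[OF cE]])
    from has_integral_diff[OF this 0]
    have d: "((\<lambda>x. r x * cos x * (r x - g (sin x))) has_integral E) ?I"
      by (simp add: algebra_simps power2_eq_square)
    have Ki: "((\<lambda>x. e * (\<bar>r x\<bar> * cos x)) has_integral e * K) ?I" unfolding K_def
      by (intro has_integral_mult_right integrable_integral integrable_continuous_interval continuous_intros c)
    have "norm (integral ?I (\<lambda>x. r x * cos x * (r x - g (sin x)))) \<le> integral ?I (\<lambda>x. e * (\<bar>r x\<bar> * cos x))"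
    proof (rule integral_norm_bound_integral)
      fix x assume x: "x \<in> ?I"
      have "norm (r x * cos x * (r x - g (sin x))) = \<bar>r x\<bar> * cos x * \<bar>r x - g (sin x)\<bar>"
        using cos0[OF x] by (simp add: abs_mult)
      also have "\<dots> \<le> \<bar>r x\<bar> * cos x * e"
        using close[OF x] cos0[OF x] by (intro mult_left_mono) auto
      finally show "norm (r x * cos x * (r x - g (sin x))) \<le> e * (\<bar>r x\<bar> * cos x)" by (simp add: mult_ac)
    qed (use d Ki in \<open>auto simp: integrable_on_def\<close>)
    then show ?thesis unfolding integral_unique[OF d] integral_unique[OF Ki] real_norm_def .
  qed
  have "E = 0"
  proof (rule ccontr)
    assume "E \<noteq> 0"
    \<comment> \<open>This tolerance forces 2 (K + 1) <= K, which contradicts K >= 0; the summand 1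
      allows for K = 0.\<close>
    then have "\<bar>E\<bar> / (2 * (K + 1)) > 0" using K0 by simp
    from bound[OF this] have "\<bar>E\<bar> * (2 * (K + 1)) \<le> \<bar>E\<bar> * K" using K0 by (simp add: field_simps)
    then have "2 * (K + 1) \<le> K" using \<open>E \<noteq> 0\<close> by (subst (asm) mult_le_cancel_left_pos) auto
    then show False using K0 by simp
  qed
  have "(r \<rho>)\<^sup>2 * cos \<rho> = 0"
  proof (rule has_integral_0_cbox_imp_0[of "-(pi/2)" "pi/2" "\<lambda>x. (r x)\<^sup>2 * cos x"])
    show "((\<lambda>x. (r x)\<^sup>2 * cos x) has_integral 0) (cbox (- (pi / 2)) (pi / 2))"
      using integrable_integral[OF integrable_continuous_interval[OF cE]] \<open>E = 0\<close> by (simp add: E_def)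
    show "0 \<le> (r x)\<^sup>2 * cos x" if "x \<in> box (- (pi / 2)) (pi / 2)" for x
      using that cos0[of x] by (auto simp: box_real)
  qed (use cE \<rho> pi_gt_zero in auto)
  then show ?thesis using strip_cos_pos[OF \<rho>] by simp
qed

lemma complex_moments_zero:
  fixes f :: "real \<Rightarrow> complex"
  assumes c: "continuous_on {-(pi/2)..pi/2} f"
    and mom: "\<And>k. ((\<lambda>\<rho>. f \<rho> * of_real (cos \<rho> * sin \<rho> ^ k)) has_integral 0) {-(pi/2)..pi/2}"
    and \<rho>: "\<rho> \<in> strip"
  shows "f \<rho> = 0"
proof (rule complex_eqI)
  show "Re (f \<rho>) = Re 0"
    using real_moments_zero[OF continuous_on_Re[OF c] _ \<rho>] has_integral_linear[OF mom bounded_linear_Re]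
    by (simp add: o_def)
  show "Im (f \<rho>) = Im 0"
    using real_moments_zero[OF continuous_on_Im[OF c] _ \<rho>] has_integral_linear[OF mom bounded_linear_Im]
    by (simp add: o_def)
qed

section \<open>The moment recurrence\<close>

lemma ends0_add: "ends0 f \<Longrightarrow> ends0 g \<Longrightarrow> ends0 (\<lambda>x. f x + g x)"
  unfolding ends0_def by (auto intro: tendsto_add_zero)

lemma ends0_diff: "ends0 f \<Longrightarrow> ends0 g \<Longrightarrow> ends0 (\<lambda>x. f x - g x)"
  unfolding ends0_def using tendsto_diff[of f 0 _ g 0] by auto

lemma ends0_cmult: "ends0 f \<Longrightarrow> ends0 (\<lambda>x. c * f x)" for f :: "real \<Rightarrow> complex"
  unfolding ends0_def by (auto intro: tendsto_mult_right_zero)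

lemma ends0_mult_sin:
  fixes f :: "real \<Rightarrow> complex" and h :: "real \<Rightarrow> real"
  assumes "ends0 f" "continuous_on {-1..1} h"
  shows "ends0 (\<lambda>x. f x * of_real (h (sin x)))"
proof -
  have "bounded (h ` {-1..1})"
    using assms(2) compact_continuous_image compact_imp_bounded compact_Icc by blast
  then obtain C where "\<forall>x\<in>{-1..1}. norm (h x) \<le> C" unfolding bounded_iff by blast
  then show ?thesis using assms(1) by (intro ends0_bounded_mult[where C=C]) auto
qed

text \<open>Pairing the equation with the test function \<open>\<sigma>\<^bsup>-M\<^esup> cos \<rho> p(sin \<rho>)\<close>, which satisfies the
  boundary condition, and integrating by parts twice.\<close>

lemma dirac_pair_test_function:
  fixes p :: "real \<Rightarrow> real"
  assumes d: "dirac_pair M w U V" and M: "\<bar>M\<bar> < 1 / 2"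
    and p: "\<And>x. (p has_real_derivative p' x) (at x)" and p': "\<And>x. (p' has_real_derivative p'' x) (at x)"
  shows "((\<lambda>\<rho>. csig (- M) \<rho> * U \<rho> * of_real (cos \<rho>) * (w\<^sup>2 * of_real (p (sin \<rho>)) +
      of_real (2 * M * p' (sin \<rho>) - p (sin \<rho>) - 3 * sin \<rho> * p' (sin \<rho>)
        + (1 - (sin \<rho>)\<^sup>2) * p'' (sin \<rho>)))) has_integral 0) {-(pi/2)..pi/2}"
proof -
  \<comment> \<open>\<open>q (sin \<rho>)\<close> is A' + (2 M / cos) A for A = cos p(sin), the
    coefficient of y when A y is differentiated. It depends on \<rho> through sin alone.\<close>
  define q where "q x = 2 * M * p x - x * p x + (1 - x\<^sup>2) * p' x" for x
  define q' where "q' x = 2 * M * p' x - p x - 3 * x * p' x + (1 - x\<^sup>2) * p'' x" for x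
  define u where "u \<rho> = csig (- M) \<rho> * U \<rho>" for \<rho>
  define y where "y \<rho> = csig (- M) \<rho> * V \<rho>" for \<rho>
  define A where "A \<rho> = complex_of_real (cos \<rho> * p (sin \<rho>))" for \<rho>
  define Q where "Q \<rho> = complex_of_real (q (sin \<rho>))" for \<rho>
  have qd: "(q has_real_derivative q' x) (at x)" for x
    unfolding q_def[abs_def] q'_def
    by (rule derivative_eq_intros p p' refl | simp add: algebra_simps power2_eq_square)+
  have chain: "((\<lambda>\<rho>. f (sin \<rho>)) has_real_derivative f' (sin \<rho>) * cos \<rho>) (at \<rho>)"
    if "\<And>x. (f has_real_derivative f' x) (at x)" for f f' :: "real \<Rightarrow> real" and \<rho>
    using DERIV_chain2[OF that DERIV_sin] .
  have Qd: "(Q has_vector_derivative of_real (q' (sin \<rho>) * cos \<rho>)) (at \<rho>)" for \<rho>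
    unfolding Q_def[abs_def] by (rule has_vector_derivative_of_real[OF chain[OF qd]])
  have "((\<lambda>\<rho>. cos \<rho> * p (sin \<rho>)) has_real_derivative
      (- sin \<rho> * p (sin \<rho>) + cos \<rho> * (p' (sin \<rho>) * cos \<rho>))) (at \<rho>)" for \<rho>
    using DERIV_mult[OF DERIV_cos chain[OF p], of \<rho>] by (simp add: algebra_simps)
  then have Ad: "(A has_vector_derivative
      of_real (- sin \<rho> * p (sin \<rho>) + cos \<rho> * (p' (sin \<rho>) * cos \<rho>))) (at \<rho>)" for \<rho>
    unfolding A_def[abs_def] by (rule has_vector_derivative_of_real)
  have ud: "(u has_vector_derivative w * y \<rho>) (at \<rho>)" if "\<rho> \<in> strip" for \<rho>
    unfolding u_def[abs_def] y_def by (rule csig_mult_deriv_U[OF d that])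
  have yd: "(y has_vector_derivative of_real (2 * M / cos \<rho>) * y \<rho> - w * u \<rho>) (at \<rho>)" if "\<rho> \<in> strip" for \<rho>
    unfolding u_def y_def[abs_def] using csig_mult_deriv_V[OF d that, of "-M"] by simp
  \<comment> \<open>The subtracted term is chosen so that all contributions of y cancel in the
    derivative; what is left is u cos times a function of sin.\<close>
  define B where "B \<rho> = w * (A \<rho> * y \<rho>) - u \<rho> * Q \<rho>" for \<rho>
  have Bd: "(B has_vector_derivative - (u \<rho> * of_real (cos \<rho>) *
      (w\<^sup>2 * of_real (p (sin \<rho>)) + of_real (q' (sin \<rho>))))) (at \<rho>)" if r: "\<rho> \<in> strip" for \<rho>
    unfolding B_def[abs_def]
  proof (rule has_vector_derivative_eq_rhs,
      rule has_vector_derivative_diff[OF has_vector_derivative_mult_right[OF has_vector_derivative_mult[OF Ad yd[OF r]]]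
        has_vector_derivative_mult[OF ud[OF r] Qd]])
    have c: "cos \<rho> \<noteq> 0" using strip_cos_pos[OF r] by simp
    have pyth: "cos \<rho> * (cos \<rho> * z) + sin \<rho> * (sin \<rho> * z) = z" for z :: real
    proof -
      have "cos \<rho> * (cos \<rho> * z) + sin \<rho> * (sin \<rho> * z) = (cos \<rho> * cos \<rho> + sin \<rho> * sin \<rho>) * z"
        by (simp only: distrib_right mult.assoc)
      then show ?thesis by (simp only: sin_cos_squared_add3 mult_1)
    qed
    have "- sin \<rho> * p (sin \<rho>) + cos \<rho> * (p' (sin \<rho>) * cos \<rho>) + cos \<rho> * p (sin \<rho>) * (2 * M / cos \<rho>) = q (sin \<rho>)"
      using c by (simp add: q_def cos_squared_eq[symmetric] power2_eq_square algebra_simps) (rule pyth)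
    then have "complex_of_real (- sin \<rho> * p (sin \<rho>) + cos \<rho> * (p' (sin \<rho>) * cos \<rho>)) +
        A \<rho> * of_real (2 * M / cos \<rho>) = Q \<rho>"
      unfolding A_def Q_def by (simp only: of_real_add[symmetric] of_real_mult[symmetric])
    then have e: "complex_of_real (- sin \<rho> * p (sin \<rho>) + cos \<rho> * (p' (sin \<rho>) * cos \<rho>)) =
        Q \<rho> - A \<rho> * of_real (2 * M / cos \<rho>)" by (simp only: eq_diff_eq)
    show "w * (A \<rho> * (complex_of_real (2 * M / cos \<rho>) * y \<rho> - w * u \<rho>) +
         complex_of_real (- sin \<rho> * p (sin \<rho>) + cos \<rho> * (p' (sin \<rho>) * cos \<rho>)) * y \<rho>) -
        (u \<rho> * complex_of_real (q' (sin \<rho>) * cos \<rho>) + w * y \<rho> * Q \<rho>) =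
        - (u \<rho> * complex_of_real (cos \<rho>) * (w\<^sup>2 * complex_of_real (p (sin \<rho>)) + complex_of_real (q' (sin \<rho>))))"
      unfolding e by (simp add: A_def algebra_simps power2_eq_square del: of_real_divide)
  qed
  have cont: "continuous_on {-1..1} p" "continuous_on {-1..1} q"
    using p qd by (auto intro!: continuous_at_imp_continuous_on DERIV_isCont)
  have "ends0 (\<lambda>\<rho>. of_real (cos \<rho>) * y \<rho>)" unfolding y_def by (rule dirac_pair_cos_y_ends0[OF d M])
  from ends0_mult_sin[OF this cont(1)] have "ends0 (\<lambda>\<rho>. w * (A \<rho> * y \<rho>))"
    unfolding A_def by (intro ends0_cmult) (simp add: mult_ac)
  moreover have "ends0 (\<lambda>\<rho>. u \<rho> * Q \<rho>)"
    unfolding u_def Q_def by (rule ends0_mult_sin[OF dirac_pairD(3)[OF d] cont(2)])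
  ultimately have "ends0 B" unfolding B_def[abs_def] by (rule ends0_diff)
  from has_integral_neg[OF strip_has_integral_zero[OF Bd this]]
  show ?thesis by (simp add: u_def q'_def)
qed

text \<open>\<open>base\<close> concerns the resonant indices, where the diagonal coefficient
  vanishes and the recurrence leaves the moment undetermined. At every other index the moment is
  expressed through the two preceding ones, so all moments vanish by induction.\<close>

lemma dirac_pair_moments:
  assumes d: "dirac_pair M w U V" and M: "\<bar>M\<bar> < 1 / 2"
    and base: "\<And>k::nat. w\<^sup>2 = (of_nat (k + 1))\<^sup>2 \<Longrightarrow>
      ((\<lambda>\<rho>. csig (- M) \<rho> * U \<rho> * of_real (cos \<rho> * sin \<rho> ^ k)) has_integral 0) {-(pi/2)..pi/2}"
    and \<rho>: "\<rho> \<in> strip"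
  shows "U \<rho> = 0"
proof -
  let ?I = "{-(pi/2)..pi/2}"
  obtain g where g: "continuous_on ?I g" "\<forall>\<rho>\<in>strip. g \<rho> = csig (- M) \<rho> * U \<rho>"
    using strip_continuous_extension[OF continuous_on_strip_of_deriv[OF csig_mult_deriv_U[OF d]]]
      dirac_pairD(3)[OF d] unfolding ends0_def by blast
  \<comment> \<open>The extension \<open>g\<close> agrees with u on the open strip only; at the end
    points both sides vanish with cos.\<close>
  have eq: "csig (- M) \<rho> * U \<rho> * of_real (cos \<rho>) = g \<rho> * of_real (cos \<rho>)" if "\<rho> \<in> ?I" for \<rho>
  proof (cases "\<rho> \<in> strip")
    case False
    then have "\<rho> = pi/2 \<or> \<rho> = -(pi/2)" using that by auto
    then have "cos \<rho> = 0" by (elim disjE; simp only: cos_minus cos_pi_half)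
    then show ?thesis by simp
  qed (use g in simp)
  define m where "m k = integral ?I (\<lambda>\<rho>. g \<rho> * of_real (cos \<rho> * sin \<rho> ^ k))" for k
  have hm: "((\<lambda>\<rho>. g \<rho> * of_real (cos \<rho> * sin \<rho> ^ k)) has_integral m k) ?I" for k
    unfolding m_def by (intro integrable_integral integrable_continuous_interval continuous_intros g(1))
  \<comment> \<open>For p = s^k the terms of degree k add up to -1 - 3k - k(k - 1) = -(k + 1)^2.
    Truncation in k - 1 and k - 2 is harmless, because the coefficients 2Mk and k(k - 1) are 0 in
    those cases.\<close>
  have rec: "(w\<^sup>2 - (of_nat (k + 1))\<^sup>2) * m k + of_real (2 * M * real k) * m (k - 1)
      + of_real (real k * real (k - 1)) * m (k - 2) = 0" for k :: nat
  proof -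
    have "((\<lambda>\<rho>. csig (- M) \<rho> * U \<rho> * of_real (cos \<rho>) * (w\<^sup>2 * of_real (sin \<rho> ^ k) +
      of_real (2 * M * (real k * sin \<rho> ^ (k - 1)) - sin \<rho> ^ k - 3 * sin \<rho> * (real k * sin \<rho> ^ (k - 1))
        + (1 - (sin \<rho>)\<^sup>2) * (real k * (real (k - 1) * sin \<rho> ^ (k - 2)))))) has_integral 0) ?I"
      by (rule dirac_pair_test_function[OF d M, of "\<lambda>x. x ^ k" "\<lambda>x. real k * x ^ (k - 1)"
         "\<lambda>x. real k * (real (k - 1) * x ^ (k - 2))"])
        (auto intro!: derivative_eq_intros simp: numeral_2_eq_2)
    then have "((\<lambda>\<rho>. g \<rho> * of_real (cos \<rho>) * (w\<^sup>2 * of_real (sin \<rho> ^ k) +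
      of_real (2 * M * (real k * sin \<rho> ^ (k - 1)) - sin \<rho> ^ k - 3 * sin \<rho> * (real k * sin \<rho> ^ (k - 1))
        + (1 - (sin \<rho>)\<^sup>2) * (real k * (real (k - 1) * sin \<rho> ^ (k - 2)))))) has_integral 0) ?I"
      using eq by (elim has_integral_eq[rotated]) simp
    moreover have "((\<lambda>\<rho>. (w\<^sup>2 - (of_nat (k + 1))\<^sup>2) * (g \<rho> * of_real (cos \<rho> * sin \<rho> ^ k)) +
        of_real (2 * M * real k) * (g \<rho> * of_real (cos \<rho> * sin \<rho> ^ (k-1)))
      + of_real (real k * real (k - 1)) * (g \<rho> * of_real (cos \<rho> * sin \<rho> ^ (k-2))))
      has_integral ((w\<^sup>2 - (of_nat (k + 1))\<^sup>2) * m k + of_real (2 * M * real k) * m (k - 1)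
      + of_real (real k * real (k - 1)) * m (k - 2))) ?I"
      by (intro has_integral_add has_integral_mult_right hm)
    moreover have "g \<rho> * of_real (cos \<rho>) * (w\<^sup>2 * of_real (sin \<rho> ^ k) +
      of_real (2 * M * (real k * sin \<rho> ^ (k - 1)) - sin \<rho> ^ k - 3 * sin \<rho> * (real k * sin \<rho> ^ (k - 1))
        + (1 - (sin \<rho>)\<^sup>2) * (real k * (real (k - 1) * sin \<rho> ^ (k - 2))))) =
      (w\<^sup>2 - (of_nat (k + 1))\<^sup>2) * (g \<rho> * of_real (cos \<rho> * sin \<rho> ^ k)) +
        of_real (2 * M * real k) * (g \<rho> * of_real (cos \<rho> * sin \<rho> ^ (k-1)))
      + of_real (real k * real (k - 1)) * (g \<rho> * of_real (cos \<rho> * sin \<rho> ^ (k-2)))" for \<rho>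
    proof -
      consider "k = 0" | "k = 1" | j where "k = Suc (Suc j)" by (metis One_nat_def not0_implies_Suc)
      then show ?thesis by cases (simp_all add: algebra_simps power2_eq_square)
    qed
    ultimately show ?thesis using has_integral_unique by (simp only:) blast
  qed
  have "m k = 0" for k
  proof (induction k rule: less_induct)
    case (less k)
    show ?case
    proof (cases "w\<^sup>2 = (of_nat (k + 1))\<^sup>2")
      case True
      have "((\<lambda>\<rho>. g \<rho> * of_real (cos \<rho> * sin \<rho> ^ k)) has_integral 0) ?I"
        by (rule has_integral_eq[OF _ base[OF True]]) (use eq in \<open>simp add: mult.assoc[symmetric]\<close>)
      then show ?thesis using hm has_integral_unique by blast
    next
      case False
      have 1: "of_real (2 * M * real k) * m (k - 1) = 0" using less.IH[of "k-1"] by (cases k) auto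
      have 2: "of_real (real k * real (k - 1)) * m (k - 2) = 0"
        using less.IH[of "k-2"] by (cases "k < 2") auto
      have "(w\<^sup>2 - (of_nat (k + 1))\<^sup>2) * m k = 0" using rec[of k] unfolding 1 2 by (simp only: add_0_right)
      then show ?thesis using False by (simp only: mult_eq_0_iff right_minus_eq) blast
    qed
  qed
  then have "((\<lambda>\<rho>. g \<rho> * of_real (cos \<rho> * sin \<rho> ^ k)) has_integral 0) ?I" for k
    using hm[of k] by simp
  then have "g \<rho> = 0" by (rule complex_moments_zero[OF g(1) _ \<rho>])
  then show ?thesis using g(2) \<rho> csig_nonzero[OF \<rho>] by simp
qed

section \<open>Spectrum and multiplicity\<close>

lemma dirac_pair_lincomb:
  assumes "dirac_pair M w U V" "dirac_pair M w U' V'"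
  shows "dirac_pair M w (\<lambda>\<rho>. a * U \<rho> + b * U' \<rho>) (\<lambda>\<rho>. a * V \<rho> + b * V' \<rho>)"
proof -
  note D = dirac_pairD[OF assms(1)] and D' = dirac_pairD[OF assms(2)]
  have "ends0 (\<lambda>\<rho>. a * (csig (- M) \<rho> * U \<rho>) + b * (csig (- M) \<rho> * U' \<rho>))"
    by (intro ends0_add ends0_cmult D(3) D'(3))
  then have "ends0 (\<lambda>\<rho>. csig (- M) \<rho> * (a * U \<rho> + b * U' \<rho>))" by (simp add: algebra_simps)
  moreover have "((\<lambda>\<rho>. a * U \<rho> + b * U' \<rho>) has_vector_derivative
      w * (a * V \<rho> + b * V' \<rho>) - of_real (M / cos \<rho>) * (a * U \<rho> + b * U' \<rho>)) (at \<rho>)"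
    if "\<rho> \<in> strip" for \<rho>
    by (rule has_vector_derivative_eq_rhs, rule has_vector_derivative_add[OF
        has_vector_derivative_mult_right[OF D(1)[OF that]] has_vector_derivative_mult_right[OF D'(1)[OF that]]])
      (simp add: algebra_simps)
  moreover have "((\<lambda>\<rho>. a * V \<rho> + b * V' \<rho>) has_vector_derivative
      of_real (M / cos \<rho>) * (a * V \<rho> + b * V' \<rho>) - w * (a * U \<rho> + b * U' \<rho>)) (at \<rho>)"
    if "\<rho> \<in> strip" for \<rho>
    by (rule has_vector_derivative_eq_rhs, rule has_vector_derivative_add[OF
        has_vector_derivative_mult_right[OF D(2)[OF that]] has_vector_derivative_mult_right[OF D'(2)[OF that]]])
      (simp add: algebra_simps)
  ultimately show ?thesis unfolding dirac_pair_def by blast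
qed

text \<open>With U = 0 the second equation makes sigma^M V constant and the first leaves w V = 0.
  Hence only w = 0 permits a nonzero V, the zero mode.\<close>

lemma dirac_pair_U_zero_imp_V:
  assumes d: "dirac_pair M w U V" and z: "\<And>\<rho>. \<rho> \<in> strip \<Longrightarrow> U \<rho> = 0"
  shows "\<exists>c. w * c = 0 \<and> (\<forall>\<rho>\<in>strip. V \<rho> = c * csig (- M) \<rho>)"
proof -
  have "((\<lambda>x. csig M x * V x) has_vector_derivative 0) (at x within strip)" if "x \<in> strip" for x
    using csig_mult_deriv_V[OF d that, of M] z[OF that] by (auto intro: has_vector_derivative_at_within)
  then obtain c where c: "\<And>x. x \<in> strip \<Longrightarrow> csig M x * V x = c"
    using has_vector_derivative_zero_constant[of strip "\<lambda>x. csig M x * V x"] by auto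
  have V: "V x = c * csig (- M) x" if "x \<in> strip" for x
  proof -
    have "csig (- M) x * (csig M x * V x) = V x" unfolding csig_add' using csig_0[OF that] by simp
    then show ?thesis unfolding c[OF that] by (simp only: mult.commute)
  qed
  have 0: "(0::real) \<in> strip" by simp
  have "(U has_vector_derivative 0) (at 0)"
    by (rule has_vector_derivative_transform_within_open[of "\<lambda>_. 0" 0 0 strip]) (use z in auto)
  then have "w * V 0 - of_real (M / cos 0) * U 0 = 0"
    using dirac_pairD(1)[OF d 0] vector_derivative_unique_at by blast
  then have "w * c = 0" using z[OF 0] V[OF 0] csig_nonzero[OF 0] by simp
  then show ?thesis using V by blast
qed

lemma dirac_pair_spectrum:
  assumes d: "dirac_pair M w U V" and M: "\<bar>M\<bar> < 1 / 2"
    and nz: "\<rho> \<in> strip" "U \<rho> \<noteq> 0 \<or> V \<rho> \<noteq> 0"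
  shows "w \<in> \<int>"
proof (rule ccontr)
  assume w: "w \<notin> \<int>"
  have "w\<^sup>2 \<noteq> (of_nat (k + 1))\<^sup>2" for k
    using w Ints_minus[OF Ints_of_nat[of "k + 1"]] Ints_of_nat[of "k + 1"] unfolding power2_eq_iff by metis
  then have U: "U x = 0" if "x \<in> strip" for x
    using dirac_pair_moments[OF d M _ that] by blast
  then obtain c where c: "w * c = 0" "\<forall>\<rho>\<in>strip. V \<rho> = c * csig (- M) \<rho>"
    using dirac_pair_U_zero_imp_V[OF d] by blast
  moreover have "w \<noteq> 0" using w by auto
  ultimately show False using nz U by simp
qed

text \<open>For n = 0 no index is resonant, so U = 0 and V is a multiple of sigma^(-M). Otherwise
  exactly one index is resonant, and a combination of the two solutions that cancels this one moment
  vanishes altogether.\<close>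

lemma dirac_pair_simple:
  assumes d: "dirac_pair M (of_int n) U V" and d': "dirac_pair M (of_int n) U' V'" and M: "\<bar>M\<bar> < 1 / 2"
    and nz: "\<exists>\<rho>\<in>strip. U \<rho> \<noteq> 0 \<or> V \<rho> \<noteq> 0"
  shows "\<exists>c. \<forall>\<rho>\<in>strip. U' \<rho> = c * U \<rho> \<and> V' \<rho> = c * V \<rho>"
proof (cases "n = 0")
  case True
  have "(of_int n)\<^sup>2 \<noteq> (of_nat (k + 1) :: complex)\<^sup>2" for k
  proof -
    have "(of_nat (k + 1) :: complex) \<noteq> 0" unfolding of_nat_eq_0_iff by simp
    then show ?thesis using True by simp
  qed
  then have U: "U x = 0" "U' x = 0" if "x \<in> strip" for x
    using dirac_pair_moments[OF d M _ that] dirac_pair_moments[OF d' M _ that] by blast+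
  obtain c where c: "\<forall>\<rho>\<in>strip. V \<rho> = c * csig (- M) \<rho>"
    using dirac_pair_U_zero_imp_V[OF d] U by blast
  obtain c' where c': "\<forall>\<rho>\<in>strip. V' \<rho> = c' * csig (- M) \<rho>"
    using dirac_pair_U_zero_imp_V[OF d'] U by blast
  have "c \<noteq> 0" using nz U c by auto
  then show ?thesis using U c c' by (intro exI[of _ "c' / c"]) auto
next
  case False
  \<comment> \<open>The only natural number k with (k + 1)^2 = n^2; the truncated subtraction is
    exact as n is nonzero.\<close>
  define N where "N = nat \<bar>n\<bar> - 1"
  have N: "k = N" if "(of_int n)\<^sup>2 = (of_nat (k + 1) :: complex)\<^sup>2" for k
  proof -
    have "of_int (n\<^sup>2) = (of_int ((int (k+1))\<^sup>2) :: complex)" using that by simp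
    then have "n\<^sup>2 = (int (k+1))\<^sup>2" by (simp only: of_int_eq_iff)
    then have "\<bar>n\<bar> = int (k + 1)" unfolding power2_eq_iff by linarith
    then show ?thesis by (simp add: N_def)
  qed
  let ?m = "\<lambda>U. integral {-(pi/2)..pi/2} (\<lambda>\<rho>. csig (- M) \<rho> * U \<rho> * of_real (cos \<rho> * sin \<rho> ^ N))"
  have mi: "((\<lambda>\<rho>. csig (- M) \<rho> * U \<rho> * of_real (cos \<rho> * sin \<rho> ^ N)) has_integral ?m U) {-(pi/2)..pi/2}"
    if d: "dirac_pair M (of_int n) U V" for U V
  proof -
    obtain C where C: "\<And>\<rho>. \<rho> \<in> strip \<Longrightarrow> norm (csig (- M) \<rho> * U \<rho>) \<le> C"
      using dirac_pair_u_bounded[OF d] by blast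
    have "set_integrable lborel strip (\<lambda>\<rho>. csig (- M) \<rho> * U \<rho> * of_real (cos \<rho> * sin \<rho> ^ N))"
    proof (rule strip_mult_bounded_integrable[where h="csig 0" and C="C * 1"
          and g="\<lambda>\<rho>. csig (- M) \<rho> * U \<rho> * of_real (cos \<rho> * sin \<rho> ^ N)"])
      show "set_integrable lborel strip (csig 0)" by (rule csig_integrable) simp
      show "csig (- M) x * U x * of_real (cos x * sin x ^ N) =
          csig 0 x * (csig (- M) x * U x * of_real (cos x * sin x ^ N))" if "x \<in> strip" for x
        by (simp only: csig_0[OF that] mult_1)
      show "continuous_on strip (\<lambda>\<rho>. csig (- M) \<rho> * U \<rho> * of_real (cos \<rho> * sin \<rho> ^ N))"
        by (intro continuous_intros csig_continuous dirac_pair_continuous(1)[OF d])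
      fix x assume x: "x \<in> strip"
      have "norm (complex_of_real (cos x * sin x ^ N)) \<le> 1"
        unfolding norm_of_real abs_mult power_abs
        by (intro mult_le_one power_le_one abs_cos_le_one abs_sin_le_one abs_ge_zero zero_le_power)
      then show "norm (csig (- M) x * U x * of_real (cos x * sin x ^ N)) \<le> C * 1"
        unfolding norm_mult[of "csig (- M) x * U x"] using C[OF x]
          order_trans[OF norm_ge_zero C[OF x]] by (intro mult_mono norm_ge_zero)
    qed
    then show ?thesis
      using set_borel_integral_eq_integral(1) integrable_on_Icc_iff_Ioo integrable_integral by blast
  qed
  have key: "a * U x + b * U' x = 0 \<and> a * V x + b * V' x = 0"
    if ab: "a * ?m U + b * ?m U' = 0" and x: "x \<in> strip" for a b x
  proof -
    note D = dirac_pair_lincomb[OF d d', of a b]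
    have "((\<lambda>\<rho>. a * (csig (- M) \<rho> * U \<rho> * of_real (cos \<rho> * sin \<rho> ^ N)) +
        b * (csig (- M) \<rho> * U' \<rho> * of_real (cos \<rho> * sin \<rho> ^ N))) has_integral 0) {-(pi/2)..pi/2}"
      using has_integral_add[OF has_integral_mult_right[OF mi[OF d], of a] has_integral_mult_right[OF mi[OF d'], of b]] ab
      by simp
    then have "((\<lambda>\<rho>. csig (- M) \<rho> * (a * U \<rho> + b * U' \<rho>) * of_real (cos \<rho> * sin \<rho> ^ N)) has_integral 0) {-(pi/2)..pi/2}"
      by (simp add: algebra_simps)
    then have z: "a * U x + b * U' x = 0" if "x \<in> strip" for x
      using dirac_pair_moments[OF D M _ that] N by blast
    then show ?thesis using dirac_pair_U_zero_imp_V[OF D] False x by auto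
  qed
  \<comment> \<open>By \<open>key\<close> with a = 1, b = 0: a vanishing resonant moment would
    annihilate the nonzero solution (U, V).\<close>
  have "?m U \<noteq> 0" using key[of 1 0] nz by auto
  show ?thesis
  proof (intro exI ballI)
    fix x assume x: "x \<in> strip"
    have "- (?m U' / ?m U) * U x + 1 * U' x = 0 \<and> - (?m U' / ?m U) * V x + 1 * V' x = 0"
      by (rule key[OF _ x]) (use \<open>?m U \<noteq> 0\<close> in simp)
    then show "U' x = ?m U' / ?m U * U x \<and> V' x = ?m U' / ?m U * V x" by (simp add: add_eq_0_iff)
  qed
qed

section \<open>Ladder operators\<close>

text \<open>On a mode of frequency n the equation eliminates the derivative in \<rho>, and the time
  derivative is multiplication by -i n. With \<open>\<nu> = n + 1/2\<close>, \<open>L_plus\<close>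
  is then \<open>\<i>\<close> times the matrix of \<open>raise_U\<close> and \<open>raise_V\<close>,
  apart from the phase in t.\<close>

definition raise_U :: "real \<Rightarrow> real \<Rightarrow> (real \<Rightarrow> complex) \<Rightarrow> (real \<Rightarrow> complex) \<Rightarrow> real \<Rightarrow> complex" where
  "raise_U M \<nu> U V \<rho> = of_real (\<nu> * cos \<rho>) * V \<rho> - of_real (M + \<nu> * sin \<rho>) * U \<rho>"

definition raise_V :: "real \<Rightarrow> real \<Rightarrow> (real \<Rightarrow> complex) \<Rightarrow> (real \<Rightarrow> complex) \<Rightarrow> real \<Rightarrow> complex" where
  "raise_V M \<nu> U V \<rho> = of_real (M - \<nu> * sin \<rho>) * V \<rho> - of_real (\<nu> * cos \<rho>) * U \<rho>"

text \<open>The same for \<open>L_minus\<close> with \<open>\<nu> = n - 1/2\<close>, so the step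
  from n to n + 1 and the step back share one value of \<nu>.\<close>

definition lower_U :: "real \<Rightarrow> real \<Rightarrow> (real \<Rightarrow> complex) \<Rightarrow> (real \<Rightarrow> complex) \<Rightarrow> real \<Rightarrow> complex" where
  "lower_U M \<nu> U V \<rho> = of_real (M - \<nu> * sin \<rho>) * U \<rho> - of_real (\<nu> * cos \<rho>) * V \<rho>"

definition lower_V :: "real \<Rightarrow> real \<Rightarrow> (real \<Rightarrow> complex) \<Rightarrow> (real \<Rightarrow> complex) \<Rightarrow> real \<Rightarrow> complex" where
  "lower_V M \<nu> U V \<rho> = of_real (\<nu> * cos \<rho>) * U \<rho> - of_real (M + \<nu> * sin \<rho>) * V \<rho>"

lemma complex_sin_cos_sq: "(complex_of_real (cos \<rho>))\<^sup>2 + (complex_of_real (sin \<rho>))\<^sup>2 = 1"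
  by (metis of_real_1 of_real_add of_real_power sin_cos_squared_add2)

text \<open>A product of two matrices, valid for arbitrary functions U and V: the off-diagonal
  entries cancel and sin^2 + cos^2 = 1 leaves a scalar on the diagonal.\<close>

lemma lower_raise:
  "lower_U M \<nu> (raise_U M \<nu> U V) (raise_V M \<nu> U V) \<rho> = of_real (\<nu>\<^sup>2 - M\<^sup>2) * U \<rho>"
  "lower_V M \<nu> (raise_U M \<nu> U V) (raise_V M \<nu> U V) \<rho> = of_real (\<nu>\<^sup>2 - M\<^sup>2) * V \<rho>"
proof -
  have "lower_U M \<nu> (raise_U M \<nu> U V) (raise_V M \<nu> U V) \<rho> =
      ((of_real \<nu>)\<^sup>2 * ((of_real (cos \<rho>))\<^sup>2 + (of_real (sin \<rho>))\<^sup>2) - (of_real M)\<^sup>2) * U \<rho>"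
    "lower_V M \<nu> (raise_U M \<nu> U V) (raise_V M \<nu> U V) \<rho> =
      ((of_real \<nu>)\<^sup>2 * ((of_real (cos \<rho>))\<^sup>2 + (of_real (sin \<rho>))\<^sup>2) - (of_real M)\<^sup>2) * V \<rho>"
    by (simp_all add: raise_U_def raise_V_def lower_U_def lower_V_def algebra_simps power2_eq_square)
  then show "lower_U M \<nu> (raise_U M \<nu> U V) (raise_V M \<nu> U V) \<rho> = of_real (\<nu>\<^sup>2 - M\<^sup>2) * U \<rho>"
    "lower_V M \<nu> (raise_U M \<nu> U V) (raise_V M \<nu> U V) \<rho> = of_real (\<nu>\<^sup>2 - M\<^sup>2) * V \<rho>"
    unfolding complex_sin_cos_sq by simp_all
qed

text \<open>The equations follow by differentiation. The boundary condition survives because V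
  enters the new first component with a factor cos and U with a bounded factor.\<close>

lemma dirac_pair_raise:
  assumes d: "dirac_pair M (of_real w) U V" and M: "\<bar>M\<bar> < 1 / 2"
  shows "dirac_pair M (of_real (w + 1)) (raise_U M (w + 1 / 2) U V) (raise_V M (w + 1 / 2) U V)"
  unfolding dirac_pair_def
proof (intro conjI ballI)
  fix \<rho> assume r: "\<rho> \<in> strip"
  define K where "K = complex_of_real (M / cos \<rho>)"
  \<comment> \<open>Writing M as K cos removes the division by cos: the identities become polynomial
    in K, sin and cos.\<close>
  have M: "complex_of_real M = K * of_real (cos \<rho>)"
    unfolding K_def of_real_mult[symmetric] using strip_cos_pos[OF r] by simp
  have half: "complex_of_real (1 / 2) = 1 / 2" by simp
  note D = dirac_pairD[OF d]
  have c: "((\<lambda>\<rho>. complex_of_real ((w + 1 / 2) * cos \<rho>)) has_vector_derivative of_real (- ((w + 1 / 2) * sin \<rho>))) (at \<rho>)"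
    by (rule has_vector_derivative_of_real) (auto intro!: derivative_eq_intros)
  have s: "((\<lambda>\<rho>. complex_of_real (M + (w + 1 / 2) * sin \<rho>)) has_vector_derivative of_real ((w + 1 / 2) * cos \<rho>)) (at \<rho>)"
    "((\<lambda>\<rho>. complex_of_real (M - (w + 1 / 2) * sin \<rho>)) has_vector_derivative of_real (- ((w + 1 / 2) * cos \<rho>))) (at \<rho>)"
    by (rule has_vector_derivative_of_real, auto intro!: derivative_eq_intros)+
  show "(raise_U M (w + 1 / 2) U V has_vector_derivative of_real (w + 1) * raise_V M (w + 1 / 2) U V \<rho> -
      of_real (M / cos \<rho>) * raise_U M (w + 1 / 2) U V \<rho>) (at \<rho>)"
    unfolding raise_U_def[abs_def]
    by (rule has_vector_derivative_eq_rhs, rule has_vector_derivative_diff[OF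
        has_vector_derivative_mult[OF c D(2)[OF r]] has_vector_derivative_mult[OF s(1) D(1)[OF r]]])
      (simp only: raise_U_def raise_V_def K_def[symmetric] of_real_mult of_real_add of_real_diff of_real_minus of_real_1 half M,
       simp add: field_simps)
  show "(raise_V M (w + 1 / 2) U V has_vector_derivative of_real (M / cos \<rho>) * raise_V M (w + 1 / 2) U V \<rho> -
      of_real (w + 1) * raise_U M (w + 1 / 2) U V \<rho>) (at \<rho>)"
    unfolding raise_V_def[abs_def]
    by (rule has_vector_derivative_eq_rhs, rule has_vector_derivative_diff[OF
        has_vector_derivative_mult[OF s(2) D(2)[OF r]] has_vector_derivative_mult[OF c D(1)[OF r]]])
      (simp only: raise_U_def raise_V_def K_def[symmetric] of_real_mult of_real_add of_real_diff of_real_minus of_real_1 half M,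
       simp add: field_simps)
next
  have "ends0 (\<lambda>\<rho>. of_real (w + 1 / 2) * (of_real (cos \<rho>) * (csig (- M) \<rho> * V \<rho>)) -
      csig (- M) \<rho> * U \<rho> * of_real (M + (w + 1 / 2) * sin \<rho>))"
    by (intro ends0_diff ends0_cmult dirac_pair_cos_y_ends0[OF d M] ends0_mult_sin[OF dirac_pairD(3)[OF d], where h="\<lambda>x. M + (w + 1 / 2) * x"] continuous_intros)
  then show "ends0 (\<lambda>\<rho>. csig (- M) \<rho> * raise_U M (w + 1 / 2) U V \<rho>)"
    by (simp add: raise_U_def algebra_simps)
qed

section \<open>Solutions at every integer frequency\<close>

lemma dirac_pair_neg:
  assumes "dirac_pair M w U V" shows "dirac_pair M (- w) U (\<lambda>\<rho>. - V \<rho>)"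
  unfolding dirac_pair_def
proof (intro conjI ballI)
  fix \<rho> assume r: "\<rho> \<in> strip"
  note D = dirac_pairD[OF assms]
  show "(U has_vector_derivative - w * - V \<rho> - of_real (M / cos \<rho>) * U \<rho>) (at \<rho>)" using D(1)[OF r] by simp
  show "((\<lambda>\<rho>. - V \<rho>) has_vector_derivative of_real (M / cos \<rho>) * - V \<rho> - - w * U \<rho>) (at \<rho>)"
    by (rule has_vector_derivative_eq_rhs, rule has_vector_derivative_minus[OF D(2)[OF r]]) simp
qed (rule dirac_pairD(3)[OF assms])

lemma dirac_pair_zero_mode: "dirac_pair M 0 (\<lambda>_. 0) (csig (- M))"
  unfolding dirac_pair_def using csig_deriv[of _ "-M"] by (auto simp: ends0_def simp del: greaterThanLessThan_iff)

text \<open>Half-odd numbers have modulus at least 1/2. Every ladder coefficient is therefore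
  nonzero and the chain of modes never breaks.\<close>

lemma half_odd_sq_gt:
  assumes "\<bar>M\<bar> < 1 / 2" shows "M\<^sup>2 < (real_of_int n + 1 / 2)\<^sup>2"
proof -
  have "real_of_int 0 \<le> real_of_int n \<or> real_of_int n \<le> real_of_int (-1)"
    unfolding of_int_le_iff by linarith
  then have "1 / 2 \<le> \<bar>real_of_int n + 1 / 2\<bar>" by linarith
  then have "\<bar>M\<bar> < \<bar>real_of_int n + 1 / 2\<bar>" using assms by linarith
  from power_strict_mono[OF this, of 2] show ?thesis by simp
qed

text \<open>Nonnegative frequencies come from raising the zero mode, negative ones from changing the
  sign of V. A raised pair has no zero because lowering returns a nonzero multiple of the pair it
  came from.\<close>

lemma dirac_pair_exists:
  assumes M: "\<bar>M\<bar> < 1 / 2"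
  shows "\<exists>U V. dirac_pair M (of_int n) U V \<and> (\<forall>\<rho>\<in>strip. U \<rho> \<noteq> 0 \<or> V \<rho> \<noteq> 0)"
proof -
  have nat: "\<exists>U V. dirac_pair M (of_nat k) U V \<and> (\<forall>\<rho>\<in>strip. U \<rho> \<noteq> 0 \<or> V \<rho> \<noteq> 0)" for k
  proof (induction k)
    case 0
    show ?case unfolding of_nat_0 using dirac_pair_zero_mode[of M] csig_nonzero[of _ "- M"] by blast
  next
    case (Suc k)
    then obtain U V where d: "dirac_pair M (of_real (real k)) U V" and nz: "\<forall>\<rho>\<in>strip. U \<rho> \<noteq> 0 \<or> V \<rho> \<noteq> 0" by auto
    let ?n = "real k + 1 / 2"
    have "raise_U M ?n U V \<rho> \<noteq> 0 \<or> raise_V M ?n U V \<rho> \<noteq> 0" if "\<rho> \<in> strip" for \<rho>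
    proof (rule ccontr)
      assume "\<not> ?thesis"
      then have z: "raise_U M ?n U V \<rho> = 0" "raise_V M ?n U V \<rho> = 0" by auto
      have "M\<^sup>2 \<noteq> ?n\<^sup>2" using half_odd_sq_gt[OF M, of "int k"] by simp
      then have "complex_of_real (?n\<^sup>2 - M\<^sup>2) \<noteq> 0" by (simp only: of_real_eq_0_iff)
      then show False using lower_raise[of M ?n U V \<rho>] bspec[OF nz that] z
        by (simp add: lower_U_def lower_V_def)
    qed
    moreover have "complex_of_real (real k + 1) = of_nat (Suc k)" by simp
    ultimately show ?case using dirac_pair_raise[OF d M] by metis
  qed
  show ?thesis
  proof (cases "n \<ge> 0")
    case True
    then show ?thesis using nat[of "nat n"] by simp
  next
    case False
    obtain U V where "dirac_pair M (of_nat (nat (-n))) U V" "\<forall>\<rho>\<in>strip. U \<rho> \<noteq> 0 \<or> V \<rho> \<noteq> 0"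
      using nat by blast
    then show ?thesis using dirac_pair_neg[of M "of_nat (nat (-n))" U V] False
      by (intro exI[of _ U] exI[of _ "\<lambda>\<rho>. - V \<rho>"]) simp
  qed
qed

section \<open>Inner products of solutions\<close>

definition pair_ip where
  "pair_ip U V U' V' = set_lebesgue_integral lborel strip (\<lambda>\<rho>. cnj (U \<rho>) * U' \<rho> + cnj (V \<rho>) * V' \<rho>)"

lemma pair_integrable:
  assumes "dirac_pair M w U V" "dirac_pair M w' U' V'" "\<bar>M\<bar> < 1 / 2"
  shows "set_integrable lborel strip (\<lambda>\<rho>. cnj (U \<rho>) * U' \<rho> + cnj (V \<rho>) * V' \<rho>)"
  using dirac_pair_prod_integrable[OF assms] by (rule set_integral_add(1))

lemma ends0_cnj: "ends0 f \<Longrightarrow> ends0 (\<lambda>x. cnj (f x))"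
  unfolding ends0_def using tendsto_cnj[of f 0] by auto

text \<open>The weights sigma^(-M) and sigma^M cancel, so the product is that of a function
  vanishing at the ends and a bounded one.\<close>

lemma cnj_U_V'_ends0:
  assumes d: "dirac_pair M w U V" and d': "dirac_pair M w' U' V'" and M: "\<bar>M\<bar> < 1 / 2"
  shows "ends0 (\<lambda>\<rho>. cnj (U \<rho>) * V' \<rho>)"
proof -
  obtain C where C: "\<And>\<rho>. \<rho> \<in> strip \<Longrightarrow> norm (csig M \<rho> * V' \<rho>) \<le> C"
    using dirac_pair_v_bounded[OF d' M] by blast
  have e0: "ends0 (\<lambda>\<rho>. cnj (csig (- M) \<rho> * U \<rho>) * (csig M \<rho> * V' \<rho>))"
    by (rule ends0_bounded_mult[OF ends0_cnj[OF dirac_pairD(3)[OF d]] C])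
  have eq: "cnj (csig (- M) \<rho> * U \<rho>) * (csig M \<rho> * V' \<rho>) = cnj (U \<rho>) * V' \<rho>" if "\<rho> \<in> strip" for \<rho>
  proof -
    have "cnj (csig (- M) \<rho> * U \<rho>) * (csig M \<rho> * V' \<rho>) = (csig (- M) \<rho> * csig M \<rho>) * (cnj (U \<rho>) * V' \<rho>)"
      by (simp add: csig_def)
    then show ?thesis unfolding csig_add using csig_0[OF that] by simp
  qed
  show ?thesis by (rule ends0_cong[OF eq, THEN iffD1, OF _ e0])
qed

lemma cnj_V_U'_ends0:
  assumes d: "dirac_pair M w U V" and d': "dirac_pair M w' U' V'" and M: "\<bar>M\<bar> < 1 / 2"
  shows "ends0 (\<lambda>\<rho>. cnj (V \<rho>) * U' \<rho>)"
  using ends0_cnj[OF cnj_U_V'_ends0[OF d' d M]] by (simp add: mult.commute)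

lemma cos_U_U_ends0:
  assumes d: "dirac_pair M w U V" and M: "\<bar>M\<bar> < 1 / 2"
  shows "ends0 (\<lambda>\<rho>. of_real (cos \<rho>) * (cnj (U \<rho>) * U \<rho>))" "ends0 (\<lambda>\<rho>. of_real (cos \<rho>) * (cnj (V \<rho>) * V \<rho>))"
proof -
  obtain C where C: "\<And>\<rho>. \<rho> \<in> strip \<Longrightarrow> norm (csig (- M) \<rho> * U \<rho>) \<le> C" "\<And>\<rho>. \<rho> \<in> strip \<Longrightarrow> norm (csig M \<rho> * V \<rho>) \<le> C"
    using dirac_pair_bounded[OF d M] by blast
  have gen: "ends0 (\<lambda>\<rho>. of_real (cos \<rho>) * (cnj (f \<rho>) * f \<rho>))"
    if p: "\<bar>p\<bar> < 1 / 2" and f: "\<And>\<rho>. \<rho> \<in> strip \<Longrightarrow> norm (csig p \<rho> * f \<rho>) \<le> C" for f p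
  proof -
    have "ends0 (\<lambda>\<rho>. cos \<rho> * sigma \<rho> powr (- 2 * p))" using p by (intro ends0_cos_sigma) auto
    then have "ends0 (\<lambda>\<rho>. complex_of_real (cos \<rho> * sigma \<rho> powr (- 2 * p)))"
      unfolding ends0_def by (auto dest!: tendsto_of_real[where 'a=complex])
    then have e0: "ends0 (\<lambda>\<rho>. complex_of_real (cos \<rho> * sigma \<rho> powr (- 2 * p)) * (cnj (csig p \<rho> * f \<rho>) * (csig p \<rho> * f \<rho>)))"
    proof (rule ends0_bounded_mult)
      fix x assume "x \<in> strip"
      from f[OF this] show "norm (cnj (csig p x * f x) * (csig p x * f x)) \<le> C * C"
        unfolding norm_mult[of "cnj _"] complex_mod_cnj
        using order_trans[OF norm_ge_zero f[OF \<open>x \<in> strip\<close>]] by (intro mult_mono norm_ge_zero)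
    qed
    have eq: "complex_of_real (cos \<rho> * sigma \<rho> powr (- 2 * p)) * (cnj (csig p \<rho> * f \<rho>) * (csig p \<rho> * f \<rho>)) =
      of_real (cos \<rho>) * (cnj (f \<rho>) * f \<rho>)" if r: "\<rho> \<in> strip" for \<rho>
    proof -
      have "complex_of_real (cos \<rho> * sigma \<rho> powr (- 2 * p)) * (cnj (csig p \<rho> * f \<rho>) * (csig p \<rho> * f \<rho>)) =
        of_real (cos \<rho>) * (((csig (- 2 * p) \<rho> * csig p \<rho>) * csig p \<rho>) * (cnj (f \<rho>) * f \<rho>))"
        by (simp add: csig_def)
      then show ?thesis unfolding csig_add using csig_0[OF r] by simp
    qed
    show ?thesis by (rule ends0_cong[OF eq, THEN iffD1, OF _ e0])
  qed
  show "ends0 (\<lambda>\<rho>. of_real (cos \<rho>) * (cnj (U \<rho>) * U \<rho>))" by (rule gen[of "-M"]) (use M C in auto)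
  show "ends0 (\<lambda>\<rho>. of_real (cos \<rho>) * (cnj (V \<rho>) * V \<rho>))" by (rule gen[of "M"]) (use M C in auto)
qed

text \<open>The Lagrange identity, with primes marking the second solution: cnj U V' - cnj V U' has
  derivative (m - n) times the integrand, since the mass terms cancel.\<close>

lemma dirac_pair_orthogonal:
  assumes d: "dirac_pair M (of_real m) U V" and d': "dirac_pair M (of_real n) U' V'" and M: "\<bar>M\<bar> < 1 / 2"
    and mn: "m \<noteq> n"
  shows "pair_ip U V U' V' = 0"
proof -
  let ?f = "\<lambda>\<rho>. cnj (U \<rho>) * U' \<rho> + cnj (V \<rho>) * V' \<rho>"
  have "((\<lambda>\<rho>. of_real (m - n) * ?f \<rho>) has_integral 0) {-(pi/2)..pi/2}"
  proof (rule strip_has_integral_zero)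
    show "ends0 (\<lambda>\<rho>. cnj (U \<rho>) * V' \<rho> - cnj (V \<rho>) * U' \<rho>)"
      by (intro ends0_diff cnj_U_V'_ends0[OF d d' M] cnj_V_U'_ends0[OF d d' M])
    fix \<rho> assume r: "\<rho> \<in> strip"
    note D = dirac_pairD[OF d] and D' = dirac_pairD[OF d']
    show "((\<lambda>\<rho>. cnj (U \<rho>) * V' \<rho> - cnj (V \<rho>) * U' \<rho>) has_vector_derivative of_real (m - n) * ?f \<rho>) (at \<rho>)"
      by (rule has_vector_derivative_eq_rhs, rule has_vector_derivative_diff[OF
        has_vector_derivative_mult[OF has_vector_derivative_cnj[OF D(1)[OF r]] D'(2)[OF r]]
        has_vector_derivative_mult[OF has_vector_derivative_cnj[OF D(2)[OF r]] D'(1)[OF r]]])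
       (simp add: algebra_simps)
  qed
  moreover have "set_integrable lborel strip (\<lambda>\<rho>. of_real (m - n) * ?f \<rho>)"
    using pair_integrable[OF d d' M] by simp
  ultimately have "set_lebesgue_integral lborel strip (\<lambda>\<rho>. of_real (m - n) * ?f \<rho>) = 0"
    by (intro set_integral_strip_eqI)
  then show ?thesis using mn unfolding pair_ip_def by simp
qed

lemma raise_norm_pointwise:
  "cnj (raise_U M \<nu> U V \<rho>) * raise_U M \<nu> U V \<rho> + cnj (raise_V M \<nu> U V \<rho>) * raise_V M \<nu> U V \<rho> =
    of_real (\<nu>\<^sup>2 + M\<^sup>2) * (cnj (U \<rho>) * U \<rho> + cnj (V \<rho>) * V \<rho>) +
    of_real (2 * M * \<nu>) * (of_real (sin \<rho>) * (cnj (U \<rho>) * U \<rho> - cnj (V \<rho>) * V \<rho>) -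
      of_real (cos \<rho>) * (cnj (U \<rho>) * V \<rho> + cnj (V \<rho>) * U \<rho>))" (is "?l = _")
proof -
  have "?l = ((of_real \<nu>)\<^sup>2 * ((of_real (cos \<rho>))\<^sup>2 + (of_real (sin \<rho>))\<^sup>2) + (of_real M)\<^sup>2) * (cnj (U \<rho>) * U \<rho> + cnj (V \<rho>) * V \<rho>) +
    2 * of_real M * of_real \<nu> * (of_real (sin \<rho>) * (cnj (U \<rho>) * U \<rho> - cnj (V \<rho>) * V \<rho>) -
      of_real (cos \<rho>) * (cnj (U \<rho>) * V \<rho> + cnj (V \<rho>) * U \<rho>))"
    by (simp add: raise_U_def raise_V_def algebra_simps power2_eq_square)
  then show ?thesis unfolding complex_sin_cos_sq by simp
qed

text \<open>Put N = |U|^2 + |V|^2, D = |U|^2 - |V|^2 and S = 2 Re (cnj U V). The two integrands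
  differ by 2 M^2 N + 2 M \<nu> (sin D - cos S), which is a total derivative. The resulting factor
  is the one expected if \<open>L_plus\<close> and - \<open>L_minus\<close> are adjoint.\<close>

lemma dirac_pair_raise_norm:
  assumes d: "dirac_pair M (of_real w) U V" and M: "\<bar>M\<bar> < 1 / 2"
  defines "\<nu> \<equiv> w + 1 / 2"
  shows "pair_ip (raise_U M \<nu> U V) (raise_V M \<nu> U V) (raise_U M \<nu> U V) (raise_V M \<nu> U V) =
    of_real (\<nu>\<^sup>2 - M\<^sup>2) * pair_ip U V U V"
proof -
  let ?U = "raise_U M \<nu> U V" and ?V = "raise_V M \<nu> U V"
  let ?f = "\<lambda>\<rho>. cnj (U \<rho>) * U \<rho> + cnj (V \<rho>) * V \<rho>"
  let ?g = "\<lambda>\<rho>. cnj (?U \<rho>) * ?U \<rho> + cnj (?V \<rho>) * ?V \<rho>"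
  let ?h = "\<lambda>\<rho>. ?g \<rho> - of_real (\<nu>\<^sup>2 - M\<^sup>2) * ?f \<rho>"
  have d': "dirac_pair M (of_real (w + 1)) ?U ?V" unfolding \<nu>_def by (rule dirac_pair_raise[OF d M])
  have i: "set_integrable lborel strip ?f" "set_integrable lborel strip ?g"
    using pair_integrable[OF d d M] pair_integrable[OF d' d' M] .
  then have i': "set_integrable lborel strip (\<lambda>\<rho>. of_real (\<nu>\<^sup>2 - M\<^sup>2) * ?f \<rho>)" by simp
  \<comment> \<open>B = - M (cos D + sin S); its derivative follows from D' = 2 w S - 2 K N and S' =
    - 2 w D with K = M / cos.\<close>
  define B where "B \<rho> = of_real (- M) * (of_real (cos \<rho>) * (cnj (U \<rho>) * U \<rho>) - of_real (cos \<rho>) * (cnj (V \<rho>) * V \<rho>))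
      - of_real M * ((cnj (U \<rho>) * V \<rho> + cnj (V \<rho>) * U \<rho>) * of_real (sin \<rho>))" for \<rho>
  have "(?h has_integral 0) {-(pi/2)..pi/2}"
  proof (rule strip_has_integral_zero[of B])
    show "ends0 B" unfolding B_def[abs_def]
      by (intro ends0_diff ends0_cmult ends0_mult_sin[where h="\<lambda>x. x"] ends0_add cos_U_U_ends0[OF d M]
          cnj_U_V'_ends0[OF d d M] cnj_V_U'_ends0[OF d d M] continuous_intros)
    fix \<rho> assume r: "\<rho> \<in> strip"
    note D = dirac_pairD(1,2)[OF d r] 
    note D' = has_vector_derivative_cnj[OF D(1)] has_vector_derivative_cnj[OF D(2)]
    have c: "((\<lambda>\<rho>. complex_of_real (cos \<rho>)) has_vector_derivative of_real (- sin \<rho>)) (at \<rho>)"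
      "((\<lambda>\<rho>. complex_of_real (sin \<rho>)) has_vector_derivative of_real (cos \<rho>)) (at \<rho>)"
      by (rule has_vector_derivative_of_real, auto intro!: derivative_eq_intros)+
    define K where "K = complex_of_real (M / cos \<rho>)"
    have M: "complex_of_real M = K * of_real (cos \<rho>)"
      unfolding K_def of_real_mult[symmetric] using strip_cos_pos[OF r] by simp
    have complex_cnj_K: "cnj K = K" by (simp add: K_def)
    have w: "complex_of_real w = of_real \<nu> - 1 / 2" by (simp add: \<nu>_def)
    show "(B has_vector_derivative ?h \<rho>) (at \<rho>)"
      unfolding B_def[abs_def]
      by (rule has_vector_derivative_eq_rhs, rule has_vector_derivative_diff[OF
            has_vector_derivative_mult_right[OF has_vector_derivative_diff[OF
              has_vector_derivative_mult[OF c(1) has_vector_derivative_mult[OF D'(1) D(1)]]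
              has_vector_derivative_mult[OF c(1) has_vector_derivative_mult[OF D'(2) D(2)]]]]
            has_vector_derivative_mult_right[OF has_vector_derivative_mult[OF has_vector_derivative_add[OF
               has_vector_derivative_mult[OF D'(1) D(2)] has_vector_derivative_mult[OF D'(2) D(1)]] c(2)]]])
       (simp only: raise_norm_pointwise K_def[symmetric] of_real_mult of_real_add of_real_diff of_real_minus
          of_real_power of_real_numeral complex_cnj_mult complex_cnj_diff complex_cnj_complex_of_real w M complex_cnj_K,
        simp add: field_simps power2_eq_square)
  qed
  moreover have "set_integrable lborel strip ?h" using i(2) i' by (rule set_integral_diff(1))
  ultimately have "set_lebesgue_integral lborel strip ?h = 0" by (intro set_integral_strip_eqI)
  then show ?thesis unfolding set_integral_diff(2)[OF i(2) i'] pair_ip_def by simp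
qed

section \<open>Reduction of the boundary conditions\<close>

text \<open>The component that the boundary condition annihilates: (c, s) is (1, 0) for type III,
  (0, 1) for type IV and (cos bp, sin bp) in the massless theories.\<close>

definition rot_U :: "real \<Rightarrow> real \<Rightarrow> complex ^ 2 \<Rightarrow> complex" where
  "rot_U c s x = of_real c * x $ 1 + of_real s * x $ 2"

definition rot_V :: "real \<Rightarrow> real \<Rightarrow> complex ^ 2 \<Rightarrow> complex" where
  "rot_V c s x = of_real c * x $ 2 - of_real s * x $ 1"

lemma rot_unit: "c\<^sup>2 + s\<^sup>2 = 1 \<Longrightarrow> (complex_of_real c)\<^sup>2 + (complex_of_real s)\<^sup>2 = 1"
  by (metis of_real_1 of_real_add of_real_power)

lemma rot_inverse:
  assumes "c\<^sup>2 + s\<^sup>2 = 1"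
  shows "of_real c * rot_U c s x - of_real s * rot_V c s x = x $ 1"
    "of_real s * rot_U c s x + of_real c * rot_V c s x = x $ 2"
proof -
  have "of_real c * rot_U c s x - of_real s * rot_V c s x = ((of_real c)\<^sup>2 + (of_real s)\<^sup>2) * x $ 1"
    "of_real s * rot_U c s x + of_real c * rot_V c s x = ((of_real c)\<^sup>2 + (of_real s)\<^sup>2) * x $ 2"
    by (simp_all add: rot_U_def rot_V_def algebra_simps power2_eq_square)
  then show "of_real c * rot_U c s x - of_real s * rot_V c s x = x $ 1"
    "of_real s * rot_U c s x + of_real c * rot_V c s x = x $ 2"
    unfolding rot_unit[OF assms] by simp_all
qed

lemma rot_vector:
  assumes "c\<^sup>2 + s\<^sup>2 = 1"
  shows "rot_U c s (vector [of_real c * a - of_real s * b, of_real s * a + of_real c * b]) = a"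
    "rot_V c s (vector [of_real c * a - of_real s * b, of_real s * a + of_real c * b]) = b"
proof -
  have "rot_U c s (vector [of_real c * a - of_real s * b, of_real s * a + of_real c * b]) = ((of_real c)\<^sup>2 + (of_real s)\<^sup>2) * a"
    "rot_V c s (vector [of_real c * a - of_real s * b, of_real s * a + of_real c * b]) = ((of_real c)\<^sup>2 + (of_real s)\<^sup>2) * b"
    by (simp_all add: rot_U_def rot_V_def algebra_simps power2_eq_square)
  then show "rot_U c s (vector [of_real c * a - of_real s * b, of_real s * a + of_real c * b]) = a"
    "rot_V c s (vector [of_real c * a - of_real s * b, of_real s * a + of_real c * b]) = b"
    unfolding rot_unit[OF assms] by simp_all
qed

lemma rot_eqI:
  assumes "c\<^sup>2 + s\<^sup>2 = 1" "rot_U c s x = rot_U c s y" "rot_V c s x = rot_V c s y"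
  shows "x = y"
  unfolding vec_eq_iff forall_2
  using rot_inverse[OF assms(1), of x] rot_inverse[OF assms(1), of y] assms(2,3) by simp

lemma rot_nonzero_iff:
  assumes "c\<^sup>2 + s\<^sup>2 = 1" shows "x \<noteq> 0 \<longleftrightarrow> rot_U c s x \<noteq> 0 \<or> rot_V c s x \<noteq> 0"
proof -
  have "rot_U c s 0 = 0" "rot_V c s 0 = 0" by (simp_all add: rot_U_def rot_V_def)
  then show ?thesis using rot_eqI[OF assms, of x 0] by auto
qed

lemma rot_ip:
  assumes "c\<^sup>2 + s\<^sup>2 = 1"
  shows "(\<Sum>i\<in>UNIV. cnj (x $ i) * y $ i) =
    cnj (rot_U c s x) * rot_U c s y + cnj (rot_V c s x) * rot_V c s y"
proof -
  have "cnj (rot_U c s x) * rot_U c s y + cnj (rot_V c s x) * rot_V c s y =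
    ((of_real c)\<^sup>2 + (of_real s)\<^sup>2) * (\<Sum>i\<in>UNIV. cnj (x $ i) * y $ i)"
    by (simp add: rot_U_def rot_V_def sum_2 algebra_simps power2_eq_square)
  then show ?thesis unfolding rot_unit[OF assms] by simp
qed

lemma rot_scale: "rot_U c s (z *s x) = z * rot_U c s x" "rot_V c s (z *s x) = z * rot_V c s x"
  by (simp_all add: rot_U_def rot_V_def algebra_simps)

section \<open>The Dirac operator as a first order system\<close>

lemma has_vector_derivative_spinor:
  fixes \<Phi> :: "real \<Rightarrow> complex ^ 2"
  shows "(\<Phi> has_vector_derivative D) (at \<rho>) \<longleftrightarrow>
    ((\<lambda>x. \<Phi> x $ 1) has_vector_derivative D $ 1) (at \<rho>) \<and> ((\<lambda>x. \<Phi> x $ 2) has_vector_derivative D $ 2) (at \<rho>)"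
proof safe
  assume a: "((\<lambda>x. \<Phi> x $ 1) has_vector_derivative D $ 1) (at \<rho>)" "((\<lambda>x. \<Phi> x $ 2) has_vector_derivative D $ 2) (at \<rho>)"
  have b: "bounded_linear (\<lambda>z. vector [z, 0] :: complex ^ 2)" "bounded_linear (\<lambda>z. vector [0, z] :: complex ^ 2)"
    unfolding linear_conv_bounded_linear[symmetric]
    by (auto intro!: linearI simp: vec_eq_iff forall_2)
  have e: "vector [x $ 1, 0] + vector [0, x $ 2] = x" for x :: "complex ^ 2"
    by (simp add: vec_eq_iff forall_2)
  show "(\<Phi> has_vector_derivative D) (at \<rho>)"
    using has_vector_derivative_add[OF bounded_linear.has_vector_derivative[OF b(1) a(1)]
      bounded_linear.has_vector_derivative[OF b(2) a(2)]] by (simp add: e)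
qed (auto intro: bounded_linear.has_vector_derivative[OF bounded_linear_vec_nth])

definition dirac_ode :: "real \<Rightarrow> complex \<Rightarrow> (real \<Rightarrow> complex) \<Rightarrow> (real \<Rightarrow> complex) \<Rightarrow> bool" where
  "dirac_ode M w U V \<longleftrightarrow>
     (\<forall>\<rho>\<in>strip. (U has_vector_derivative (w * V \<rho> - of_real (M / cos \<rho>) * U \<rho>)) (at \<rho>) \<and>
       (V has_vector_derivative (of_real (M / cos \<rho>) * V \<rho> - w * U \<rho>)) (at \<rho>))"

lemma dirac_pair_iff: "dirac_pair M w U V \<longleftrightarrow> dirac_ode M w U V \<and> ends0 (\<lambda>\<rho>. csig (- M) \<rho> * U \<rho>)"
  unfolding dirac_pair_def dirac_ode_def by simp

lemma dirac_op_iff_ode: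
  "(\<Phi> differentiable_on strip \<and> (\<forall>\<rho>\<in>strip. dirac_op M \<Phi> \<rho> = w *s \<Phi> \<rho>)) \<longleftrightarrow>
    dirac_ode M w (\<lambda>\<rho>. \<Phi> \<rho> $ 1) (\<lambda>\<rho>. \<Phi> \<rho> $ 2)" (is "?l \<longleftrightarrow> ?r")
proof
  assume l: ?l
  show ?r unfolding dirac_ode_def
  proof
    fix \<rho> assume r: "\<rho> \<in> strip"
    have "\<Phi> differentiable (at \<rho>)"
      using l r differentiable_on_eq_differentiable_at[OF open_greaterThanLessThan] by blast
    then have "(\<Phi> has_vector_derivative vector_derivative \<Phi> (at \<rho>)) (at \<rho>)"
      by (simp only: vector_derivative_works)
    then have d: "((\<lambda>x. \<Phi> x $ 1) has_vector_derivative vector_derivative \<Phi> (at \<rho>) $ 1) (at \<rho>)"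
      "((\<lambda>x. \<Phi> x $ 2) has_vector_derivative vector_derivative \<Phi> (at \<rho>) $ 2) (at \<rho>)"
      unfolding has_vector_derivative_spinor by auto
    have "dirac_op M \<Phi> \<rho> = w *s \<Phi> \<rho>" using l r by blast
    then have "dirac_op M \<Phi> \<rho> $ 1 = w * \<Phi> \<rho> $ 1" "dirac_op M \<Phi> \<rho> $ 2 = w * \<Phi> \<rho> $ 2" by simp_all
    then have "vector_derivative \<Phi> (at \<rho>) $ 1 = w * \<Phi> \<rho> $ 2 - of_real (M / cos \<rho>) * \<Phi> \<rho> $ 1"
      "vector_derivative \<Phi> (at \<rho>) $ 2 = of_real (M / cos \<rho>) * \<Phi> \<rho> $ 2 - w * \<Phi> \<rho> $ 1"
      unfolding dirac_op_def vector_2 vector_derivative_at[OF d(1)] vector_derivative_at[OF d(2)]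
      by (simp_all add: algebra_simps eq_diff_eq diff_eq_eq)
    then show "((\<lambda>\<rho>. \<Phi> \<rho> $ 1) has_vector_derivative w * \<Phi> \<rho> $ 2 - of_real (M / cos \<rho>) * \<Phi> \<rho> $ 1) (at \<rho>) \<and>
      ((\<lambda>\<rho>. \<Phi> \<rho> $ 2) has_vector_derivative of_real (M / cos \<rho>) * \<Phi> \<rho> $ 2 - w * \<Phi> \<rho> $ 1) (at \<rho>)"
      using d by simp
  qed
next
  assume r: ?r
  have d: "((\<lambda>\<rho>. \<Phi> \<rho> $ 1) has_vector_derivative w * \<Phi> \<rho> $ 2 - of_real (M / cos \<rho>) * \<Phi> \<rho> $ 1) (at \<rho>)"
      "((\<lambda>\<rho>. \<Phi> \<rho> $ 2) has_vector_derivative of_real (M / cos \<rho>) * \<Phi> \<rho> $ 2 - w * \<Phi> \<rho> $ 1) (at \<rho>)"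
    if "\<rho> \<in> strip" for \<rho> using r that unfolding dirac_ode_def by blast+
  have "(\<Phi> has_vector_derivative vector [w * \<Phi> \<rho> $ 2 - of_real (M / cos \<rho>) * \<Phi> \<rho> $ 1,
      of_real (M / cos \<rho>) * \<Phi> \<rho> $ 2 - w * \<Phi> \<rho> $ 1]) (at \<rho>)" if "\<rho> \<in> strip" for \<rho>
    unfolding has_vector_derivative_spinor vector_2 using d[OF that] by blast
  then have "\<Phi> differentiable_on strip"
    by (meson differentiableI_vector differentiable_at_imp_differentiable_on)
  moreover have "dirac_op M \<Phi> \<rho> = w *s \<Phi> \<rho>" if "\<rho> \<in> strip" for \<rho>
    unfolding dirac_op_def vector_derivative_at[OF d(1)[OF that]] vector_derivative_at[OF d(2)[OF that]]
    by (simp add: vec_eq_iff forall_2)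
  ultimately show ?l by blast
qed

text \<open>A rotation by a right angle interchanges the two equations and reverses the sign of the
  mass term.\<close>

lemma dirac_ode_neg_mass: "dirac_ode (- M) w V (\<lambda>\<rho>. - U \<rho>) \<longleftrightarrow> dirac_ode M w U V"
proof -
  have m: "((\<lambda>\<rho>. - U \<rho>) has_vector_derivative D) (at \<rho>) \<longleftrightarrow> (U has_vector_derivative - D) (at \<rho>)" for D \<rho>
    using has_vector_derivative_minus[of U "- D" "at \<rho>"] has_vector_derivative_minus[of "\<lambda>\<rho>. - U \<rho>" D "at \<rho>"] by auto
  show ?thesis unfolding dirac_ode_def m by (simp add: conj_commute)
qed

text \<open>The massless operator is the derivative times a rotation generator, which commutes with
  constant rotations.\<close>

lemma dirac_ode_massless_rotate:
  assumes "dirac_ode 0 w U V"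
  shows "dirac_ode 0 w (\<lambda>\<rho>. of_real c * U \<rho> + of_real s * V \<rho>) (\<lambda>\<rho>. of_real c * V \<rho> - of_real s * U \<rho>)"
  unfolding dirac_ode_def
proof (intro ballI conjI)
  fix \<rho> assume "\<rho> \<in> strip"
  then have d: "(U has_vector_derivative w * V \<rho>) (at \<rho>)" "(V has_vector_derivative - (w * U \<rho>)) (at \<rho>)"
    using assms unfolding dirac_ode_def by (auto simp del: greaterThanLessThan_iff)
  show "((\<lambda>\<rho>. of_real c * U \<rho> + of_real s * V \<rho>) has_vector_derivative
      w * (of_real c * V \<rho> - of_real s * U \<rho>) - of_real (0 / cos \<rho>) * (of_real c * U \<rho> + of_real s * V \<rho>)) (at \<rho>)"
    by (rule has_vector_derivative_eq_rhs, rule has_vector_derivative_add[OF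
      has_vector_derivative_mult_right[OF d(1)] has_vector_derivative_mult_right[OF d(2)]])
     (simp add: algebra_simps)
  show "((\<lambda>\<rho>. of_real c * V \<rho> - of_real s * U \<rho>) has_vector_derivative
      of_real (0 / cos \<rho>) * (of_real c * V \<rho> - of_real s * U \<rho>) - w * (of_real c * U \<rho> + of_real s * V \<rho>)) (at \<rho>)"
    by (rule has_vector_derivative_eq_rhs, rule has_vector_derivative_diff[OF
      has_vector_derivative_mult_right[OF d(2)] has_vector_derivative_mult_right[OF d(1)]])
     (simp add: algebra_simps)
qed

lemma dirac_ode_massless_rotate_iff:
  assumes "c\<^sup>2 + s\<^sup>2 = 1"
  shows "dirac_ode 0 w (\<lambda>\<rho>. \<Phi> \<rho> $ 1) (\<lambda>\<rho>. \<Phi> \<rho> $ 2) \<longleftrightarrow>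
    dirac_ode 0 w (\<lambda>\<rho>. rot_U c s (\<Phi> \<rho>)) (\<lambda>\<rho>. rot_V c s (\<Phi> \<rho>))" (is "?l \<longleftrightarrow> ?r")
proof
  assume ?l then show ?r unfolding rot_U_def rot_V_def by (rule dirac_ode_massless_rotate)
next
  assume ?r
  from dirac_ode_massless_rotate[OF this, of c "- s"] show ?l
    using rot_inverse[OF assms] by (simp add: add.commute)
qed

text \<open>Provides the square integrability clause of \<open>eigenfunction\<close> from the
  estimates for pairs, the rotation preserving the norm.\<close>

lemma rotate_integrable:
  assumes "c\<^sup>2 + s\<^sup>2 = 1" "\<bar>M\<bar> < 1 / 2"
    "dirac_pair M w (\<lambda>\<rho>. rot_U c s (\<Phi> \<rho>)) (\<lambda>\<rho>. rot_V c s (\<Phi> \<rho>))"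
  shows "set_integrable lborel strip (\<lambda>\<rho>. (norm (\<Phi> \<rho>))\<^sup>2)"
proof -
  have "(norm (\<Phi> \<rho>))\<^sup>2 = norm (cnj (rot_U c s (\<Phi> \<rho>)) * rot_U c s (\<Phi> \<rho>) + cnj (rot_V c s (\<Phi> \<rho>)) * rot_V c s (\<Phi> \<rho>))" for \<rho>
  proof -
    have "(norm (\<Phi> \<rho>))\<^sup>2 = (\<Sum>i\<in>UNIV. (norm (\<Phi> \<rho> $ i))\<^sup>2)"
      by (simp add: norm_vec_def L2_set_def sum_nonneg)
    then have "complex_of_real ((norm (\<Phi> \<rho>))\<^sup>2) = (\<Sum>i\<in>UNIV. cnj (\<Phi> \<rho> $ i) * \<Phi> \<rho> $ i)"
      by (simp only: of_real_sum complex_norm_square mult.commute)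
    from arg_cong[OF this, of norm] show ?thesis
      unfolding rot_ip[OF assms(1)] by (simp only: norm_of_real abs_power2)
  qed
  then show ?thesis
    using set_integrable_norm[OF pair_integrable[OF assms(3,3,2)]] by (simp only:)
qed

text \<open>Type IV reverses the sign of the mass, so only M^2 is kept; matrix elements and ground
  energy depend on M through M^2.\<close>

definition reduces_to :: "real \<Rightarrow> boundary_condition \<Rightarrow> real \<Rightarrow> real \<Rightarrow> real \<Rightarrow> bool" where
  "reduces_to M bc M' c s \<longleftrightarrow> c\<^sup>2 + s\<^sup>2 = 1 \<and> \<bar>M'\<bar> < 1 / 2 \<and> M'\<^sup>2 = M\<^sup>2 \<and>
     (\<forall>w \<Phi>. eigenfunction M bc w \<Phi> \<longleftrightarrow>
        dirac_pair M' w (\<lambda>\<rho>. rot_U c s (\<Phi> \<rho>)) (\<lambda>\<rho>. rot_V c s (\<Phi> \<rho>)) \<and> (\<exists>\<rho>\<in>strip. \<Phi> \<rho> \<noteq> 0))"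

text \<open>The boundary conditions are compared along solutions only. The massless case relies on
  this, since there the limits of the second rotated component come from the equation.\<close>

lemma reduces_toI:
  assumes cs: "c\<^sup>2 + s\<^sup>2 = 1" "\<bar>M'\<bar> < 1 / 2" "M'\<^sup>2 = M\<^sup>2"
    and ode: "\<And>w \<Phi>. dirac_ode M w (\<lambda>\<rho>. \<Phi> \<rho> $ 1) (\<lambda>\<rho>. \<Phi> \<rho> $ 2) \<longleftrightarrow>
      dirac_ode M' w (\<lambda>\<rho>. rot_U c s (\<Phi> \<rho>)) (\<lambda>\<rho>. rot_V c s (\<Phi> \<rho>))"
    and bc: "\<And>w \<Phi>. dirac_ode M' w (\<lambda>\<rho>. rot_U c s (\<Phi> \<rho>)) (\<lambda>\<rho>. rot_V c s (\<Phi> \<rho>)) \<Longrightarrow>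
      satisfies_bc M bc \<Phi> \<longleftrightarrow> ends0 (\<lambda>\<rho>. csig (- M') \<rho> * rot_U c s (\<Phi> \<rho>))"
  shows "reduces_to M bc M' c s"
  unfolding reduces_to_def eigenfunction_def
  using cs ode bc dirac_op_iff_ode[of _ M] rotate_integrable[OF cs(1,2)]
  unfolding dirac_pair_iff by blast

lemma reduces_to_III: assumes "0 < M" "M < 1 / 2" shows "reduces_to M DirichletIII M 1 0"
  using assms by (intro reduces_toI) (auto simp: rot_U_def rot_V_def ends0_def tilde1_def[abs_def] csig_def)

lemma reduces_to_IV: assumes "0 < M" "M < 1 / 2" shows "reduces_to M DirichletIV (- M) 0 1"
  using assms by (intro reduces_toI) (auto simp: rot_U_def rot_V_def ends0_def tilde2_def[abs_def] csig_def dirac_ode_neg_mass)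

text \<open>At the right end the condition reads \<open>rot_U\<close> = 0. At the left end its
  coefficients are (cos bm, - sin bm), and these equal (cos bp, sin bp) up to sign when bp + bm is 0
  or pi, so one rotation serves both ends.\<close>

lemma reduces_to_Angles:
  assumes "bp \<in> {0..<pi}" "bm \<in> {0..<pi}" "bp + bm \<in> {0, pi}"
  shows "reduces_to 0 (Angles bp bm) 0 (cos bp) (sin bp)"
proof (rule reduces_toI)
  let ?c = "cos bp" and ?s = "sin bp"
  show cs: "?c\<^sup>2 + ?s\<^sup>2 = 1" by simp
  show "dirac_ode 0 w (\<lambda>\<rho>. \<Phi> \<rho> $ 1) (\<lambda>\<rho>. \<Phi> \<rho> $ 2) \<longleftrightarrow>
      dirac_ode 0 w (\<lambda>\<rho>. rot_U ?c ?s (\<Phi> \<rho>)) (\<lambda>\<rho>. rot_V ?c ?s (\<Phi> \<rho>))" for w \<Phi>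
    by (rule dirac_ode_massless_rotate_iff[OF cs])
  have bm: "(cos bm = ?c \<and> sin bm = - ?s) \<or> (cos bm = - ?c \<and> sin bm = ?s)"
  proof -
    have "bp + bm = 0 \<or> bm = pi - bp" using assms(3) by auto
    then show ?thesis
    proof
      assume "bp + bm = 0" then have "bp = 0" "bm = 0" using assms(1,2) by auto
      then show ?thesis by simp
    qed simp
  qed
  fix w \<Phi> assume ode: "dirac_ode 0 w (\<lambda>\<rho>. rot_U ?c ?s (\<Phi> \<rho>)) (\<lambda>\<rho>. rot_V ?c ?s (\<Phi> \<rho>))"
  have c1: "ends0 (\<lambda>\<rho>. csig (- 0) \<rho> * rot_U ?c ?s (\<Phi> \<rho>)) \<longleftrightarrow> ends0 (\<lambda>\<rho>. rot_U ?c ?s (\<Phi> \<rho>))"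
    by (rule ends0_cong) (simp only: minus_zero csig_0 mult_1)
  show "satisfies_bc 0 (Angles bp bm) \<Phi> \<longleftrightarrow> ends0 (\<lambda>\<rho>. csig (- 0) \<rho> * rot_U ?c ?s (\<Phi> \<rho>))"
  proof
    assume "satisfies_bc 0 (Angles bp bm) \<Phi>"
    then obtain u v where uv: "(\<Phi> \<longlongrightarrow> u) (at_left (pi / 2))" "(\<Phi> \<longlongrightarrow> v) (at_right (- (pi / 2)))"
        "of_real ?c * u $ 1 = - (of_real ?s * u $ 2)" "of_real (cos bm) * v $ 1 = of_real (sin bm) * v $ 2" by auto
    have "rot_U ?c ?s u = 0" using uv(3) by (simp add: rot_U_def)
    moreover have "rot_U ?c ?s v = 0" using uv(4) bm by (auto simp: rot_U_def neg_eq_iff_add_eq_0)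
    moreover have "((\<lambda>\<rho>. rot_U ?c ?s (\<Phi> \<rho>)) \<longlongrightarrow> rot_U ?c ?s u) (at_left (pi / 2))"
      "((\<lambda>\<rho>. rot_U ?c ?s (\<Phi> \<rho>)) \<longlongrightarrow> rot_U ?c ?s v) (at_right (- (pi / 2)))"
      unfolding rot_U_def by (intro tendsto_intros uv(1,2))+
    ultimately show "ends0 (\<lambda>\<rho>. csig (- 0) \<rho> * rot_U ?c ?s (\<Phi> \<rho>))"
      unfolding c1 unfolding ends0_def by simp
  next
    \<comment> \<open>\<open>satisfies_bc\<close> asks for limits of the whole spinor, while
      \<open>ends0\<close> speaks of \<open>rot_U\<close> alone; \<open>dirac_pair_v_limits\<close>
      supplies those of \<open>rot_V\<close>.\<close>
    assume e: "ends0 (\<lambda>\<rho>. csig (- 0) \<rho> * rot_U ?c ?s (\<Phi> \<rho>))"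
    then have d: "dirac_pair 0 w (\<lambda>\<rho>. rot_U ?c ?s (\<Phi> \<rho>)) (\<lambda>\<rho>. rot_V ?c ?s (\<Phi> \<rho>))"
      unfolding dirac_pair_iff using ode by simp
    obtain l r where lr: "((\<lambda>\<rho>. csig 0 \<rho> * rot_V ?c ?s (\<Phi> \<rho>)) \<longlongrightarrow> l) (at_left (pi / 2))"
      "((\<lambda>\<rho>. csig 0 \<rho> * rot_V ?c ?s (\<Phi> \<rho>)) \<longlongrightarrow> r) (at_right (- (pi / 2)))"
      using dirac_pair_v_limits[OF d] by auto
    have ev: "eventually (\<lambda>\<rho>. csig 0 \<rho> * rot_V ?c ?s (\<Phi> \<rho>) = rot_V ?c ?s (\<Phi> \<rho>)) (at_left (pi / 2))"
      "eventually (\<lambda>\<rho>. csig 0 \<rho> * rot_V ?c ?s (\<Phi> \<rho>) = rot_V ?c ?s (\<Phi> \<rho>)) (at_right (- (pi / 2)))"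
      using eventually_strip csig_0 by (auto elim!: eventually_mono)
    have lim: "(\<Phi> \<longlongrightarrow> vector [- of_real ?s * z, of_real ?c * z]) F"
      if "((\<lambda>\<rho>. rot_V ?c ?s (\<Phi> \<rho>)) \<longlongrightarrow> z) F" "((\<lambda>\<rho>. rot_U ?c ?s (\<Phi> \<rho>)) \<longlongrightarrow> 0) F" for z F
    proof (rule vec_tendstoI)
      fix i :: 2
      have "((\<lambda>\<rho>. of_real ?c * rot_U ?c ?s (\<Phi> \<rho>) - of_real ?s * rot_V ?c ?s (\<Phi> \<rho>)) \<longlongrightarrow> of_real ?c * 0 - of_real ?s * z) F"
        "((\<lambda>\<rho>. of_real ?s * rot_U ?c ?s (\<Phi> \<rho>) + of_real ?c * rot_V ?c ?s (\<Phi> \<rho>)) \<longlongrightarrow> of_real ?s * 0 + of_real ?c * z) F"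
        by (intro tendsto_intros that)+
      then have "((\<lambda>\<rho>. \<Phi> \<rho> $ 1) \<longlongrightarrow> - of_real ?s * z) F" "((\<lambda>\<rho>. \<Phi> \<rho> $ 2) \<longlongrightarrow> of_real ?c * z) F"
        unfolding rot_inverse[OF cs] by simp_all
      then show "((\<lambda>\<rho>. \<Phi> \<rho> $ i) \<longlongrightarrow> vector [- of_real ?s * z, of_real ?c * z] $ i) F"
        using exhaust_2[of i] by auto
    qed
    have "(\<Phi> \<longlongrightarrow> vector [- of_real ?s * l, of_real ?c * l]) (at_left (pi / 2))"
      "(\<Phi> \<longlongrightarrow> vector [- of_real ?s * r, of_real ?c * r]) (at_right (- (pi / 2)))"
      using e lr unfolding c1 tendsto_cong[OF ev(1)] tendsto_cong[OF ev(2)] ends0_def by (blast intro: lim)+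
    then show "satisfies_bc 0 (Angles bp bm) \<Phi>"
      unfolding satisfies_bc.simps using bm
      by (intro exI[of _ "vector [- of_real ?s * l, of_real ?c * l]"] exI[of _ "vector [- of_real ?s * r, of_real ?c * r]"])
        (auto simp: algebra_simps)
  qed
qed auto

lemma admissible_reduces:
  assumes "admissible_theory M bc" obtains M' c s where "reduces_to M bc M' c s"
  using assms reduces_to_III reduces_to_IV reduces_to_Angles by (cases bc) (simp; metis)+

section \<open>The frequency spectrum\<close>

lemma frequency_spectrum_Ints:
  assumes "admissible_theory M bc" shows "frequency_spectrum M bc = \<int>"
proof -
  obtain M' c s where r: "reduces_to M bc M' c s" using admissible_reduces[OF assms] .
  have cs: "c\<^sup>2 + s\<^sup>2 = 1" and M: "\<bar>M'\<bar> < 1 / 2"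
    and ef: "\<And>w \<Phi>. eigenfunction M bc w \<Phi> \<longleftrightarrow>
        dirac_pair M' w (\<lambda>\<rho>. rot_U c s (\<Phi> \<rho>)) (\<lambda>\<rho>. rot_V c s (\<Phi> \<rho>)) \<and> (\<exists>\<rho>\<in>strip. \<Phi> \<rho> \<noteq> 0)"
    using r unfolding reduces_to_def by blast+
  show ?thesis
  proof
    show "frequency_spectrum M bc \<subseteq> \<int>"
      unfolding frequency_spectrum_def ef rot_nonzero_iff[OF cs] using dirac_pair_spectrum[OF _ M] by blast
    show "\<int> \<subseteq> frequency_spectrum M bc"
    proof
      fix w :: complex assume "w \<in> \<int>"
      then obtain n where w: "w = of_int n" by (auto elim: Ints_cases)
      obtain U V where d: "dirac_pair M' (of_int n) U V" and nz: "\<forall>\<rho>\<in>strip. U \<rho> \<noteq> 0 \<or> V \<rho> \<noteq> 0"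
        using dirac_pair_exists[OF M] by blast
      define \<Phi> :: "real \<Rightarrow> complex ^ 2" where
        "\<Phi> \<rho> = vector [of_real c * U \<rho> - of_real s * V \<rho>, of_real s * U \<rho> + of_real c * V \<rho>]" for \<rho>
      have UV: "rot_U c s (\<Phi> \<rho>) = U \<rho>" "rot_V c s (\<Phi> \<rho>) = V \<rho>" for \<rho>
        unfolding \<Phi>_def rot_vector[OF cs] by (rule refl)+
      have "(0::real) \<in> strip" by simp
      then have "eigenfunction M bc w \<Phi>"
        unfolding ef rot_nonzero_iff[OF cs] UV w using d nz by blast
      then show "w \<in> frequency_spectrum M bc" unfolding frequency_spectrum_def by blast
    qed
  qed
qed

text \<open>Massless solutions of frequency 0 are constant spinors. The two boundary conditions on a
  constant have determinant - sin (bp + bm), whose zeros for angles in the given range are at bp +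
  bm = 0 and pi.\<close>

lemma zero_frequency_Angles:
  assumes "bp \<in> {0..<pi}" "bm \<in> {0..<pi}"
  shows "bp + bm \<in> {0, pi} \<longleftrightarrow> 0 \<in> frequency_spectrum 0 (Angles bp bm)"
proof
  assume "bp + bm \<in> {0, pi}"
  then have "admissible_theory 0 (Angles bp bm)" using assms by simp
  then show "0 \<in> frequency_spectrum 0 (Angles bp bm)" by (simp add: frequency_spectrum_Ints)
next
  assume "0 \<in> frequency_spectrum 0 (Angles bp bm)"
  then obtain \<Phi> where e: "eigenfunction 0 (Angles bp bm) 0 \<Phi>" unfolding frequency_spectrum_def by blast
  then have "dirac_ode 0 0 (\<lambda>\<rho>. \<Phi> \<rho> $ 1) (\<lambda>\<rho>. \<Phi> \<rho> $ 2)"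
    unfolding eigenfunction_def dirac_op_iff_ode[symmetric] by blast
  then have "(\<Phi> has_vector_derivative 0) (at \<rho> within strip)" if "\<rho> \<in> strip" for \<rho>
    using that has_vector_derivative_spinor[of \<Phi> 0 \<rho>] unfolding dirac_ode_def
    by (auto intro: has_vector_derivative_at_within)
  then obtain k where k: "\<And>\<rho>. \<rho> \<in> strip \<Longrightarrow> \<Phi> \<rho> = k"
    using has_vector_derivative_zero_constant[of strip \<Phi>] by auto
  have k0: "k \<noteq> 0" using e k unfolding eigenfunction_def by auto
  obtain u v where uv: "(\<Phi> \<longlongrightarrow> u) (at_left (pi / 2))" "(\<Phi> \<longlongrightarrow> v) (at_right (- (pi / 2)))"
    "of_real (cos bp) * u $ 1 = - (of_real (sin bp) * u $ 2)" "of_real (cos bm) * v $ 1 = of_real (sin bm) * v $ 2"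
    using e unfolding eigenfunction_def by auto
  have "(\<Phi> \<longlongrightarrow> k) (at_left (pi / 2))" "(\<Phi> \<longlongrightarrow> k) (at_right (- (pi / 2)))"
    using eventually_strip k by (auto intro!: tendsto_eventually elim!: eventually_mono)
  then have "u = k" "v = k"
    using uv(1,2) tendsto_unique trivial_limit_at_left_real trivial_limit_at_right_real by blast+
  then have 1: "of_real (cos bp) * k $ 1 + of_real (sin bp) * k $ 2 = 0"
    and 2: "of_real (cos bm) * k $ 1 - of_real (sin bm) * k $ 2 = 0" using uv(3,4) by simp_all
  \<comment> \<open>Cramer's rule for the facts \<open>1\<close> and \<open>2\<close>.\<close>
  have "of_real (sin (bp + bm)) * k $ 1 = of_real (sin bm) * (of_real (cos bp) * k $ 1 + of_real (sin bp) * k $ 2)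
      + of_real (sin bp) * (of_real (cos bm) * k $ 1 - of_real (sin bm) * k $ 2)"
    "of_real (sin (bp + bm)) * k $ 2 = of_real (cos bm) * (of_real (cos bp) * k $ 1 + of_real (sin bp) * k $ 2)
      - of_real (cos bp) * (of_real (cos bm) * k $ 1 - of_real (sin bm) * k $ 2)"
    by (simp_all add: sin_add algebra_simps)
  then have "of_real (sin (bp + bm)) * k $ 1 = 0" "of_real (sin (bp + bm)) * k $ 2 = 0"
    unfolding 1 2 by simp_all
  moreover have "k $ 1 \<noteq> 0 \<or> k $ 2 \<noteq> 0" using k0 by (auto simp: vec_eq_iff forall_2)
  ultimately have s: "sin (bp + bm) = 0" by auto
  show "bp + bm \<in> {0, pi}"
  proof (rule ccontr)
    assume n: "bp + bm \<notin> {0, pi}"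
    show False
    proof (cases "bp + bm < pi")
      case True
      then have "sin (bp + bm) > 0" using assms n by (intro sin_gt_zero) auto
      then show False using s by simp
    next
      case False
      then have "sin (bp + bm) < 0" using assms n by (intro sin_lt_zero) auto
      then show False using s by simp
    qed
  qed
qed

section \<open>Action of the ladder operators on modes\<close>

lemma mode_rot:
  "rot_U c s (mode \<Phi> n t \<rho>) = exp (- \<i> * of_int n * of_real t) * rot_U c s (\<Phi> n \<rho>)"
  "rot_V c s (mode \<Phi> n t \<rho>) = exp (- \<i> * of_int n * of_real t) * rot_V c s (\<Phi> n \<rho>)"
  by (simp_all add: mode_def rot_scale)

lemma spinor_ip_mode:
  assumes cs: "c\<^sup>2 + s\<^sup>2 = 1"
  shows "spinor_ip t (mode \<Phi> m) (mode \<Phi> n) = exp (\<i> * of_int (m - n) * of_real t) *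
    pair_ip (\<lambda>\<rho>. rot_U c s (\<Phi> m \<rho>)) (\<lambda>\<rho>. rot_V c s (\<Phi> m \<rho>)) (\<lambda>\<rho>. rot_U c s (\<Phi> n \<rho>)) (\<lambda>\<rho>. rot_V c s (\<Phi> n \<rho>))"
proof -
  have e: "cnj (exp (- \<i> * of_int m * of_real t)) * exp (- \<i> * of_int n * of_real t) =
      exp (\<i> * of_int (m - n) * of_real t)"
    by (simp add: exp_cnj exp_add[symmetric] algebra_simps)
  have "(\<Sum>i\<in>UNIV. cnj (mode \<Phi> m t \<rho> $ i) * mode \<Phi> n t \<rho> $ i) = exp (\<i> * of_int (m - n) * of_real t) *
    (cnj (rot_U c s (\<Phi> m \<rho>)) * rot_U c s (\<Phi> n \<rho>) + cnj (rot_V c s (\<Phi> m \<rho>)) * rot_V c s (\<Phi> n \<rho>))" for \<rho>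
    unfolding rot_ip[OF cs] mode_rot e[symmetric] by (simp only: complex_cnj_mult distrib_left mult_ac)
  then show ?thesis unfolding spinor_ip_def pair_ip_def by (simp only: set_integral_mult_right)
qed

lemma has_vector_derivative_mode_time:
  "((\<lambda>\<tau>. mode \<Phi> n \<tau> \<rho>) has_vector_derivative (- \<i> * of_int n) *s mode \<Phi> n t \<rho>) (at t)"
proof -
  have "((\<lambda>\<tau>. exp (- \<i> * of_int n * of_real \<tau>)) has_vector_derivative
      (- \<i> * of_int n) * exp (- \<i> * of_int n * of_real t)) (at t)"
  proof -
    have "((\<lambda>z. exp (- \<i> * of_int n * z)) has_field_derivative
        (- \<i> * of_int n) * exp (- \<i> * of_int n * of_real t)) (at (of_real t))"
      by (auto intro!: derivative_eq_intros)
    then show ?thesis by (rule has_vector_derivative_real_field)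
  qed
  from has_vector_derivative_mult_left[OF this] show ?thesis
    unfolding has_vector_derivative_spinor by (simp add: mode_def mult.assoc)
qed

text \<open>The equation removes all derivatives, leaving an algebraic expression in the rotated
  components. Here \<open>\<sigma>\<close> is the sign parameter of \<open>ladder\<close>, not the
  function \<open>sigma\<close>.\<close>

lemma ladder_mode_rot:
  assumes cs: "c\<^sup>2 + s\<^sup>2 = 1" and r: "\<rho> \<in> strip"
    and ode: "dirac_ode M' (of_int n) (\<lambda>\<rho>. rot_U c s (\<Phi> n \<rho>)) (\<lambda>\<rho>. rot_V c s (\<Phi> n \<rho>))"
  shows "rot_U c s (ladder \<sigma> (mode \<Phi> n) t \<rho>) = exp (- \<sigma> * \<i> * of_real t) * exp (- \<i> * of_int n * of_real t) *
      (\<sigma> * \<i> * of_real (cos \<rho>) * (of_int n * rot_V c s (\<Phi> n \<rho>) - of_real (M' / cos \<rho>) * rot_U c s (\<Phi> n \<rho>))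
       - \<sigma> * \<i> / 2 * of_real (sin \<rho>) * rot_U c s (\<Phi> n \<rho>) - \<i> * of_int n * of_real (sin \<rho>) * rot_U c s (\<Phi> n \<rho>)
       + \<i> / 2 * of_real (cos \<rho>) * rot_V c s (\<Phi> n \<rho>))" (is ?thU)
    and "rot_V c s (ladder \<sigma> (mode \<Phi> n) t \<rho>) = exp (- \<sigma> * \<i> * of_real t) * exp (- \<i> * of_int n * of_real t) *
      (\<sigma> * \<i> * of_real (cos \<rho>) * (of_real (M' / cos \<rho>) * rot_V c s (\<Phi> n \<rho>) - of_int n * rot_U c s (\<Phi> n \<rho>))
       - \<sigma> * \<i> / 2 * of_real (sin \<rho>) * rot_V c s (\<Phi> n \<rho>) - \<i> * of_int n * of_real (sin \<rho>) * rot_V c s (\<Phi> n \<rho>)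
       - \<i> / 2 * of_real (cos \<rho>) * rot_U c s (\<Phi> n \<rho>))" (is ?thV)
proof -
  let ?E = "exp (- \<i> * of_int n * of_real t)"
  let ?U' = "of_int n * rot_V c s (\<Phi> n \<rho>) - of_real (M' / cos \<rho>) * rot_U c s (\<Phi> n \<rho>)"
  let ?V' = "of_real (M' / cos \<rho>) * rot_V c s (\<Phi> n \<rho>) - of_int n * rot_U c s (\<Phi> n \<rho>)"
  have d: "((\<lambda>\<rho>. rot_U c s (\<Phi> n \<rho>)) has_vector_derivative ?U') (at \<rho>)"
    "((\<lambda>\<rho>. rot_V c s (\<Phi> n \<rho>)) has_vector_derivative ?V') (at \<rho>)"
    using ode r unfolding dirac_ode_def by blast+
  define D :: "complex ^ 2" where "D = vector [of_real c * ?U' - of_real s * ?V', of_real s * ?U' + of_real c * ?V']"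
  have "((\<lambda>\<rho>. of_real c * rot_U c s (\<Phi> n \<rho>) - of_real s * rot_V c s (\<Phi> n \<rho>)) has_vector_derivative D $ 1) (at \<rho>)"
    "((\<lambda>\<rho>. of_real s * rot_U c s (\<Phi> n \<rho>) + of_real c * rot_V c s (\<Phi> n \<rho>)) has_vector_derivative D $ 2) (at \<rho>)"
    unfolding D_def vector_2
    by (intro has_vector_derivative_diff has_vector_derivative_add has_vector_derivative_mult_right d)+
  then have D: "((\<lambda>\<rho>. \<Phi> n \<rho> $ 1) has_vector_derivative D $ 1) (at \<rho>)" "((\<lambda>\<rho>. \<Phi> n \<rho> $ 2) has_vector_derivative D $ 2) (at \<rho>)"
    unfolding rot_inverse[OF cs] by simp_all
  have Dm: "((\<lambda>x. mode \<Phi> n t x) has_vector_derivative ?E *s D) (at \<rho>)"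
    unfolding has_vector_derivative_spinor mode_def vector_scaleR_component
    using has_vector_derivative_mult_right[OF D(1), of ?E] has_vector_derivative_mult_right[OF D(2), of ?E] by simp
  have rD: "rot_U c s D = ?U'" "rot_V c s D = ?V'" unfolding D_def rot_vector[OF cs] by (rule refl)+
  \<comment> \<open>\<open>Sigma01\<close> is a multiple of the rotation generator, so it takes the
    same form in the rotated components.\<close>
  have S: "rot_U c s (Sigma01 *v x) = \<i> / 2 * rot_V c s x" "rot_V c s (Sigma01 *v x) = - \<i> / 2 * rot_U c s x" for x
    by (simp_all add: rot_U_def rot_V_def Sigma01_def matrix_vector_mult_def sum_2 algebra_simps)
  have add: "rot_U c s (x + y) = rot_U c s x + rot_U c s y" "rot_V c s (x + y) = rot_V c s x + rot_V c s y"
    "rot_U c s (x - y) = rot_U c s x - rot_U c s y" "rot_V c s (x - y) = rot_V c s x - rot_V c s y" for x y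
    by (simp_all add: rot_U_def rot_V_def algebra_simps)
  have lad: "ladder \<sigma> (mode \<Phi> n) t \<rho> = exp (- \<sigma> * \<i> * of_real t) *s
     ((\<sigma> * \<i> * of_real (cos \<rho>)) *s (?E *s D) - (\<sigma> * \<i> / 2 * of_real (sin \<rho>)) *s (?E *s \<Phi> n \<rho>)
      + of_real (sin \<rho>) *s ((- \<i> * of_int n) *s (?E *s \<Phi> n \<rho>))
      + of_real (cos \<rho>) *s (Sigma01 *v (?E *s \<Phi> n \<rho>)))"
    unfolding ladder_def vector_derivative_at[OF Dm] vector_derivative_at[OF has_vector_derivative_mode_time]
    unfolding mode_def ..
  show ?thU unfolding lad add rot_scale S rD by (simp add: algebra_simps del: of_real_divide)
  show ?thV unfolding lad add rot_scale S rD by (simp add: algebra_simps del: of_real_divide)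
qed

lemma ladder_plus_mode:
  assumes cs: "c\<^sup>2 + s\<^sup>2 = 1" and r: "\<rho> \<in> strip"
    and ode: "dirac_ode M' (of_int n) (\<lambda>\<rho>. rot_U c s (\<Phi> n \<rho>)) (\<lambda>\<rho>. rot_V c s (\<Phi> n \<rho>))"
    and U: "raise_U M' (of_int n + 1 / 2) (\<lambda>\<rho>. rot_U c s (\<Phi> n \<rho>)) (\<lambda>\<rho>. rot_V c s (\<Phi> n \<rho>)) \<rho> = l * rot_U c s (\<Phi> (n + 1) \<rho>)"
    and V: "raise_V M' (of_int n + 1 / 2) (\<lambda>\<rho>. rot_U c s (\<Phi> n \<rho>)) (\<lambda>\<rho>. rot_V c s (\<Phi> n \<rho>)) \<rho> = l * rot_V c s (\<Phi> (n + 1) \<rho>)"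
  shows "L_plus (mode \<Phi> n) t \<rho> = (\<i> * l) *s mode \<Phi> (n + 1) t \<rho>"
proof (rule rot_eqI[OF cs])
  define K where "K = complex_of_real (M' / cos \<rho>)"
  have M: "complex_of_real M' = K * of_real (cos \<rho>)"
    unfolding K_def of_real_mult[symmetric] using strip_cos_pos[OF r] by simp
  define e where "e = exp (- \<i> * of_int (n + 1) * of_real t)"
  have E: "exp (- 1 * \<i> * of_real t) * exp (- \<i> * of_int n * of_real t) = e"
    by (simp add: e_def exp_add[symmetric] algebra_simps)
  note ops = raise_U_def raise_V_def of_real_mult of_real_add of_real_diff M
  show "rot_U c s (L_plus (mode \<Phi> n) t \<rho>) = rot_U c s ((\<i> * l) *s mode \<Phi> (n + 1) t \<rho>)"
    unfolding ladder_mode_rot(1)[where n=n and \<Phi>=\<Phi>, OF cs r ode] rot_scale mode_rot E e_def[symmetric]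
    unfolding mult.assoc mult.left_commute[of l] U[symmetric] K_def[symmetric]
    unfolding ops by (simp add: field_simps)
  show "rot_V c s (L_plus (mode \<Phi> n) t \<rho>) = rot_V c s ((\<i> * l) *s mode \<Phi> (n + 1) t \<rho>)"
    unfolding ladder_mode_rot(2)[where n=n and \<Phi>=\<Phi>, OF cs r ode] rot_scale mode_rot E e_def[symmetric]
    unfolding mult.assoc mult.left_commute[of l] V[symmetric] K_def[symmetric]
    unfolding ops by (simp add: field_simps)
qed

lemma ladder_minus_mode:
  assumes cs: "c\<^sup>2 + s\<^sup>2 = 1" and r: "\<rho> \<in> strip"
    and ode: "dirac_ode M' (of_int n) (\<lambda>\<rho>. rot_U c s (\<Phi> n \<rho>)) (\<lambda>\<rho>. rot_V c s (\<Phi> n \<rho>))"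
    and U: "lower_U M' (of_int n - 1 / 2) (\<lambda>\<rho>. rot_U c s (\<Phi> n \<rho>)) (\<lambda>\<rho>. rot_V c s (\<Phi> n \<rho>)) \<rho> = l * rot_U c s (\<Phi> (n - 1) \<rho>)"
    and V: "lower_V M' (of_int n - 1 / 2) (\<lambda>\<rho>. rot_U c s (\<Phi> n \<rho>)) (\<lambda>\<rho>. rot_V c s (\<Phi> n \<rho>)) \<rho> = l * rot_V c s (\<Phi> (n - 1) \<rho>)"
  shows "L_minus (mode \<Phi> n) t \<rho> = (\<i> * l) *s mode \<Phi> (n - 1) t \<rho>"
proof (rule rot_eqI[OF cs])
  define K where "K = complex_of_real (M' / cos \<rho>)"
  have M: "complex_of_real M' = K * of_real (cos \<rho>)"
    unfolding K_def of_real_mult[symmetric] using strip_cos_pos[OF r] by simp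
  define e where "e = exp (- \<i> * of_int (n - 1) * of_real t)"
  have E: "exp (- (- 1) * \<i> * of_real t) * exp (- \<i> * of_int n * of_real t) = e"
    by (simp add: e_def exp_add[symmetric] algebra_simps)
  note ops = lower_U_def lower_V_def of_real_mult of_real_add of_real_diff M
  show "rot_U c s (L_minus (mode \<Phi> n) t \<rho>) = rot_U c s ((\<i> * l) *s mode \<Phi> (n - 1) t \<rho>)"
    unfolding ladder_mode_rot(1)[where n=n and \<Phi>=\<Phi>, OF cs r ode] rot_scale mode_rot E e_def[symmetric]
    unfolding mult.assoc mult.left_commute[of l] U[symmetric] K_def[symmetric]
    unfolding ops by (simp add: field_simps)
  show "rot_V c s (L_minus (mode \<Phi> n) t \<rho>) = rot_V c s ((\<i> * l) *s mode \<Phi> (n - 1) t \<rho>)"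
    unfolding ladder_mode_rot(2)[where n=n and \<Phi>=\<Phi>, OF cs r ode] rot_scale mode_rot E e_def[symmetric]
    unfolding mult.assoc mult.left_commute[of l] V[symmetric] K_def[symmetric]
    unfolding ops by (simp add: field_simps)
qed

lemma spinor_ip_scale_right:
  assumes "\<And>\<rho>. \<rho> \<in> strip \<Longrightarrow> \<Psi>' t \<rho> = z *s \<Psi>'' t \<rho>"
  shows "spinor_ip t \<Psi> \<Psi>' = z * spinor_ip t \<Psi> \<Psi>''"
proof -
  have "spinor_ip t \<Psi> \<Psi>' = set_lebesgue_integral lborel strip (\<lambda>\<rho>. z * (\<Sum>i\<in>UNIV. cnj (\<Psi> t \<rho> $ i) * \<Psi>'' t \<rho> $ i))"
    unfolding spinor_ip_def using assms
    by (intro set_lebesgue_integral_cong) (auto simp: sum_distrib_left mult_ac)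
  then show ?thesis unfolding spinor_ip_def by simp
qed

text \<open>Simplicity makes the raised mode an unknown multiple \<open>k n\<close> of the next
  mode, whose phase depends on the chosen modes; the norm computation determines |k n|^2. This is
  all the information that the charges require.\<close>

theorem ladder_matrix_elements:
  assumes adm: "admissible_theory M bc" and nm: "normalized_modes M bc \<Phi>"
  obtains l :: "int \<Rightarrow> complex" where
    "\<And>n. l n * cnj (l n) = of_real ((of_int n + 1 / 2)\<^sup>2 - M\<^sup>2)"
    "\<And>t m n. spinor_ip t (mode \<Phi> m) (L_plus (mode \<Phi> n)) = (if m = n + 1 then l n else 0)"
    "\<And>t m n. spinor_ip t (mode \<Phi> m) (L_minus (mode \<Phi> n)) = (if n = m + 1 then - cnj (l m) else 0)"
proof -
  obtain M' c s where rd: "reduces_to M bc M' c s" using admissible_reduces[OF adm] .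
  have cs: "c\<^sup>2 + s\<^sup>2 = 1" and M: "\<bar>M'\<bar> < 1 / 2" and MM: "M'\<^sup>2 = M\<^sup>2"
    and ef: "\<And>w \<Phi>. eigenfunction M bc w \<Phi> \<longleftrightarrow>
        dirac_pair M' w (\<lambda>\<rho>. rot_U c s (\<Phi> \<rho>)) (\<lambda>\<rho>. rot_V c s (\<Phi> \<rho>)) \<and> (\<exists>\<rho>\<in>strip. \<Phi> \<rho> \<noteq> 0)"
    using rd unfolding reduces_to_def by blast+
  define U where "U n \<rho> = rot_U c s (\<Phi> n \<rho>)" for n \<rho>
  define V where "V n \<rho> = rot_V c s (\<Phi> n \<rho>)" for n \<rho>
  define \<nu> where "\<nu> n = real_of_int n + 1 / 2" for n
  have d: "dirac_pair M' (of_int n) (U n) (V n)" and nz: "\<exists>\<rho>\<in>strip. U n \<rho> \<noteq> 0 \<or> V n \<rho> \<noteq> 0" for n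
    using nm unfolding normalized_modes_def ef rot_nonzero_iff[OF cs] U_def[abs_def] V_def[abs_def] by blast+
  have d': "dirac_pair M' (of_real (real_of_int n)) (U n) (V n)" for n using d[of n] by simp
  have ode: "dirac_ode M' (of_int n) (\<lambda>\<rho>. rot_U c s (\<Phi> n \<rho>)) (\<lambda>\<rho>. rot_V c s (\<Phi> n \<rho>))" for n
    using d[of n] unfolding dirac_pair_iff U_def[abs_def] V_def[abs_def] by blast
  have ip: "spinor_ip t (mode \<Phi> m) (mode \<Phi> n) = exp (\<i> * of_int (m - n) * of_real t) * pair_ip (U m) (V m) (U n) (V n)" for t m n
    unfolding U_def[abs_def] V_def[abs_def] by (rule spinor_ip_mode[OF cs])
  have norm: "pair_ip (U n) (V n) (U n) (V n) = 1" for n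
    using nm ip[of 0 n n] unfolding normalized_modes_def by simp
  have orth: "spinor_ip t (mode \<Phi> m) (mode \<Phi> n) = (if m = n then 1 else 0)" for t m n
    using dirac_pair_orthogonal[OF d' d' M, of m n] norm[of n] unfolding ip by simp
  have raise: "\<exists>k. \<forall>\<rho>\<in>strip. raise_U M' (\<nu> n) (U n) (V n) \<rho> = k * U (n + 1) \<rho> \<and> raise_V M' (\<nu> n) (U n) (V n) \<rho> = k * V (n + 1) \<rho>" for n
  proof -
    have "dirac_pair M' (of_int (n + 1)) (raise_U M' (\<nu> n) (U n) (V n)) (raise_V M' (\<nu> n) (U n) (V n))"
      using dirac_pair_raise[OF d'[of n] M] by (simp add: \<nu>_def)
    then show ?thesis using dirac_pair_simple[OF d _ M nz] by blast
  qed
  then obtain k where k: "\<And>n \<rho>. \<rho> \<in> strip \<Longrightarrow> raise_U M' (\<nu> n) (U n) (V n) \<rho> = k n * U (n + 1) \<rho>"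
    "\<And>n \<rho>. \<rho> \<in> strip \<Longrightarrow> raise_V M' (\<nu> n) (U n) (V n) \<rho> = k n * V (n + 1) \<rho>" by metis
  have kk: "cnj (k n) * k n = of_real ((\<nu> n)\<^sup>2 - M\<^sup>2)" for n
  proof -
    have "pair_ip (raise_U M' (\<nu> n) (U n) (V n)) (raise_V M' (\<nu> n) (U n) (V n)) (raise_U M' (\<nu> n) (U n) (V n)) (raise_V M' (\<nu> n) (U n) (V n)) =
      set_lebesgue_integral lborel strip (\<lambda>\<rho>. (cnj (k n) * k n) * (cnj (U (n+1) \<rho>) * U (n+1) \<rho> + cnj (V (n+1) \<rho>) * V (n+1) \<rho>))"
      unfolding pair_ip_def using k by (intro set_lebesgue_integral_cong) (auto simp: algebra_simps)
    also have "\<dots> = cnj (k n) * k n * pair_ip (U (n+1)) (V (n+1)) (U (n+1)) (V (n+1))"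
      unfolding pair_ip_def by (simp only: set_integral_mult_right)
    finally show ?thesis
      using dirac_pair_raise_norm[OF d' M, of n] unfolding norm \<nu>_def MM by simp
  qed
  have k0: "k n \<noteq> 0" for n
  proof
    assume "k n = 0"
    then have "complex_of_real ((\<nu> n)\<^sup>2 - M\<^sup>2) = 0" using kk[of n] by simp
    then show False using half_odd_sq_gt[OF M, of n] unfolding MM \<nu>_def of_real_eq_0_iff by simp
  qed
  \<comment> \<open>Lowering after raising multiplies by |k n|^2; cancelling \<open>k n\<close>
    leaves its conjugate.\<close>
  have lower: "lower_U M' (\<nu> n) (U (n + 1)) (V (n + 1)) \<rho> = cnj (k n) * U n \<rho>"
    "lower_V M' (\<nu> n) (U (n + 1)) (V (n + 1)) \<rho> = cnj (k n) * V n \<rho>" if r: "\<rho> \<in> strip" for n \<rho>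
  proof -
    have "k n * lower_U M' (\<nu> n) (U (n + 1)) (V (n + 1)) \<rho> = of_real ((\<nu> n)\<^sup>2 - M'\<^sup>2) * U n \<rho>"
      "k n * lower_V M' (\<nu> n) (U (n + 1)) (V (n + 1)) \<rho> = of_real ((\<nu> n)\<^sup>2 - M'\<^sup>2) * V n \<rho>"
      unfolding lower_raise[of M' "\<nu> n" "U n" "V n" \<rho>, symmetric]
      unfolding lower_U_def[of _ _ "raise_U _ _ _ _"] lower_V_def[of _ _ "raise_U _ _ _ _"] k[OF r]
      by (simp_all add: lower_U_def lower_V_def algebra_simps)
    then have "k n * lower_U M' (\<nu> n) (U (n + 1)) (V (n + 1)) \<rho> = k n * (cnj (k n) * U n \<rho>)"
      "k n * lower_V M' (\<nu> n) (U (n + 1)) (V (n + 1)) \<rho> = k n * (cnj (k n) * V n \<rho>)"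
      unfolding MM kk[symmetric] by (simp_all only: mult_ac)
    then show "lower_U M' (\<nu> n) (U (n + 1)) (V (n + 1)) \<rho> = cnj (k n) * U n \<rho>"
      "lower_V M' (\<nu> n) (U (n + 1)) (V (n + 1)) \<rho> = cnj (k n) * V n \<rho>" using k0[of n] by simp_all
  qed
  have plus: "L_plus (mode \<Phi> n) t \<rho> = (\<i> * k n) *s mode \<Phi> (n + 1) t \<rho>" if r: "\<rho> \<in> strip" for n t \<rho>
    by (rule ladder_plus_mode[OF cs r ode])
      (use k[OF r, of n] in \<open>simp_all only: U_def[abs_def] V_def[abs_def] \<nu>_def\<close>)
  have minus: "L_minus (mode \<Phi> n) t \<rho> = (\<i> * cnj (k (n - 1))) *s mode \<Phi> (n - 1) t \<rho>" if r: "\<rho> \<in> strip" for n t \<rho>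
  proof (rule ladder_minus_mode[OF cs r ode])
    have n: "\<nu> (n - 1) = of_int n - 1 / 2" by (simp add: \<nu>_def)
    show "lower_U M' (of_int n - 1 / 2) (\<lambda>\<rho>. rot_U c s (\<Phi> n \<rho>)) (\<lambda>\<rho>. rot_V c s (\<Phi> n \<rho>)) \<rho> = cnj (k (n - 1)) * rot_U c s (\<Phi> (n - 1) \<rho>)"
      "lower_V M' (of_int n - 1 / 2) (\<lambda>\<rho>. rot_U c s (\<Phi> n \<rho>)) (\<lambda>\<rho>. rot_V c s (\<Phi> n \<rho>)) \<rho> = cnj (k (n - 1)) * rot_V c s (\<Phi> (n - 1) \<rho>)"
      using lower[OF r, of "n - 1"] unfolding n by (simp_all add: U_def[abs_def] V_def[abs_def])
  qed
  show ?thesis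
  \<comment> \<open>The factor \<open>\<i>\<close> of the ladder operators is absorbed in l;
    \<open>\<i> * cnj (k m)\<close> then equals \<open>- cnj (l m)\<close>.\<close>
  proof (rule that[of "\<lambda>n. \<i> * k n"])
    show "\<i> * k n * cnj (\<i> * k n) = of_real ((of_int n + 1 / 2)\<^sup>2 - M\<^sup>2)" for n
      unfolding \<nu>_def[symmetric] kk[symmetric] by (simp add: algebra_simps)
    show "spinor_ip t (mode \<Phi> m) (L_plus (mode \<Phi> n)) = (if m = n + 1 then \<i> * k n else 0)" for t m n
      using spinor_ip_scale_right[of "L_plus (mode \<Phi> n)" t "\<i> * k n" "mode \<Phi> (n + 1)" "mode \<Phi> m"] plus
      unfolding orth by auto
    show "spinor_ip t (mode \<Phi> m) (L_minus (mode \<Phi> n)) = (if n = m + 1 then - cnj (\<i> * k m) else 0)" for t m n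
      using spinor_ip_scale_right[of "L_minus (mode \<Phi> n)" t "\<i> * cnj (k (n - 1))" "mode \<Phi> (n - 1)" "mode \<Phi> m"] minus
      unfolding orth by auto
  qed
qed

section \<open>Lowest weight representations\<close>

text \<open>A unit lowest weight vector together with the fact that it generates. Both the space
  generated by a Fock vacuum and any abstract discrete series representation are instances, and they
  are compared here.\<close>

locale lowest_weight =
  fixes R :: "'v::ab_group_add sl2_rep" and v :: 'v and l :: real
  assumes unitary: "unitary_sl2_rep R"
    and v_in: "v \<in> rspace R" and v_norm: "rip R v v = 1"
    and v_weight: "r0 R v = rscale R (of_real l) v" and v_lowest: "rminus R v = 0"
    and l_pos: "0 < l"
    and generates: "\<And>W. module.subspace (rscale R) W \<Longrightarrow> v \<in> W \<Longrightarrow>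
      invariant {r0 R, rplus R, rminus R} W \<Longrightarrow> rspace R \<subseteq> W"
begin

abbreviation sc where "sc \<equiv> rscale R"
abbreviation V where "V \<equiv> rspace R"
abbreviation ip where "ip \<equiv> rip R"

sublocale vector_space sc using unitary unfolding unitary_sl2_rep_def by blast

lemma sub: "subspace V" using unitary unfolding unitary_sl2_rep_def by blast

lemma inner: "inner_product_on sc V ip" using unitary unfolding unitary_sl2_rep_def by blast

lemmas ip_add = inner[unfolded inner_product_on_def, THEN conjunct1, rule_format]
  and ip_scale = inner[unfolded inner_product_on_def, THEN conjunct2, THEN conjunct1, rule_format]
  and ip_cnj = inner[unfolded inner_product_on_def, THEN conjunct2, THEN conjunct2, THEN conjunct1, rule_format]

lemma op_linear:
  assumes "A \<in> {r0 R, rplus R, rminus R}"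
  shows "x \<in> V \<Longrightarrow> A x \<in> V" "x \<in> V \<Longrightarrow> y \<in> V \<Longrightarrow> A (x + y) = A x + A y"
    "x \<in> V \<Longrightarrow> A (sc a x) = sc a (A x)"
proof -
  have "linear_from_to sc sc V V A" using unitary assms unfolding unitary_sl2_rep_def by blast
  note lin = this[unfolded linear_from_to_def]
  show "x \<in> V \<Longrightarrow> A x \<in> V" using lin by blast
  show "x \<in> V \<Longrightarrow> y \<in> V \<Longrightarrow> A (x + y) = A x + A y"
    by (rule lin[THEN conjunct2, THEN conjunct1, rule_format])
  show "x \<in> V \<Longrightarrow> A (sc a x) = sc a (A x)"
    by (rule lin[THEN conjunct2, THEN conjunct2, rule_format])
qed

lemmas r0_linear = op_linear[of "r0 R", simplified]
lemmas rplus_linear = op_linear[of "rplus R", simplified]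
lemmas rminus_linear = op_linear[of "rminus R", simplified]

lemma comm_0p: "x \<in> V \<Longrightarrow> r0 R (rplus R x) = rplus R (r0 R x) + rplus R x"
  and comm_pm: "x \<in> V \<Longrightarrow> rminus R (rplus R x) = rplus R (rminus R x) - sc 2 (r0 R x)"
  using unitary unfolding unitary_sl2_rep_def comm_def by (auto simp: algebra_simps diff_eq_eq)

lemma adjoints:
  assumes "x \<in> V" "y \<in> V"
  shows rplus_adj: "ip (rplus R x) y = - ip x (rminus R y)" and r0_adj: "ip (r0 R x) y = ip x (r0 R y)"
proof -
  have "\<forall>x\<in>V. \<forall>y\<in>V. ip (rplus R x) y = - ip x (rminus R y) \<and> ip (r0 R x) y = ip x (r0 R y)"
    using unitary unfolding unitary_sl2_rep_def by (elim conjE)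
  from bspec[OF bspec[OF this assms(1)] assms(2)]
  show "ip (rplus R x) y = - ip x (rminus R y)" "ip (r0 R x) y = ip x (r0 R y)" by (rule conjunct1, rule conjunct2)
qed

definition e where "e n = (rplus R ^^ n) v"
text \<open>The sum of 2 (l + j) over j < k, collected from [L+, L-] = 2 L0 as the lowering operator
  passes k raising operators.\<close>

definition \<gamma> :: "nat \<Rightarrow> real" where "\<gamma> k = real k * (2 * l + real k - 1)"
text \<open>The squared norm of \<open>e n\<close>: n! times the rising factorial of 2l of length
  n.\<close>

definition G :: "nat \<Rightarrow> real" where "G n = (\<Prod>k<n. \<gamma> (Suc k))"

lemma e_0: "e 0 = v" and e_Suc: "e (Suc n) = rplus R (e n)" by (simp_all add: e_def)

lemma e_in [simp]: "e n \<in> V"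
  by (induction n) (simp_all add: e_0 e_Suc v_in rplus_linear)

lemma r0_e: "r0 R (e n) = sc (of_real l + of_nat n) (e n)"
proof (induction n)
  case (Suc n)
  have "r0 R (e (Suc n)) = sc (of_real l + of_nat n) (e (Suc n)) + sc 1 (e (Suc n))"
    unfolding e_Suc comm_0p[OF e_in] Suc rplus_linear(3)[OF e_in] scale_one ..
  also have "\<dots> = sc (of_real l + of_nat (Suc n)) (e (Suc n))"
    unfolding scale_left_distrib[symmetric] by (simp add: add_ac)
  finally show ?case .
qed (simp add: e_0 v_weight)

lemma rminus_e_0: "rminus R (e 0) = 0" by (simp add: e_0 v_lowest)

lemma rminus_e_Suc: "rminus R (e (Suc n)) = sc (- of_real (\<gamma> (Suc n))) (e n)"
proof (induction n)
  case 0
  have "rminus R (e (Suc 0)) = rplus R (rminus R v) - sc 2 (r0 R v)" by (simp add: e_Suc e_0 comm_pm v_in)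
  moreover have "rplus R 0 = 0" using rplus_linear(3)[OF v_in, of 0] by simp
  ultimately show ?case by (simp add: v_lowest v_weight e_0 \<gamma>_def)
next
  case (Suc n)
  have "rminus R (e (Suc (Suc n))) = rplus R (rminus R (e (Suc n))) - sc 2 (r0 R (e (Suc n)))"
    by (subst e_Suc) (simp add: comm_pm)
  also have "\<dots> = sc (- of_real (\<gamma> (Suc n))) (e (Suc n)) - sc (2 * (of_real l + of_nat (Suc n))) (e (Suc n))"
    unfolding Suc rplus_linear(3)[OF e_in] r0_e e_Suc[symmetric] by (simp only: scale_scale)
  also have "\<dots> = sc (- of_real (\<gamma> (Suc n)) - 2 * (of_real l + of_nat (Suc n))) (e (Suc n))"
    by (simp only: scale_left_diff_distrib)
  also have "- of_real (\<gamma> (Suc n)) - 2 * (of_real l + of_nat (Suc n)) = - complex_of_real (\<gamma> (Suc (Suc n)))"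
    by (simp add: \<gamma>_def algebra_simps)
  finally show ?case .
qed

lemma \<gamma>_pos: "0 < \<gamma> (Suc n)"
  using l_pos unfolding \<gamma>_def by (intro mult_pos_pos) auto

lemma G_pos: "0 < G n" unfolding G_def by (intro prod_pos) (simp add: \<gamma>_pos)

lemma G_Suc: "G (Suc n) = \<gamma> (Suc n) * G n" by (simp add: G_def)

lemma ip_scale_left: "x \<in> V \<Longrightarrow> y \<in> V \<Longrightarrow> ip (sc a x) y = cnj a * ip x y"
  using ip_cnj[of y "sc a x"] ip_cnj[of y x] ip_scale[of y x a] subspace_scale[OF sub] by simp

lemma e_norm: "ip (e n) (e n) = of_real (G n)"
proof (induction n)
  case (Suc n)
  have "ip (e (Suc n)) (e (Suc n)) = - ip (e n) (rminus R (e (Suc n)))"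
    by (subst e_Suc) (simp add: rplus_adj)
  then show ?case unfolding rminus_e_Suc ip_scale[OF e_in e_in] Suc G_Suc by simp
qed (simp add: e_0 v_norm G_def)

lemma e_orth: "m \<noteq> n \<Longrightarrow> ip (e m) (e n) = 0"
proof -
  assume mn: "m \<noteq> n"
  have "ip (r0 R (e m)) (e n) = ip (e m) (r0 R (e n))" by (simp add: r0_adj)
  then have "(of_real l + of_nat m) * ip (e m) (e n) = (of_real l + of_nat n) * ip (e m) (e n)"
    unfolding r0_e by (simp add: ip_scale ip_scale_left)
  then show ?thesis using mn by simp
qed

text \<open>Coordinates read off with the inner product. They are linear on \<open>V\<close>, and
  those of an image under an operator follow by moving the operator to \<open>e k\<close>.\<close>

definition coef where "coef k x = ip (e k) x / of_real (G k)"

lemma coef_e: "coef k (e n) = (if k = n then 1 else 0)"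
  using G_pos[of n] by (simp add: coef_def e_norm e_orth)

lemma coef_add: "x \<in> V \<Longrightarrow> y \<in> V \<Longrightarrow> coef k (x + y) = coef k x + coef k y"
  by (simp add: coef_def ip_add add_divide_distrib)

lemma coef_scale: "x \<in> V \<Longrightarrow> coef k (sc a x) = a * coef k x"
  by (simp add: coef_def ip_scale)

lemma coef_0: "coef k 0 = 0"
  using coef_scale[of "e 0" k 0] by simp

lemma sum_in: "(\<Sum>k\<in>S. sc (a k) (e k)) \<in> V"
  by (intro subspace_sum[OF sub] subspace_scale[OF sub]) simp

lemma coef_sum:
  assumes "finite S" shows "coef k (\<Sum>j\<in>S. sc (a j) (e j)) = (if k \<in> S then a k else 0)"
  using assms
proof (induction S)
  case (insert j S)
  then show ?case
    by (simp add: coef_add sum_in coef_scale coef_e subspace_scale[OF sub])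
qed (simp add: coef_0)

lemma V_span: "V = span (range e)"
proof
  have inv: "A x \<in> span (range e)" if A: "A \<in> {r0 R, rplus R, rminus R}" "\<And>n. A (e n) \<in> span (range e)"
    and x: "x \<in> span (range e)" for A x
  proof -
    have "x \<in> V \<and> A x \<in> span (range e)"
      using x
    proof (rule span_induct)
      show "subspace {x. x \<in> V \<and> A x \<in> span (range e)}"
      proof (rule subspaceI)
        have "A 0 = 0" using op_linear(3)[OF A(1), of "e 0" 0] by simp
        then show "0 \<in> {x. x \<in> V \<and> A x \<in> span (range e)}"
          using subspace_0[OF sub] span_zero by simp
      qed (use op_linear[OF A(1)] subspace_add[OF sub] subspace_scale[OF sub] span_add span_scale in auto)
    qed (use A in auto)
    then show ?thesis by blast
  qed
  have e: "e n \<in> span (range e)" for n by (simp add: span_base)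
  show "V \<subseteq> span (range e)"
  proof (rule generates)
    show "v \<in> span (range e)" using e[of 0] by (simp add: e_0)
    have "r0 R (e n) \<in> span (range e)" for n by (simp add: r0_e span_scale e)
    moreover have "rplus R (e n) \<in> span (range e)" for n using e[of "Suc n"] by (simp add: e_Suc)
    moreover have "rminus R (e n) \<in> span (range e)" for n
      by (cases n) (simp_all only: rminus_e_0 rminus_e_Suc span_scale[OF e] span_zero)
    ultimately show "invariant {r0 R, rplus R, rminus R} (span (range e))"
      unfolding invariant_def using inv by blast
  qed (rule subspace_span)
  show "span (range e) \<subseteq> V" by (rule span_minimal[OF _ sub]) auto
qed

text \<open>Valid for all larger ranges, so that several vectors can be expanded over a common
  one.\<close>

lemma expansion:
  assumes "x \<in> V" shows "\<exists>n. \<forall>m\<ge>n. x = (\<Sum>k<m. sc (coef k x) (e k))"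
proof -
  let ?W = "{x. x \<in> V \<and> (\<exists>n. \<forall>m\<ge>n. x = (\<Sum>k<m. sc (coef k x) (e k)))}"
  have "x \<in> V \<and> (\<exists>n. \<forall>m\<ge>n. x = (\<Sum>k<m. sc (coef k x) (e k)))"
    using assms[unfolded V_span]
  proof (rule span_induct)
    show "subspace ?W"
    proof (rule subspaceI)
      show "0 \<in> ?W"
        using subspace_0[OF sub] by (simp add: coef_0)
    next
      fix x y assume "x \<in> ?W"
        "y \<in> ?W"
      then obtain n n' where xy: "x \<in> V" "y \<in> V"
        "\<And>m. m \<ge> n \<Longrightarrow> x = (\<Sum>k<m. sc (coef k x) (e k))" "\<And>m. m \<ge> n' \<Longrightarrow> y = (\<Sum>k<m. sc (coef k y) (e k))" by blast
      have "x + y = (\<Sum>k<m. sc (coef k (x + y)) (e k))" if "m \<ge> max n n'" for m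
      proof -
        have "(\<Sum>k<m. sc (coef k (x + y)) (e k)) = (\<Sum>k<m. sc (coef k x) (e k)) + (\<Sum>k<m. sc (coef k y) (e k))"
          by (simp add: coef_add xy(1,2) scale_left_distrib sum.distrib)
        also have "\<dots> = x + y" using xy(3)[of m] xy(4)[of m] that by (metis max.bounded_iff)
        finally show ?thesis ..
      qed
      then show "x + y \<in> ?W"
        using subspace_add[OF sub xy(1,2)] by blast
    next
      fix a x assume "x \<in> ?W"
      then obtain n where x: "x \<in> V" "\<And>m. m \<ge> n \<Longrightarrow> x = (\<Sum>k<m. sc (coef k x) (e k))" by blast
      have "sc a x = (\<Sum>k<m. sc (coef k (sc a x)) (e k))" if "m \<ge> n" for m
      proof -
        have "(\<Sum>k<m. sc (coef k (sc a x)) (e k)) = sc a (\<Sum>k<m. sc (coef k x) (e k))"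
          by (simp add: coef_scale x(1) scale_sum_right)
        also have "\<dots> = sc a x" by (simp only: x(2)[OF that, symmetric])
        finally show ?thesis ..
      qed
      then show "sc a x \<in> ?W"
        using subspace_scale[OF sub x(1)] by blast
    qed
    fix x assume "x \<in> range e"
    then obtain n where n: "x = e n" by blast
    have "e n = (\<Sum>k<m. sc (coef k (e n)) (e k))" if "m \<ge> Suc n" for m
    proof -
      have "(\<Sum>k<m. sc (coef k (e n)) (e k)) = (\<Sum>k<m. if k = n then e n else 0)"
        by (intro sum.cong) (auto simp: coef_e)
      then show ?thesis using that by simp
    qed
    then show "x \<in> V \<and> (\<exists>n. \<forall>m\<ge>n. x = (\<Sum>k<m. sc (coef k x) (e k)))" unfolding n by (intro conjI) (simp, blast)
  qed
  then show ?thesis by blast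
qed

lemma coef_eqI:
  assumes "x \<in> V" "y \<in> V" "\<And>k. coef k x = coef k y" shows "x = y"
proof -
  obtain n n' where "\<forall>m\<ge>n. x = (\<Sum>k<m. sc (coef k x) (e k))" "\<forall>m\<ge>n'. y = (\<Sum>k<m. sc (coef k y) (e k))"
    using expansion assms(1,2) by blast
  then have "x = (\<Sum>k<max n n'. sc (coef k x) (e k))" "y = (\<Sum>k<max n n'. sc (coef k y) (e k))" by simp_all
  then show ?thesis using assms(3) by simp
qed

lemma coef_r0: "x \<in> V \<Longrightarrow> coef k (r0 R x) = (of_real l + of_nat k) * coef k x"
  using r0_adj[of "e k" x] by (simp add: coef_def r0_e ip_scale_left)

lemma rminus_adj: "x \<in> V \<Longrightarrow> y \<in> V \<Longrightarrow> ip (rminus R x) y = - ip x (rplus R y)"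
proof -
  assume x: "x \<in> V" and y: "y \<in> V"
  have "ip (rminus R x) y = cnj (ip y (rminus R x))" by (rule ip_cnj[OF y rminus_linear(1)[OF x]])
  also have "ip y (rminus R x) = - ip (rplus R y) x" using rplus_adj[OF y x] by simp
  also have "cnj (- ip (rplus R y) x) = - ip x (rplus R y)"
    using ip_cnj[OF rplus_linear(1)[OF y] x] by simp
  finally show ?thesis .
qed

lemma coef_rplus_0: "x \<in> V \<Longrightarrow> coef 0 (rplus R x) = 0"
proof -
  assume x: "x \<in> V"
  have "ip 0 x = 0" using ip_scale_left[of "e 0" x 0] x by simp
  then show ?thesis using rminus_adj[of "e 0" x] x by (simp add: coef_def rminus_e_0)
qed

lemma coef_rplus_Suc: "x \<in> V \<Longrightarrow> coef (Suc k) (rplus R x) = coef k x"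
proof -
  assume x: "x \<in> V"
  have "ip (e (Suc k)) (rplus R x) = of_real (\<gamma> (Suc k)) * ip (e k) x"
    using rminus_adj[OF e_in x, of "Suc k"] unfolding rminus_e_Suc ip_scale_left[OF e_in x] by simp
  then show ?thesis using \<gamma>_pos[of k] by (simp add: coef_def G_Suc)
qed

lemma coef_rminus: "x \<in> V \<Longrightarrow> coef k (rminus R x) = - of_real (\<gamma> (Suc k)) * coef (Suc k) x"
  using rplus_adj[of "e k" x] \<gamma>_pos[of k] G_pos[of k]
  by (simp add: coef_def e_Suc[symmetric] G_Suc)

lemma ip_expansion:
  assumes x: "x \<in> V" and y: "y = (\<Sum>k<m. sc (b k) (e k))"
  shows "ip x y = (\<Sum>k<m. b k * of_real (G k) * cnj (coef k x))"
  unfolding y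
proof (induction m)
  case 0
  show ?case using ip_scale[OF x e_in, of 0 0] by simp
next
  case (Suc m)
  have "ip x (sc (b m) (e m)) = b m * of_real (G m) * cnj (coef m x)"
    using ip_cnj[of "e m" x] x G_pos[of m] by (simp add: ip_scale coef_def)
  then show ?case using Suc by (simp add: ip_add x sum_in subspace_scale[OF sub])
qed

lemma v_nonzero: "v \<noteq> 0"
  using v_norm ip_scale[OF v_in v_in, of 0] by auto

lemma e_nonzero: "e n \<noteq> 0"
  using coef_e[of n n] coef_0[of n] by auto

section \<open>Irreducibility and weights\<close>

lemma irreducible: "irreducible_rep R"
  unfolding irreducible_rep_def
proof (intro conjI allI impI)
  show "V \<noteq> {0}" using v_in v_nonzero by blast
  fix W assume W: "subspace W \<and> W \<subseteq> V \<and> invariant {r0 R, rplus R, rminus R} W"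
  then have sW: "subspace W" and WV: "W \<subseteq> V" and iW: "invariant {r0 R, rplus R, rminus R} W" by auto
  \<comment> \<open>Each lowering shortens the support of x by one. Once lowering gives 0,
    positivity of \<open>\<gamma>\<close> removes every coordinate except the one at index 0, so x
    is a multiple of v.\<close>
  have key: "v \<in> W" if "x \<in> W" "x \<noteq> 0" "\<And>k. k \<ge> n \<Longrightarrow> coef k x = 0" for n x
    using that
  proof (induction n arbitrary: x)
    case 0
    then have "x = 0" using coef_eqI[of x 0] WV subspace_0[OF sub] by (auto simp: coef_0)
    then show ?case using 0 by simp
  next
    case (Suc n)
    have xV: "x \<in> V" using Suc.prems WV by blast
    have Lx: "rminus R x \<in> W" using iW Suc.prems(1) unfolding invariant_def by blast
    show ?case
    proof (cases "rminus R x = 0")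
      case False
      show ?thesis
        by (rule Suc.IH[OF Lx False]) (simp add: coef_rminus[OF xV] Suc.prems(3))
    next
      case True
      have "coef (Suc k) x = 0" for k
        using coef_rminus[OF xV, of k] \<gamma>_pos[of k] unfolding True coef_0 by simp
      then have "coef k x = coef k (sc (coef 0 x) v)" for k
        using coef_e[of k 0] unfolding e_0 coef_scale[OF v_in] by (cases k) simp_all
      then have "x = sc (coef 0 x) v"
        by (intro coef_eqI xV subspace_scale[OF sub v_in])
      then obtain a where a: "x = sc a v" by blast
      then have "a \<noteq> 0" using Suc.prems(2) by auto
      then have "v = sc (1 / a) x" unfolding a by simp
      then show ?thesis using subspace_scale[OF sW Suc.prems(1), of "1 / a"] by (simp only:)
    qed
  qed
  show "W = {0} \<or> W = V"
  proof (cases "W = {0}")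
    case False
    then obtain x where x: "x \<in> W" "x \<noteq> 0" using subspace_0[OF sW] by blast
    obtain n where n: "\<forall>m\<ge>n. x = (\<Sum>k<m. sc (coef k x) (e k))" using expansion x WV by blast
    have "coef k x = 0" if "k \<ge> n" for k
    proof -
      have "x = (\<Sum>j<n. sc (coef j x) (e j))" using n by blast
      then have "coef k x = coef k (\<Sum>j<n. sc (coef j x) (e j))" by (rule arg_cong)
      also have "\<dots> = 0" using that by (simp add: coef_sum)
      finally show ?thesis .
    qed
    then have "v \<in> W" using key[OF x] by blast
    then show ?thesis using generates[OF sW _ iW] WV by blast
  qed simp
qed

lemma weight_space_eq: "weight_space R (of_real l + of_nat n) = span {e n}"
proof
  show "span {e n} \<subseteq> weight_space R (of_real l + of_nat n)"
  proof
    fix x assume "x \<in> span {e n}"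
    then obtain a where "x = sc a (e n)" unfolding span_singleton by blast
    then show "x \<in> weight_space R (of_real l + of_nat n)"
      unfolding weight_space_def by (simp add: subspace_scale[OF sub] r0_linear r0_e mult.commute)
  qed
  show "weight_space R (of_real l + of_nat n) \<subseteq> span {e n}"
  proof
    fix x assume "x \<in> weight_space R (of_real l + of_nat n)"
    then have x: "x \<in> V" "r0 R x = sc (of_real l + of_nat n) x" unfolding weight_space_def by auto
    have "coef k x = coef k (sc (coef n x) (e n))" for k
      using coef_r0[OF x(1), of k] unfolding x(2) by (auto simp: coef_scale x(1) coef_e)
    then have "x = sc (coef n x) (e n)" by (intro coef_eqI x(1) subspace_scale[OF sub e_in])
    then show "x \<in> span {e n}" unfolding span_singleton by blast
  qed
qed

lemma discrete_series: "discrete_series_plus l R"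
  unfolding discrete_series_plus_def
proof (intro conjI l_pos unitary irreducible allI ballI)
  show "{\<mu>. \<exists>x\<in>weight_space R \<mu>. x \<noteq> 0} = {of_real l + of_nat n | n. True}" (is "?A = ?B")
  proof
    show "?B \<subseteq> ?A" using weight_space_eq e_nonzero span_base by blast
    show "?A \<subseteq> ?B"
    proof
      fix \<mu> assume "\<mu> \<in> ?A"
      then obtain x where x: "x \<in> V" "r0 R x = sc \<mu> x" "x \<noteq> 0" unfolding weight_space_def by blast
      obtain k where k: "coef k x \<noteq> 0"
        using coef_eqI[OF x(1) subspace_0[OF sub]] x(3) coef_0 by metis
      have "\<mu> = of_real l + of_nat k"
        using coef_r0[OF x(1), of k] k unfolding x(2) by (simp add: coef_scale x(1))
      then show "\<mu> \<in> ?B" by blast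
    qed
  qed
  fix n show "dim (weight_space R (of_real l + of_nat n)) = 1"
    unfolding weight_space_eq dim_span
    using dim_eq_card_independent[of "{e n}"] e_nonzero[of n] by simp
next
  fix x assume "x \<in> weight_space R (of_real l)"
  then obtain a where "x = sc a (e 0)" using weight_space_eq[of 0] unfolding span_singleton by auto
  then show "rminus R x = 0" by (simp add: rminus_linear rminus_e_0)
qed

end

section \<open>Uniqueness for a given lowest weight\<close>

text \<open>Vectors with equal coordinates are matched; in coordinates the three operators and the
  inner product are given by formulas in l alone.\<close>

lemma lowest_weight_isomorphic:
  assumes "lowest_weight R v l" "lowest_weight R' v' l"
  shows "isomorphic_reps R R'"
proof -
  interpret A: lowest_weight R v l by fact
  interpret B: lowest_weight R' v' l by fact
  have ex: "\<exists>y. y \<in> rspace R' \<and> (\<forall>k. B.coef k y = A.coef k x)" if x: "x \<in> rspace R" for x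
  proof -
    obtain n where n: "\<forall>m\<ge>n. x = (\<Sum>k<m. A.sc (A.coef k x) (A.e k))" using A.expansion[OF x] by blast
    then have "x = (\<Sum>k<n. A.sc (A.coef k x) (A.e k))" by blast
    then have eq: "A.coef k x = A.coef k (\<Sum>k<n. A.sc (A.coef k x) (A.e k))" for k by (rule arg_cong)
    have z: "A.coef k x = 0" if "\<not> k < n" for k
      using that by (subst eq) (simp add: A.coef_sum)
    show ?thesis
      by (intro exI[of _ "\<Sum>k<n. B.sc (A.coef k x) (B.e k)"]) (simp add: B.sum_in B.coef_sum z)
  qed
  have ex': "\<exists>x. x \<in> rspace R \<and> (\<forall>k. A.coef k x = B.coef k y)" if y: "y \<in> rspace R'" for y
  proof -
    obtain n where n: "\<forall>m\<ge>n. y = (\<Sum>k<m. B.sc (B.coef k y) (B.e k))" using B.expansion[OF y] by blast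
    then have "y = (\<Sum>k<n. B.sc (B.coef k y) (B.e k))" by blast
    then have eq: "B.coef k y = B.coef k (\<Sum>k<n. B.sc (B.coef k y) (B.e k))" for k by (rule arg_cong)
    have z: "B.coef k y = 0" if "\<not> k < n" for k
      using that by (subst eq) (simp add: B.coef_sum)
    show ?thesis
      by (intro exI[of _ "\<Sum>k<n. A.sc (B.coef k y) (A.e k)"]) (simp add: A.sum_in A.coef_sum z)
  qed
  define U where "U x = (SOME y. y \<in> rspace R' \<and> (\<forall>k. B.coef k y = A.coef k x))" for x
  have U: "U x \<in> rspace R'" "B.coef k (U x) = A.coef k x" if "x \<in> rspace R" for x k
    using someI_ex[OF ex[OF that]] unfolding U_def by blast+
  have UI: "U x = y" if "x \<in> rspace R" "y \<in> rspace R'" "\<And>k. B.coef k y = A.coef k x" for x y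
    by (rule B.coef_eqI) (use U that in auto)
  show ?thesis
    unfolding isomorphic_reps_def
  proof (intro exI[of _ U] conjI ballI)
    show "linear_from_to (rscale R) (rscale R') (rspace R) (rspace R') U"
      unfolding linear_from_to_def
    proof (intro conjI ballI allI)
      show "U ` rspace R \<subseteq> rspace R'" using U by blast
      fix x assume x: "x \<in> rspace R"
      show "U (x + y) = U x + U y" if y: "y \<in> rspace R" for y
        by (rule UI) (use x y U in \<open>auto simp: A.coef_add B.coef_add intro: A.subspace_add[OF A.sub] B.subspace_add[OF B.sub]\<close>)
      show "U (rscale R a x) = rscale R' a (U x)" for a
        by (rule UI) (use x U in \<open>auto simp: A.coef_scale B.coef_scale intro: A.subspace_scale[OF A.sub] B.subspace_scale[OF B.sub]\<close>)
    qed
    show "bij_betw U (rspace R) (rspace R')"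
      unfolding bij_betw_def
    proof
      show "inj_on U (rspace R)"
      proof (rule inj_onI)
        fix x y assume xy: "x \<in> rspace R" "y \<in> rspace R" "U x = U y"
        show "x = y"
          by (rule A.coef_eqI[OF xy(1,2)]) (use U(2)[OF xy(1)] U(2)[OF xy(2)] xy(3) in metis)
      qed
      show "U ` rspace R = rspace R'"
      proof
        show "rspace R' \<subseteq> U ` rspace R"
        proof
          fix y assume y: "y \<in> rspace R'"
          obtain x where x: "x \<in> rspace R" "\<forall>k. A.coef k x = B.coef k y" using ex'[OF y] by blast
          have "U x = y" by (rule UI[OF x(1) y]) (simp add: x(2))
          then show "y \<in> U ` rspace R" using x(1) by blast
        qed
      qed (use U in blast)
    qed
    fix x assume x: "x \<in> rspace R"
    show "U (r0 R x) = r0 R' (U x)"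
      by (rule UI) (use x U in \<open>auto simp: A.coef_r0 B.coef_r0 intro: A.r0_linear(1) B.r0_linear(1)\<close>)
    show "U (rminus R x) = rminus R' (U x)"
      by (rule UI) (use x U in \<open>auto simp: A.coef_rminus B.coef_rminus intro: A.rminus_linear(1) B.rminus_linear(1)\<close>)
    show "U (rplus R x) = rplus R' (U x)"
    proof (rule UI)
      show "B.coef k (rplus R' (U x)) = A.coef k (rplus R x)" for k
        using x U by (cases k) (simp_all add: A.coef_rplus_0 B.coef_rplus_0 A.coef_rplus_Suc B.coef_rplus_Suc)
    qed (use x U in \<open>auto intro: A.rplus_linear(1) B.rplus_linear(1)\<close>)
  next
    fix x y assume x: "x \<in> rspace R" and y: "y \<in> rspace R"
    obtain n where n: "\<forall>m\<ge>n. y = (\<Sum>k<m. A.sc (A.coef k y) (A.e k))" using A.expansion[OF y] by blast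
    obtain n' where n': "\<forall>m\<ge>n'. U y = (\<Sum>k<m. B.sc (B.coef k (U y)) (B.e k))" using B.expansion[OF U(1)[OF y]] by blast
    define m where "m = max n n'"
    have "y = (\<Sum>k<m. A.sc (A.coef k y) (A.e k))" "U y = (\<Sum>k<m. B.sc (B.coef k (U y)) (B.e k))"
      using n n' by (simp_all add: m_def)
    from A.ip_expansion[OF x this(1)] B.ip_expansion[OF U(1)[OF x] this(2)]
    show "rip R' (U x) (U y) = rip R x y" using U x y by simp
  qed
qed

text \<open>A weight vector at l is normalized, and irreducibility makes it a generator.\<close>

lemma discrete_series_lowest_weight:
  assumes D: "discrete_series_plus l D"
  obtains v where "lowest_weight D v l"
proof -
  have u: "unitary_sl2_rep D" and irr: "irreducible_rep D" and l: "0 < l"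
    and low: "\<And>x. x \<in> weight_space D (of_real l) \<Longrightarrow> rminus D x = 0"
    and wt: "{\<mu>. \<exists>x\<in>weight_space D \<mu>. x \<noteq> 0} = {of_real l + of_nat n | n :: nat. True}"
    using D unfolding discrete_series_plus_def by auto
  interpret vector_space "rscale D" using u unfolding unitary_sl2_rep_def by blast
  have sub: "subspace (rspace D)" and ip: "inner_product_on (rscale D) (rspace D) (rip D)"
    and lin: "\<And>A. A \<in> {r0 D, rplus D, rminus D} \<Longrightarrow> linear_from_to (rscale D) (rscale D) (rspace D) (rspace D) A"
    using u unfolding unitary_sl2_rep_def by blast+
  have "of_real l + of_nat 0 \<in> {\<mu>. \<exists>x\<in>weight_space D \<mu>. x \<noteq> 0}" unfolding wt by blast
  then have "\<exists>x\<in>weight_space D (of_real l). x \<noteq> 0" by simp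
  then obtain x where x: "x \<in> weight_space D (of_real l)" "x \<noteq> 0" by blast
  then have xV: "x \<in> rspace D" and x0: "r0 D x = rscale D (of_real l) x" unfolding weight_space_def by auto
  define q where "q = sqrt (Re (rip D x x))"
  have pos: "0 < Re (rip D x x)" using ip xV x(2) unfolding inner_product_on_def by blast
  then have q: "0 < q" "q * q = Re (rip D x x)" by (simp_all add: q_def)
  have "rip D x x = cnj (rip D x x)" using ip xV unfolding inner_product_on_def by blast
  from arg_cong[OF this, of Im] have "Im (rip D x x) = 0" by simp
  then have xx: "rip D x x = of_real (q * q)" unfolding q(2) by (simp add: complex_eq_iff)
  define v where "v = rscale D (of_real (1 / q)) x"
  have vV: "v \<in> rspace D" unfolding v_def by (rule subspace_scale[OF sub xV])
  have v0: "v \<noteq> 0" using q(1) x(2) by (simp add: v_def)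
  note ip_scale = ip[unfolded inner_product_on_def, THEN conjunct2, THEN conjunct1, rule_format]
  note ip_cnj = ip[unfolded inner_product_on_def, THEN conjunct2, THEN conjunct2, THEN conjunct1, rule_format]
  have "rip D v (rscale D (of_real (1 / q)) x) = of_real (1 / q) * rip D v x" by (rule ip_scale[OF vV xV])
  then have "rip D v v = of_real (1 / q) * rip D v x" unfolding v_def[symmetric] .
  also have "rip D v x = cnj (rip D x v)" by (rule ip_cnj[OF xV vV])
  also have "rip D x v = of_real (1 / q) * rip D x x" unfolding v_def by (rule ip_scale[OF xV xV])
  finally have vv: "rip D v v = 1" unfolding xx using q(1) by simp
  have lin': "linear_from_to (rscale D) (rscale D) (rspace D) (rspace D) (r0 D)" using lin by blast
  have "r0 D v = rscale D (of_real (1 / q)) (r0 D x)"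
    unfolding v_def by (rule lin'[unfolded linear_from_to_def, THEN conjunct2, THEN conjunct2, rule_format, OF xV])
  then have rv: "r0 D v = rscale D (of_real l) v" by (simp add: x0 v_def mult.commute)
  have "lowest_weight D v l"
  proof
    show "rminus D v = 0" by (rule low) (simp add: weight_space_def vV rv)
    fix W assume W: "subspace W" "v \<in> W" "invariant {r0 D, rplus D, rminus D} W"
    \<comment> \<open>Irreducibility speaks of subspaces of the representation space, hence the
      intersection.\<close>
    have "invariant {r0 D, rplus D, rminus D} (W \<inter> rspace D)"
      unfolding invariant_def
    proof
      fix A assume A: "A \<in> {r0 D, rplus D, rminus D}"
      have "A ` W \<subseteq> W" using W(3) A unfolding invariant_def by (rule bspec)
      moreover have "A ` rspace D \<subseteq> rspace D" using lin[OF A] unfolding linear_from_to_def by (rule conjunct1)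
      ultimately show "A ` (W \<inter> rspace D) \<subseteq> W \<inter> rspace D" by blast
    qed
    moreover have "subspace (W \<inter> rspace D)" by (rule subspace_inter[OF W(1) sub])
    ultimately have "W \<inter> rspace D = {0} \<or> W \<inter> rspace D = rspace D"
      using irr unfolding irreducible_rep_def by blast
    then show "rspace D \<subseteq> W" using W(2) vV v0 by blast
  qed (use u vV vv rv l in auto)
  then show ?thesis by (rule that)
qed

section \<open>Charges on Fock space\<close>

text \<open>The modes \<open>c n\<close>, \<open>n \<in> \<int>\<close>, and their adjoints \<open>d n\<close>, acting on a Fock space whose vacuum is the
  filled Dirac sea: positive modes are empty and negative ones are occupied.\<close>

locale dirac_sea = vector_space sc
  for sc :: "complex \<Rightarrow> 'v \<Rightarrow> 'v::ab_group_add" +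
  fixes ip :: "'v \<Rightarrow> 'v \<Rightarrow> complex" and c d :: "int \<Rightarrow> 'v \<Rightarrow> 'v" and vac :: 'v
  assumes ip: "inner_product_on sc UNIV ip"
    and c_add: "c n (x + y) = c n x + c n y" and c_scale: "c n (sc a x) = sc a (c n x)"
    and d_add: "d n (x + y) = d n x + d n y" and d_scale: "d n (sc a x) = sc a (d n x)"
    and car: "c m (d n x) = (if m = n then x else 0) - d n (c m x)"
    and cc: "c m (c n x) = - c n (c m x)" and dd: "d m (d n x) = - d n (d m x)"
    and adj: "ip (d n x) y = ip x (c n y)"
    and vac_norm: "ip vac vac = 1"
    and c_vac: "0 \<le> n \<Longrightarrow> c n vac = 0" and d_vac: "n < 0 \<Longrightarrow> d n vac = 0"
    and generated: "subspace W \<Longrightarrow> vac \<in> W \<Longrightarrow> (\<And>n x. x \<in> W \<Longrightarrow> c n x \<in> W) \<Longrightarrow>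
      (\<And>n x. x \<in> W \<Longrightarrow> d n x \<in> W) \<Longrightarrow> W = UNIV"
begin

lemma ip_add: "ip x (y + z) = ip x y + ip x z"
  by (rule ip[unfolded inner_product_on_def, THEN conjunct1, rule_format]) simp_all

lemma ip_scale: "ip x (sc a y) = a * ip x y"
  by (rule ip[unfolded inner_product_on_def, THEN conjunct2, THEN conjunct1, rule_format]) simp_all

lemma ip_cnj: "ip y x = cnj (ip x y)"
  by (rule ip[unfolded inner_product_on_def, THEN conjunct2, THEN conjunct2, THEN conjunct1, rule_format]) simp_all

lemma ip_add_left: "ip (x + y) z = ip x z + ip y z"
proof -
  have "ip (x + y) z = cnj (ip z (x + y))" by (rule ip_cnj)
  then show ?thesis by (simp add: ip_add ip_cnj[symmetric])
qed

lemma ip_scale_left: "ip (sc a x) y = cnj a * ip x y"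
proof -
  have "ip (sc a x) y = cnj (ip y (sc a x))" by (rule ip_cnj)
  then show ?thesis by (simp add: ip_scale ip_cnj[symmetric])
qed

lemma ip_minus: "ip x (- y) = - ip x y"
  using ip_scale[of x "-1" y] by simp

lemma ip_0: "ip x 0 = 0" "ip 0 x = 0"
  using ip_scale[of x 0 0] ip_scale_left[of 0 0 x] by simp_all

lemma ip_sum: "ip x (\<Sum>k\<in>S. f k) = (\<Sum>k\<in>S. ip x (f k))" "ip (\<Sum>k\<in>S. f k) x = (\<Sum>k\<in>S. ip (f k) x)"
  by (induction S rule: infinite_finite_induct) (simp_all add: ip_0 ip_add ip_add_left)

section \<open>Linear operators on the sea and finiteness of the sums\<close>

definition linop :: "('v \<Rightarrow> 'v) \<Rightarrow> bool" where
  "linop A \<longleftrightarrow> (\<forall>x y. A (x + y) = A x + A y) \<and> (\<forall>a x. A (sc a x) = sc a (A x))"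

lemma linopI: "(\<And>x y. A (x + y) = A x + A y) \<Longrightarrow> (\<And>a x. A (sc a x) = sc a (A x)) \<Longrightarrow> linop A"
  by (simp add: linop_def)

lemma linop_add: "linop A \<Longrightarrow> A (x + y) = A x + A y" and linop_scale: "linop A \<Longrightarrow> A (sc a x) = sc a (A x)"
  by (simp_all add: linop_def)

lemma linop_0: "linop A \<Longrightarrow> A 0 = 0"
  using linop_scale[of A 0 0] by simp

lemma linop_minus: "linop A \<Longrightarrow> A (- x) = - A x"
  using linop_scale[of A "-1" x] by simp

lemma linop_diff: "linop A \<Longrightarrow> A (x - y) = A x - A y"
  using linop_add[of A x "- y"] linop_minus[of A y] by simp

lemma linop_sum: "linop A \<Longrightarrow> A (\<Sum>k\<in>S. f k) = (\<Sum>k\<in>S. A (f k))"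
  by (induction S rule: infinite_finite_induct) (simp_all add: linop_0 linop_add)

lemma linop_cd: "linop (c n)" "linop (d n)"
  by (simp_all add: linop_def c_add c_scale d_add d_scale)

lemmas cd_simps = linop_0[OF linop_cd(1)] linop_0[OF linop_cd(2)] linop_minus[OF linop_cd(1)]
  linop_minus[OF linop_cd(2)] linop_diff[OF linop_cd(1)] linop_diff[OF linop_cd(2)] c_add d_add c_scale d_scale

text \<open>The kernel of A is a subspace containing the vacuum and stable under all
  \<open>c n\<close> and \<open>d n\<close>, hence everything.\<close>

lemma linop_eq_0I:
  assumes A: "linop A" and "\<And>n x. A (c n x) = c n (A x)" "\<And>n x. A (d n x) = d n (A x)"
    and "A vac = 0"
  shows "A x = 0"
proof -
  have "{x. A x = 0} = UNIV"
  proof (rule generated)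
    show "subspace {x. A x = 0}"
      by (rule subspaceI) (simp_all add: linop_0[OF A] linop_add[OF A] linop_scale[OF A])
  qed (use assms(2-4) in \<open>simp_all add: cd_simps\<close>)
  then show ?thesis by blast
qed

text \<open>The vacuum has bound 1, and applying \<open>c k\<close> or \<open>d k\<close> raises a
  bound N at most to max N (|k| + 1), since modes other than k only contribute signs. On each vector
  this makes the infinite sums below finite.\<close>

lemma eventually_annihilated: "\<exists>N. \<forall>n\<ge>N. c n x = 0 \<and> d (- n) x = 0"
proof -
  let ?W = "{x. \<exists>N. \<forall>n\<ge>N. c n x = 0 \<and> d (- n) x = 0}"
  have "?W = UNIV"
  proof (rule generated)
    show "subspace ?W"
    proof (rule subspaceI)
      fix x y assume "x \<in> ?W" "y \<in> ?W"
      then obtain N N' where "\<forall>n\<ge>N. c n x = 0 \<and> d (- n) x = 0" "\<forall>n\<ge>N'. c n y = 0 \<and> d (- n) y = 0" by blast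
      then have "\<forall>n\<ge>max N N'. c n (x + y) = 0 \<and> d (- n) (x + y) = 0" by (simp add: c_add d_add)
      then show "x + y \<in> ?W" by blast
    next
      fix a x assume "x \<in> ?W"
      then obtain N where "\<forall>n\<ge>N. c n x = 0 \<and> d (- n) x = 0" by blast
      then have "\<forall>n\<ge>N. c n (sc a x) = 0 \<and> d (- n) (sc a x) = 0" by (simp add: c_scale d_scale)
      then show "sc a x \<in> ?W" by blast
    qed (simp add: cd_simps)
    have "\<forall>n\<ge>1. c n vac = 0 \<and> d (- n) vac = 0" by (simp add: c_vac d_vac)
    then show "vac \<in> ?W" by blast
    fix k x assume "x \<in> ?W"
    then obtain N where N: "\<forall>n\<ge>N. c n x = 0 \<and> d (- n) x = 0" by blast
    have "c n (c k x) = 0 \<and> d (- n) (c k x) = 0" if "n \<ge> max N (\<bar>k\<bar> + 1)" for n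
    proof
      show "c n (c k x) = 0" using N that by (subst cc) (simp add: cd_simps)
      have "k \<noteq> - n" using that by auto
      then have "c k (d (- n) x) = - d (- n) (c k x)" by (subst car) simp
      then show "d (- n) (c k x) = 0" using N that by (simp add: cd_simps)
    qed
    then show "c k x \<in> ?W" by blast
    have "c n (d k x) = 0 \<and> d (- n) (d k x) = 0" if "n \<ge> max N (\<bar>k\<bar> + 1)" for n
    proof
      show "d (- n) (d k x) = 0" using N that by (subst dd) (simp add: cd_simps)
      have "n \<noteq> k" using that by auto
      then show "c n (d k x) = 0" using N that by (subst car) (simp add: cd_simps)
    qed
    then show "d k x \<in> ?W" by blast
  qed
  then show ?thesis by blast
qed

section \<open>Bilinear charges\<close>

text \<open>Second quantization of the one-particle operator that sends mode n to \<open>a n\<close>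
  times mode n + j.\<close>

definition bilin :: "(int \<Rightarrow> complex) \<Rightarrow> int \<Rightarrow> 'v \<Rightarrow> 'v" where
  "bilin a j x = Sum_any (\<lambda>n. sc (a n) (d (n + j) (c n x)))"

text \<open>For large n the factor c kills x; for large -n the factor d does, after an exchange that
  costs only a sign when j \<noteq> 0. At j = 0 each filled level would leave a copy of x, the
  divergence of the unordered energy.\<close>

lemma bilin_finite: assumes "j \<noteq> 0" shows "finite {n. d (n + j) (c n x) \<noteq> 0}"
proof -
  obtain N where N: "\<forall>n\<ge>N. c n x = 0 \<and> d (- n) x = 0" using eventually_annihilated by blast
  have "d (n + j) (c n x) = 0" if "n \<notin> {- N - j..N}" for n
  proof (cases "n \<ge> N")
    case False
    then have "N \<le> - (n + j)" using that by auto
    then have "d (- (- (n + j))) x = 0" using N by blast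
    then have "d (n + j) x = 0" by (simp only: minus_minus)
    moreover have "c n (d (n + j) x) = - d (n + j) (c n x)" using assms by (subst car) simp
    ultimately show ?thesis by (simp add: cd_simps)
  qed (use N in \<open>simp add: cd_simps\<close>)
  then have "{n. d (n + j) (c n x) \<noteq> 0} \<subseteq> {- N - j..N}" by blast
  then show ?thesis by (rule finite_subset) simp
qed

lemma bilin_sum:
  assumes "finite S" "{n. d (n + j) (c n x) \<noteq> 0} \<subseteq> S"
  shows "bilin a j x = (\<Sum>n\<in>S. sc (a n) (d (n + j) (c n x)))"
proof -
  have "{n. sc (a n) (d (n + j) (c n x)) \<noteq> 0} \<subseteq> S" using assms(2) by auto
  then show ?thesis unfolding bilin_def by (rule Sum_any.expand_superset[OF assms(1)])
qed

lemma bilin_linop: assumes j: "j \<noteq> 0" shows "linop (bilin a j)"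
proof (rule linopI)
  fix x y b
  let ?S = "{n. d (n + j) (c n x) \<noteq> 0} \<union> {n. d (n + j) (c n y) \<noteq> 0} \<union> {n. d (n + j) (c n (x + y)) \<noteq> 0}
    \<union> {n. d (n + j) (c n (sc b x)) \<noteq> 0}"
  have S: "finite ?S" using bilin_finite[OF j] by simp
  have e: "bilin a j z = (\<Sum>n\<in>?S. sc (a n) (d (n + j) (c n z)))" if "z \<in> {x, y, x + y, sc b x}" for z
    by (rule bilin_sum[OF S]) (use that in auto)
  show "bilin a j (x + y) = bilin a j x + bilin a j y"
    using e by (simp add: cd_simps scale_right_distrib sum.distrib)
  show "bilin a j (sc b x) = sc b (bilin a j x)"
    using e by (simp add: cd_simps scale_sum_right mult.commute)
qed

lemma quad_d: "d m (c n (d k x)) = (if n = k then d m x else 0) + d k (d m (c n x))"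
proof -
  have "d m (d k (c n x)) = - d k (d m (c n x))" by (rule dd)
  then show ?thesis by (subst car) (simp add: cd_simps)
qed

lemma quad_c: "d m (c n (c k x)) = (if k = m then - c n x else 0) + c k (d m (c n x))"
proof -
  have "c k (d m (c n x)) = (if k = m then c n x else 0) - d m (c k (c n x))" by (rule car)
  moreover have "c n (c k x) = - c k (c n x)" by (rule cc)
  ultimately show ?thesis by (simp add: cd_simps)
qed

text \<open>Commuting with \<open>d k\<close> reproduces the one-particle operator on mode k; all
  other terms of the sum pass through \<open>d k\<close>.\<close>

lemma bilin_d:
  assumes j: "j \<noteq> 0" shows "bilin a j (d k x) = d k (bilin a j x) + sc (a k) (d (k + j) x)"
proof -
  let ?S = "{n. d (n + j) (c n x) \<noteq> 0} \<union> {n. d (n + j) (c n (d k x)) \<noteq> 0} \<union> {k}"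
  have S: "finite ?S" using bilin_finite[OF j] by simp
  have "bilin a j (d k x) = (\<Sum>n\<in>?S. sc (a n) (d (n + j) (c n (d k x))))" by (rule bilin_sum[OF S]) blast
  also have "\<dots> = (\<Sum>n\<in>?S. d k (sc (a n) (d (n + j) (c n x))) + (if n = k then sc (a k) (d (k + j) x) else 0))"
    by (intro sum.cong refl) (simp add: quad_d scale_right_distrib cd_simps add.commute)
  also have "\<dots> = d k (\<Sum>n\<in>?S. sc (a n) (d (n + j) (c n x))) + sc (a k) (d (k + j) x)"
    using S by (simp only: sum.distrib linop_sum[OF linop_cd(2)] sum.delta) simp
  also have "(\<Sum>n\<in>?S. sc (a n) (d (n + j) (c n x))) = bilin a j x" by (rule bilin_sum[OF S, symmetric]) blast
  finally show ?thesis .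
qed

lemma bilin_c:
  assumes j: "j \<noteq> 0" shows "bilin a j (c k x) = c k (bilin a j x) - sc (a (k - j)) (c (k - j) x)"
proof -
  let ?S = "{n. d (n + j) (c n x) \<noteq> 0} \<union> {n. d (n + j) (c n (c k x)) \<noteq> 0} \<union> {k - j}"
  have S: "finite ?S" using bilin_finite[OF j] by simp
  have "bilin a j (c k x) = (\<Sum>n\<in>?S. sc (a n) (d (n + j) (c n (c k x))))" by (rule bilin_sum[OF S]) blast
  also have "\<dots> = (\<Sum>n\<in>?S. c k (sc (a n) (d (n + j) (c n x))) + (if n = k - j then - sc (a (k - j)) (c (k - j) x) else 0))"
    by (intro sum.cong refl) (auto simp: quad_c scale_right_distrib cd_simps)
  also have "\<dots> = c k (\<Sum>n\<in>?S. sc (a n) (d (n + j) (c n x))) + - sc (a (k - j)) (c (k - j) x)"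
    using S by (simp only: sum.distrib linop_sum[OF linop_cd(1)] sum.delta) simp
  also have "(\<Sum>n\<in>?S. sc (a n) (d (n + j) (c n x))) = bilin a j x" by (rule bilin_sum[OF S, symmetric]) blast
  finally show ?thesis by simp
qed

section \<open>The normal ordered energy\<close>

text \<open>At negative indices c creates a hole in the sea and d removes one, so the term is normal
  ordered and kills the vacuum.\<close>

definition energy_term :: "'v \<Rightarrow> nat \<Rightarrow> 'v" where
  "energy_term x n = sc (of_nat n) (d (int n) (c (int n) x) + c (- int n) (d (- int n) x))"

definition energy :: "'v \<Rightarrow> 'v" where
  "energy x = Sum_any (\<lambda>n::nat. if 1 \<le> n then energy_term x n else 0)"

lemma energy_sum:
  obtains N where "\<And>m. m \<ge> N \<Longrightarrow>
    energy x = sum (energy_term x) {1..m}"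
proof -
  obtain N where N: "\<forall>n\<ge>N. c n x = 0 \<and> d (- n) x = 0" using eventually_annihilated by blast
  show ?thesis
  proof (rule that[of "nat N"])
    fix m assume m: "m \<ge> nat N"
    let ?f = "\<lambda>n::nat. if 1 \<le> n then energy_term x n else 0"
    have "?f n = 0" if "n \<notin> {1..m}" for n
    proof (cases "1 \<le> n")
      case True
      then have "int n \<ge> N" using that m by auto
      then have "c (int n) x = 0 \<and> d (- int n) x = 0" using N by blast
      then show ?thesis by (simp add: energy_term_def cd_simps)
    qed simp
    then have "{n. ?f n \<noteq> 0} \<subseteq> {1..m}" by blast
    then have "energy x = sum ?f {1..m}" unfolding energy_def by (rule Sum_any.expand_superset[OF finite_atLeastAtMost])
    also have "\<dots> = sum (energy_term x) {1..m}"
      by (intro sum.cong) auto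
    finally show "energy x = sum (energy_term x) {1..m}" .
  qed
qed

lemma energy_linop: "linop energy"
proof (rule linopI)
  fix x y a
  obtain Nx where Nx: "\<And>m. m \<ge> Nx \<Longrightarrow> energy x = sum (energy_term x) {1..m}" using energy_sum[of x] by blast
  obtain Ny where Ny: "\<And>m. m \<ge> Ny \<Longrightarrow> energy y = sum (energy_term y) {1..m}" using energy_sum[of y] by blast
  obtain N where N: "\<And>m. m \<ge> N \<Longrightarrow> energy (x + y) = sum (energy_term (x + y)) {1..m}" using energy_sum[of "x + y"] by blast
  obtain Na where Na: "\<And>m. m \<ge> Na \<Longrightarrow> energy (sc a x) = sum (energy_term (sc a x)) {1..m}" using energy_sum[of "sc a x"] by blast
  define m where "m = max (max Nx Ny) (max N Na)"
  have m: "m \<ge> Nx" "m \<ge> Ny" "m \<ge> N" "m \<ge> Na" by (simp_all add: m_def)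
  show "energy (x + y) = energy x + energy y"
    unfolding N[OF m(3)] Nx[OF m(1)] Ny[OF m(2)] sum.distrib[symmetric]
    by (intro sum.cong refl) (simp add: energy_term_def cd_simps scale_right_distrib add_ac)
  show "energy (sc a x) = sc a (energy x)"
    unfolding Na[OF m(4)] Nx[OF m(1)] scale_sum_right
    by (intro sum.cong refl) (simp add: energy_term_def cd_simps scale_right_distrib mult.commute)
qed

lemma quad'_d: "c n (d m (d k x)) = (if n = k then - d m x else 0) + d k (c n (d m x))"
  using car[of n k "d m x"] dd[of m k x] by (simp add: cd_simps)

lemma quad'_c: "c n (d m (c k x)) = (if k = m then c n x else 0) + c k (c n (d m x))"
proof -
  have a: "d m (c k x) = (if k = m then x else 0) - c k (d m x)" using car[of k m x] by simp
  show ?thesis unfolding a by (simp add: cd_simps cc[of n k "d m x"])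
qed

text \<open>Serves \<open>d k\<close> and \<open>c k\<close> at once: only the term n = |k| produces
  an extra z, and for k = 0 no such term occurs as the sum starts at 1.\<close>

lemma energy_shift:
  fixes k :: int
  assumes K: "linop K" and "k = 0 \<Longrightarrow> z = 0"
    and shift: "\<And>n. 1 \<le> n \<Longrightarrow> energy_term (K x) n = K (energy_term x n) + (if k = int n \<or> k = - int n then z else 0)"
  shows "energy (K x) = K (energy x) + z"
proof -
  obtain N where N: "\<And>m. m \<ge> N \<Longrightarrow> energy x = sum (energy_term x) {1..m}" using energy_sum[of x] by blast
  obtain N' where N': "\<And>m. m \<ge> N' \<Longrightarrow> energy (K x) = sum (energy_term (K x)) {1..m}" using energy_sum[of "K x"] by blast
  define m where "m = max (max N N') (nat \<bar>k\<bar>)"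
  have m: "m \<ge> N" "m \<ge> N'" "m \<ge> nat \<bar>k\<bar>" by (simp_all add: m_def)
  have iff: "k = int n \<or> k = - int n \<longleftrightarrow> n = nat \<bar>k\<bar>" for n by linarith
  have "energy (K x) = (\<Sum>n\<in>{1..m}. K (energy_term x n) + (if n = nat \<bar>k\<bar> then z else 0))"
    unfolding N'[OF m(2)] by (intro sum.cong refl) (simp only: shift[unfolded iff] atLeastAtMost_iff)
  also have "\<dots> = K (sum (energy_term x) {1..m}) + (if nat \<bar>k\<bar> \<in> {1..m} then z else 0)"
    by (simp only: sum.distrib linop_sum[OF K] sum.delta finite_atLeastAtMost)
  also have "(if nat \<bar>k\<bar> \<in> {1..m} then z else 0) = z"
    using m(3) assms(2) by auto
  finally show ?thesis unfolding N[OF m(1)] .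
qed

lemma energy_d: "energy (d k x) = d k (energy x) + sc (of_int k) (d k x)"
  by (rule energy_shift[of "d k" k, OF linop_cd(2)])
    (auto simp: energy_term_def quad_d quad'_d cd_simps scale_right_distrib scale_right_diff_distrib add_ac)

lemma energy_c: "energy (c k x) = c k (energy x) - sc (of_int k) (c k x)"
proof -
  have "energy (c k x) = c k (energy x) + - sc (of_int k) (c k x)"
    by (rule energy_shift[of "c k" k, OF linop_cd(1)])
      (auto simp: energy_term_def quad_c quad'_c cd_simps scale_right_distrib scale_right_diff_distrib add_ac)
  then show ?thesis by simp
qed

lemma energy_vac: "energy vac = 0"
  unfolding energy_def energy_term_def by (simp add: c_vac d_vac cd_simps cong: if_cong)

end

section \<open>The algebra of the charges\<close>

text \<open>\<open>mm\<close> stands for M^2. The phases of l stay free, reflecting those of the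
  modes.\<close>

locale sea_charges = dirac_sea sc ip c d vac
  for sc :: "complex \<Rightarrow> 'v \<Rightarrow> 'v::ab_group_add" and ip c d vac +
  fixes l :: "int \<Rightarrow> complex" and mm :: real
  assumes l: "l n * cnj (l n) = of_real ((of_int n + 1 / 2)\<^sup>2 - mm)"
begin

definition P where "P = bilin l 1"
text \<open>The shift to n - 1 arises because l is labelled by the lower of the two modes it
  connects.\<close>

definition Q where "Q = bilin (\<lambda>n. - cnj (l (n - 1))) (- 1)"
text \<open>Half of |l (-1)|^2, the strength of the transition across the surface of the
  sea.\<close>

definition lam :: real where "lam = (1 / 4 - mm) / 2"

lemma PQ_linop: "linop P" "linop Q" by (simp_all add: P_def Q_def bilin_linop)

lemmas PQ_simps = linop_0[OF PQ_linop(1)] linop_0[OF PQ_linop(2)] linop_minus[OF PQ_linop(1)] linop_minus[OF PQ_linop(2)]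
  linop_add[OF PQ_linop(1)] linop_add[OF PQ_linop(2)] linop_diff[OF PQ_linop(1)] linop_diff[OF PQ_linop(2)]
  linop_scale[OF PQ_linop(1)] linop_scale[OF PQ_linop(2)]

lemma P_d: "P (d k x) = d k (P x) + sc (l k) (d (k + 1) x)"
  and P_c: "P (c k x) = c k (P x) - sc (l (k - 1)) (c (k - 1) x)"
  and Q_d: "Q (d k x) = d k (Q x) - sc (cnj (l (k - 1))) (d (k - 1) x)"
  and Q_c: "Q (c k x) = c k (Q x) + sc (cnj (l k)) (c (k + 1) x)"
  unfolding P_def Q_def by (simp_all add: bilin_d bilin_c)

text \<open>In the vacuum the only upward step from a filled level to an empty one is from -1 to
  0.\<close>

lemma P_vac: "P vac = sc (l (- 1)) (d 0 (c (- 1) vac))"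
proof -
  have "d (n + 1) (c n vac) = 0" if "n \<noteq> - 1" for n
  proof (cases "0 \<le> n")
    case False
    then have "c n (d (n + 1) vac) = 0" using that by (simp add: d_vac cd_simps)
    then show ?thesis by (simp add: car)
  qed (simp add: c_vac cd_simps)
  then have "{n. d (n + 1) (c n vac) \<noteq> 0} \<subseteq> {- 1}" by blast
  then show ?thesis unfolding P_def by (subst bilin_sum[of "{- 1}"]) simp_all
qed

text \<open>Directly below each filled level lies another filled one, so every downward step is
  blocked.\<close>

lemma Q_vac: "Q vac = 0"
proof -
  have "d (n + - 1) (c n vac) = 0" for n
  proof (cases "0 \<le> n")
    case False
    then have "c n (d (n + - 1) vac) = 0" by (simp add: d_vac cd_simps)
    then show ?thesis by (simp add: car)
  qed (simp add: c_vac cd_simps)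
  then show ?thesis unfolding Q_def by (subst bilin_sum[of "{}"]) simp_all
qed

text \<open>(k + 1/2)^2 - (k - 1/2)^2 = 2k, so M cancels and can appear in the commutator only
  through the additive constant.\<close>

lemma l_diff: "l k * cnj (l k) - l (k - 1) * cnj (l (k - 1)) = 2 * of_int k"
  unfolding l by (simp add: power2_eq_square algebra_simps)

definition Z where "Z x = energy x + sc (of_real lam) x"

lemma Z_linop: "linop Z"
  unfolding Z_def[abs_def]
  by (rule linopI) (simp_all add: linop_add[OF energy_linop] linop_scale[OF energy_linop] scale_right_distrib mult.commute add_ac)

lemma Z_d: "Z (d k x) = d k (Z x) + sc (of_int k) (d k x)"
  and Z_c: "Z (c k x) = c k (Z x) - sc (of_int k) (c k x)"
  by (simp_all add: Z_def energy_d energy_c cd_simps)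

lemma Z_vac: "Z vac = sc (of_real lam) vac" by (simp add: Z_def energy_vac)

lemmas Z_simps = linop_0[OF Z_linop] linop_minus[OF Z_linop] linop_add[OF Z_linop] linop_diff[OF Z_linop] linop_scale[OF Z_linop]

lemma sc_diff_combine: "sc (l k * cnj (l k)) x - sc (l (k - 1) * cnj (l (k - 1))) x = sc (2 * of_int k) x"
  by (simp only: l_diff scale_left_diff_distrib[symmetric])

text \<open>By \<open>l_diff\<close> the difference of the two sides commutes with all
  \<open>c k\<close> and \<open>d k\<close>, so it is determined by its value on the vacuum. The
  constant lam in \<open>Z\<close> is what makes that value 0.\<close>

lemma comm_PQ: "P (Q x) - Q (P x) = sc 2 (Z x)"
proof -
  define A where "A x = P (Q x) - Q (P x) - sc 2 (Z x)" for x
  have lin: "linop A"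
    by (rule linopI) (simp_all add: A_def PQ_simps Z_simps scale_right_distrib scale_right_diff_distrib mult.commute algebra_simps)
  have "A x = 0"
  proof (rule linop_eq_0I[OF lin])
    fix k x
    have "A (d k x) = d k (A x) + (sc (l k * cnj (l k)) (d k x) - sc (l (k - 1) * cnj (l (k - 1))) (d k x)) - sc (2 * of_int k) (d k x)"
      by (simp add: A_def P_d Q_d Z_d PQ_simps cd_simps scale_right_distrib scale_right_diff_distrib algebra_simps)
    then show "A (d k x) = d k (A x)" unfolding sc_diff_combine by simp
    have "A (c k x) = c k (A x) - (sc (l k * cnj (l k)) (c k x) - sc (l (k - 1) * cnj (l (k - 1))) (c k x)) + sc (2 * of_int k) (c k x)"
      by (simp add: A_def P_c Q_c Z_c PQ_simps cd_simps scale_right_distrib scale_right_diff_distrib algebra_simps)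
    then show "A (c k x) = c k (A x)" unfolding sc_diff_combine by simp
  next
    \<comment> \<open>P lifts the particle at level -1 to level 0 and Q returns it; the round trip
      contributes -|l (-1)|^2 = -2 lam.\<close>
    have v: "c 0 vac = 0" "d (- 1) vac = 0" by (simp_all add: c_vac d_vac)
    have "d (- 1) (c (- 1) vac) = vac" using car[of "- 1" "- 1" vac] by (simp add: v cd_simps)
    then have "Q (P vac) = - sc (l (- 1) * cnj (l (- 1))) vac"
      unfolding P_vac by (simp add: PQ_simps Q_d Q_c Q_vac v cd_simps)
    also have "l (- 1) * cnj (l (- 1)) = 2 * of_real lam"
      unfolding l lam_def by (simp add: power2_eq_square)
    finally show "A vac = 0" by (simp add: A_def Q_vac PQ_simps Z_vac)
  qed
  then show ?thesis by (simp add: A_def)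
qed

text \<open>The same scheme: \<open>Z\<close> counts \<open>d k\<close> with weight k and P raises
  that index by one. On the vacuum, P creates a pair of total weight 1.\<close>

lemma comm_ZP: "Z (P x) - P (Z x) = P x"
proof -
  define A where "A x = Z (P x) - P (Z x) - P x" for x
  have lin: "linop A"
    by (rule linopI) (simp_all add: A_def PQ_simps Z_simps scale_right_distrib scale_right_diff_distrib)
  have "A x = 0"
  proof (rule linop_eq_0I[OF lin])
    fix k x
    show "A (d k x) = d k (A x)"
      by (simp add: A_def P_d Z_d PQ_simps Z_simps cd_simps scale_right_distrib scale_right_diff_distrib scale_left_distrib algebra_simps)
    show "A (c k x) = c k (A x)"
      by (simp add: A_def P_c Z_c PQ_simps Z_simps cd_simps scale_right_distrib scale_right_diff_distrib scale_left_diff_distrib scale_left_distrib algebra_simps)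
  next
    show "A vac = 0"
      by (simp add: A_def P_vac Z_d Z_c Z_vac PQ_simps Z_simps cd_simps scale_right_distrib scale_right_diff_distrib mult.commute)
  qed
  then show ?thesis by (simp add: A_def)
qed

lemma comm_ZQ: "Z (Q x) - Q (Z x) = - Q x"
proof -
  define A where "A x = Z (Q x) - Q (Z x) + Q x" for x
  have lin: "linop A"
    by (rule linopI) (simp_all add: A_def PQ_simps Z_simps scale_right_distrib scale_right_diff_distrib)
  have "A x = 0"
  proof (rule linop_eq_0I[OF lin])
    fix k x
    show "A (d k x) = d k (A x)"
      by (simp add: A_def Q_d Z_d PQ_simps Z_simps cd_simps scale_right_distrib scale_right_diff_distrib scale_left_diff_distrib scale_left_distrib algebra_simps)
    show "A (c k x) = c k (A x)"
      by (simp add: A_def Q_c Z_c PQ_simps Z_simps cd_simps scale_right_distrib scale_right_diff_distrib scale_left_diff_distrib scale_left_distrib algebra_simps)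
  next
    show "A vac = 0" by (simp add: A_def Q_vac Z_vac PQ_simps Z_simps)
  qed
  then show ?thesis by (simp add: A_def add_eq_0_iff2)
qed

lemma P_adj: "ip (P x) y = - ip x (Q y)"
proof -
  \<comment> \<open>Contains the support of P x, and its shift by 1 contains that of Q y, so both
    sums run over the same index set after reindexing.\<close>
  let ?S = "{n. d (n + 1) (c n x) \<noteq> 0} \<union> (\<lambda>n. n - 1) ` {n. d (n + - 1) (c n y) \<noteq> 0}"
  have S: "finite ?S" using bilin_finite[of 1 x] bilin_finite[of "- 1" y] by simp
  have "P x = (\<Sum>n\<in>?S. sc (l n) (d (n + 1) (c n x)))" unfolding P_def by (rule bilin_sum[OF S]) blast
  then have "ip (P x) y = (\<Sum>n\<in>?S. cnj (l n) * ip (c n x) (c (n + 1) y))"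
    by (simp add: ip_sum ip_scale_left adj)
  moreover have "Q y = (\<Sum>n\<in>(\<lambda>n. n + 1) ` ?S. sc (- cnj (l (n - 1))) (d (n + - 1) (c n y)))"
    unfolding Q_def
  proof (rule bilin_sum)
    show "{n. d (n + - 1) (c n y) \<noteq> 0} \<subseteq> (\<lambda>n. n + 1) ` ?S"
    proof
      fix n assume "n \<in> {n. d (n + - 1) (c n y) \<noteq> 0}"
      then have "n - 1 \<in> ?S" by blast
      then have "n - 1 + 1 \<in> (\<lambda>n. n + 1) ` ?S" by (rule imageI)
      then show "n \<in> (\<lambda>n. n + 1) ` ?S" by simp
    qed
  qed (use S in simp)
  then have "Q y = (\<Sum>n\<in>?S. sc (- cnj (l n)) (d n (c (n + 1) y)))"
    by (subst (asm) sum.reindex) (auto simp: inj_on_def)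
  moreover have "ip x (d n z) = ip (c n x) z" for n z
    using adj[of n z x] ip_cnj[of x "d n z"] ip_cnj[of "c n x" z] by simp
  ultimately show ?thesis by (simp add: ip_sum ip_scale ip_minus sum_negf)
qed

lemma Q_adj: "ip (Q x) y = - ip x (P y)"
proof -
  have "ip (Q x) y = cnj (ip y (Q x))" by (rule ip_cnj)
  also have "ip y (Q x) = - ip (P y) x" by (simp add: P_adj)
  also have "cnj (- ip (P y) x) = - ip x (P y)" by (simp add: ip_cnj[symmetric])
  finally show ?thesis .
qed

text \<open>\<open>Z\<close> is half of P Q - Q P. Passing to adjoints turns P into - Q and Q into -
  P, which leaves each of the two products unchanged.\<close>

lemma Z_adj: "ip (Z x) y = ip x (Z y)"
proof -
  have ip_diff: "ip x (y - z) = ip x y - ip x z" "ip (y - z) x = ip y x - ip z x" for x y z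
    using ip_add[of x "y - z" z] ip_add_left[of "y - z" z x] by simp_all
  have "ip (sc 2 (Z x)) y = ip x (sc 2 (Z y))"
    unfolding comm_PQ[symmetric] ip_diff by (simp add: P_adj Q_adj)
  then show ?thesis by (simp add: ip_scale ip_scale_left)
qed

end

section \<open>Degenerate vacua and the representations they generate\<close>

context sea_charges
begin

text \<open>Filling level 0 shifts \<open>Z\<close> by k = 0, and lowering from there is blocked by
  the filled level -1.\<close>

lemma vacua:
  shows "ip (d 0 vac) (d 0 vac) = 1" "ip (d 0 vac) vac = 0" "ip vac (d 0 vac) = 0"
    "Q (d 0 vac) = 0" "Z (d 0 vac) = sc (of_real lam) (d 0 vac)"
proof -
  show 0: "ip (d 0 vac) vac = 0" by (simp add: adj c_vac ip_0)
  show "ip (d 0 vac) (d 0 vac) = 1" by (simp add: adj car c_vac cd_simps vac_norm)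
  show "ip vac (d 0 vac) = 0" using ip_cnj[of vac "d 0 vac"] unfolding 0 by simp
  show "Q (d 0 vac) = 0" by (simp add: Q_d Q_vac d_vac cd_simps)
  show "Z (d 0 vac) = sc (of_real lam) (d 0 vac)" by (simp add: Z_d Z_vac cd_simps)
qed

lemma vacuum_superposition:
  assumes "v = sc a vac + sc b (d 0 vac)"
  shows "ip v v = cnj a * a + cnj b * b" "Q v = 0" "Z v = sc (of_real lam) v"
  unfolding assms
  by (simp_all add: ip_add ip_add_left ip_scale ip_scale_left vac_norm vacua PQ_simps Q_vac Z_simps Z_vac
      scale_right_distrib mult.commute)

text \<open>The commutation and adjoint relations hold on the whole Fock space, so they restrict to
  the smallest invariant subspace containing v.\<close>

lemma lowest_weight_generated:
  assumes v: "ip v v = 1" "Q v = 0" "Z v = sc (of_real lam) v" and "0 < lam"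
  shows "lowest_weight \<lparr>rscale = sc, rip = ip,
    rspace = \<Inter>{W. subspace W \<and> v \<in> W \<and> invariant {Z, P, Q} W}, r0 = Z, rplus = P, rminus = Q\<rparr> v lam"
proof -
  let ?F = "{W. subspace W \<and> v \<in> W \<and> invariant {Z, P, Q} W}"
  have sub: "subspace (\<Inter>?F)" by (rule subspace_Inter) blast
  have vF: "v \<in> \<Inter>?F" by blast
  have inv: "A ` \<Inter>?F \<subseteq> \<Inter>?F" if "A \<in> {Z, P, Q}" for A
    using that unfolding invariant_def by blast
  have lin: "linear_from_to sc sc (\<Inter>?F) (\<Inter>?F) A" if "A \<in> {Z, P, Q}" for A
    unfolding linear_from_to_def
  proof (intro conjI ballI allI)
    have "linop A" using that Z_linop PQ_linop by blast
    then show "A (x + y) = A x + A y" "A (sc a x) = sc a (A x)" for x y a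
      by (rule linop_add, rule linop_scale)
  qed (rule inv[OF that])
  have ip': "inner_product_on sc (\<Inter>?F) ip"
    unfolding inner_product_on_def
  proof (intro conjI ballI allI impI)
    show "ip y x = cnj (ip x y)" for x y by (rule ip_cnj)
    show "x \<noteq> 0 \<Longrightarrow> 0 < Re (ip x x)" for x
      by (rule ip[unfolded inner_product_on_def, THEN conjunct2, THEN conjunct2, THEN conjunct2, rule_format]) simp_all
  qed (simp_all add: ip_add ip_scale)
  show ?thesis
  proof
    show "unitary_sl2_rep \<lparr>rscale = sc, rip = ip, rspace = \<Inter>?F, r0 = Z, rplus = P, rminus = Q\<rparr>"
      unfolding unitary_sl2_rep_def sl2_rep.simps
    proof (intro conjI ballI)
      show "vector_space sc" by (rule vector_space_axioms)
      show "linear_from_to sc sc (\<Inter>?F) (\<Inter>?F) A" if "A \<in> {Z, P, Q}" for A by (rule lin[OF that])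
      fix x y
      show "comm Z P x = P x" "comm Z Q x = - Q x" "comm P Q x = sc 2 (Z x)"
        unfolding comm_def by (rule comm_ZP comm_ZQ comm_PQ)+
      show "ip (P x) y = - ip x (Q y)" "ip (Z x) y = ip x (Z y)" by (rule P_adj Z_adj)+
    qed (rule sub ip')+
  qed (use assms vF in auto)
qed

end

section \<open>From the Fock space axioms to the Dirac sea\<close>

text \<open>Particle-hole relabelling: below 0, \<open>c_op\<close> is \<open>cre_b\<close> and
  \<open>c_dag\<close> is \<open>ann_b\<close>, so the relations for a and b merge into one family
  indexed by the integers.\<close>

lemma fermionic_fock_dirac_sea:
  assumes fock: "fermionic_fock F"
  shows "dirac_sea (fscale F) (fip F) (c_op F) (c_dag F) (vac F)"
proof -
  note f = fock[unfolded fermionic_fock_def]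
  have vs: "vector_space (fscale F)" using f by (elim conjE)
  have ip: "inner_product_on (fscale F) UNIV (fip F)" using f by (elim conjE)
  have lin: "\<forall>A\<in>fock_operators F. linear_from_to (fscale F) (fscale F) UNIV UNIV A" using f by (elim conjE)
  have adj_a: "\<forall>n x y. fip F (cre_a F n x) y = fip F x (ann_a F n y)" using f by (elim conjE)
  have adj_b: "\<forall>n\<ge>1. \<forall>x y. fip F (cre_b F n x) y = fip F x (ann_b F n y)" using f by (elim conjE)
  have a1: "\<forall>n m. anticomm (ann_a F n) (cre_a F m) = (if n = m then (\<lambda>x. x) else (\<lambda>_. 0))" using f by (elim conjE)
  have a2: "\<forall>n m. anticomm (ann_a F n) (ann_a F m) = (\<lambda>_. 0)" using f by (elim conjE)
  have a3: "\<forall>n m. anticomm (cre_a F n) (cre_a F m) = (\<lambda>_. 0)" using f by (elim conjE)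
  have b1: "\<forall>n\<ge>1. \<forall>m\<ge>1. anticomm (ann_b F n) (cre_b F m) = (if n = m then (\<lambda>x. x) else (\<lambda>_. 0))" using f by (elim conjE)
  have b2: "\<forall>n\<ge>1. \<forall>m\<ge>1. anticomm (ann_b F n) (ann_b F m) = (\<lambda>_. 0)" using f by (elim conjE)
  have b3: "\<forall>n\<ge>1. \<forall>m\<ge>1. anticomm (cre_b F n) (cre_b F m) = (\<lambda>_. 0)" using f by (elim conjE)
  have ab1: "\<forall>n. \<forall>m\<ge>1. anticomm (ann_a F n) (ann_b F m) = (\<lambda>_. 0)" using f by (elim conjE)
  have ab2: "\<forall>n. \<forall>m\<ge>1. anticomm (ann_a F n) (cre_b F m) = (\<lambda>_. 0)" using f by (elim conjE)
  have ab3: "\<forall>n. \<forall>m\<ge>1. anticomm (cre_a F n) (ann_b F m) = (\<lambda>_. 0)" using f by (elim conjE)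
  have ab4: "\<forall>n. \<forall>m\<ge>1. anticomm (cre_a F n) (cre_b F m) = (\<lambda>_. 0)" using f by (elim conjE)
  have vv: "fip F (vac F) (vac F) = 1" using f by (elim conjE)
  have va: "\<forall>n. ann_a F n (vac F) = 0" using f by (elim conjE)
  have vb: "\<forall>n\<ge>1. ann_b F n (vac F) = 0" using f by (elim conjE)
  have gen: "\<forall>W. module.subspace (fscale F) W \<and> vac F \<in> W \<and> invariant (fock_operators F) W \<longrightarrow> W = UNIV"
    using f by (elim conjE)
  \<comment> \<open>Negative modes never refer to \<open>ann_b\<close> or \<open>cre_b\<close> at
    index 0, where nothing is known about them.\<close>
  have pos: "nat (- n) \<ge> 1" if "n < 0" for n :: int using that by simp
  have ops: "c_op F n \<in> fock_operators F" "c_dag F n \<in> fock_operators F" for n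
    unfolding fock_operators_def c_op_def c_dag_def using pos[of n] by (auto simp del: One_nat_def)
  have sum0: "A (B x) + B (A x) = 0" if "anticomm A B = (\<lambda>_. 0)" for A B :: "'a \<Rightarrow> 'a" and x
    using fun_cong[OF that, of x] by (simp add: anticomm_def)
  have car: "c_op F m (c_dag F n x) + c_dag F n (c_op F m x) = (if m = n then x else 0)" for m n x
  proof (cases "0 \<le> m"; cases "0 \<le> n")
    assume "0 \<le> m" "0 \<le> n"
    then show ?thesis using fun_cong[OF a1[rule_format, of "nat m" "nat n"], of x]
      by (simp add: c_op_def c_dag_def anticomm_def eq_nat_nat_iff split: if_splits)
  next
    assume "\<not> 0 \<le> m" "\<not> 0 \<le> n"
    then show ?thesis using fun_cong[OF b1[rule_format, OF pos[of n] pos[of m]], of x]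
      by (simp add: c_op_def c_dag_def anticomm_def eq_nat_nat_iff add.commute split: if_splits)
  next
    assume "0 \<le> m" "\<not> 0 \<le> n"
    then show ?thesis using sum0[OF ab1[rule_format, OF pos[of n], of "nat m"], of x]
      by (simp add: c_op_def c_dag_def)
  next
    assume "\<not> 0 \<le> m" "0 \<le> n"
    then show ?thesis using sum0[OF ab4[rule_format, OF pos[of m], of "nat n"], of x]
      by (simp add: c_op_def c_dag_def add.commute)
  qed
  have cc: "c_op F m (c_op F n x) + c_op F n (c_op F m x) = 0" for m n x
    using sum0[OF a2[rule_format, of "nat m" "nat n"], of x] sum0[OF b3[rule_format, OF pos[of m] pos[of n]], of x]
      sum0[OF ab2[rule_format, OF pos[of n], of "nat m"], of x] sum0[OF ab2[rule_format, OF pos[of m], of "nat n"], of x]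
    by (cases "0 \<le> m"; cases "0 \<le> n"; simp add: c_op_def add.commute)
  have dd: "c_dag F m (c_dag F n x) + c_dag F n (c_dag F m x) = 0" for m n x
    using sum0[OF a3[rule_format, of "nat m" "nat n"], of x] sum0[OF b2[rule_format, OF pos[of m] pos[of n]], of x]
      sum0[OF ab3[rule_format, OF pos[of n], of "nat m"], of x] sum0[OF ab3[rule_format, OF pos[of m], of "nat n"], of x]
    by (cases "0 \<le> m"; cases "0 \<le> n"; simp add: c_dag_def add.commute)
  have ip_cnj: "fip F y x = cnj (fip F x y)" for x y
    by (rule ip[unfolded inner_product_on_def, THEN conjunct2, THEN conjunct2, THEN conjunct1, rule_format]) simp_all
  interpret vector_space "fscale F" by (rule vs)
  show ?thesis
  proof
    show "inner_product_on (fscale F) UNIV (fip F)" by (rule ip)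
    show "c_op F n (x + y) = c_op F n x + c_op F n y" "c_op F n (fscale F a x) = fscale F a (c_op F n x)"
      "c_dag F n (x + y) = c_dag F n x + c_dag F n y" "c_dag F n (fscale F a x) = fscale F a (c_dag F n x)" for n x y a
      using bspec[OF lin ops(1)[of n]] bspec[OF lin ops(2)[of n]] unfolding linear_from_to_def by simp_all
    show "c_op F m (c_dag F n x) = (if m = n then x else 0) - c_dag F n (c_op F m x)" for m n x
      using car[of m n x] by (simp add: eq_diff_eq)
    show "c_op F m (c_op F n x) = - c_op F n (c_op F m x)" "c_dag F m (c_dag F n x) = - c_dag F n (c_dag F m x)" for m n x
      using cc[of m n x] dd[of m n x] by (simp_all add: eq_neg_iff_add_eq_0)
    show "fip F (c_dag F n x) y = fip F x (c_op F n y)" for n x y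
    proof (cases "0 \<le> n")
      case False
      \<comment> \<open>Below 0 creation and annihilation have exchanged roles relative to the
        axiom; conjugate symmetry of the inner product turns it around.\<close>
      have "fip F (ann_b F (nat (- n)) x) y = cnj (fip F y (ann_b F (nat (- n)) x))" by (rule ip_cnj)
      also have "fip F y (ann_b F (nat (- n)) x) = fip F (cre_b F (nat (- n)) y) x"
        using adj_b[rule_format, OF pos[of n]] False by simp
      also have "cnj (fip F (cre_b F (nat (- n)) y) x) = fip F x (cre_b F (nat (- n)) y)" by (rule ip_cnj[symmetric])
      finally show ?thesis using False by (simp add: c_dag_def c_op_def)
    qed (simp add: c_dag_def c_op_def adj_a)
    show "fip F (vac F) (vac F) = 1" by (rule vv)
    show "c_op F n (vac F) = 0" if "0 \<le> n" for n using that va by (simp add: c_op_def)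
    show "c_dag F n (vac F) = 0" if "n < 0" for n using that vb[rule_format, OF pos[OF that]] by (simp add: c_dag_def)
    fix W assume W: "subspace W" "vac F \<in> W" "\<And>n x. x \<in> W \<Longrightarrow> c_op F n x \<in> W" "\<And>n x. x \<in> W \<Longrightarrow> c_dag F n x \<in> W"
    have "invariant (fock_operators F) W"
      unfolding invariant_def
    proof (intro ballI subsetI)
      fix A y assume A: "A \<in> fock_operators F" and "y \<in> A ` W"
      then obtain x where x: "x \<in> W" and y: "y = A x" by blast
      have "\<exists>n. A = c_op F n \<or> A = c_dag F n"
      proof -
        consider n where "A = ann_a F n" | n where "A = cre_a F n" | n where "n \<ge> 1" "A = ann_b F n"
          | n where "n \<ge> 1" "A = cre_b F n" using A unfolding fock_operators_def by blast
        then show ?thesis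
        proof cases
          case (1 n) then show ?thesis by (intro exI[of _ "int n"]) (simp add: c_op_def)
        next
          case (2 n) then show ?thesis by (intro exI[of _ "int n"]) (simp add: c_dag_def)
        next
          case (3 n) then show ?thesis by (intro exI[of _ "- int n"]) (simp add: c_dag_def)
        next
          case (4 n) then show ?thesis by (intro exI[of _ "- int n"]) (simp add: c_op_def)
        qed
      qed
      then show "y \<in> W" unfolding y using W(3,4) x by blast
    qed
    then show "W = UNIV" using gen W(1,2) by blast
  qed
qed

text \<open>The matrix elements live on the diagonal m = n + j, which collapses the double series to
  one sum over n.\<close>

lemma charge_eq_bilin:
  assumes fock: "fermionic_fock F"
    and L: "\<And>m n. spinor_ip t (mode \<Phi> m) (L (mode \<Phi> n)) = (if m = n + j then a n else 0)" and j: "j \<noteq> 0"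
  shows "charge F \<Phi> t L = dirac_sea.bilin (fscale F) (c_op F) (c_dag F) a j"
proof
  fix x
  interpret dirac_sea "fscale F" "fip F" "c_op F" "c_dag F" "vac F" by (rule fermionic_fock_dirac_sea[OF fock])
  let ?S = "{n. c_dag F (n + j) (c_op F n x) \<noteq> 0}"
  let ?f = "\<lambda>(m, n). fscale F (spinor_ip t (mode \<Phi> m) (L (mode \<Phi> n))) (c_dag F m (c_op F n x))"
  have S: "finite ?S" by (rule bilin_finite[OF j])
  have "{p. ?f p \<noteq> 0} \<subseteq> (\<lambda>n. (n + j, n)) ` ?S" by (auto simp: L split: if_splits)
  then have "charge F \<Phi> t L x = sum ?f ((\<lambda>n. (n + j, n)) ` ?S)"
    unfolding charge_def by (rule Sum_any.expand_superset[OF finite_imageI[OF S]])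
  also have "\<dots> = (\<Sum>n\<in>?S. fscale F (a n) (c_dag F (n + j) (c_op F n x)))"
    by (subst sum.reindex) (auto simp: inj_on_def L)
  also have "\<dots> = bilin a j x" by (rule bilin_sum[OF S subset_refl, symmetric])
  finally show "charge F \<Phi> t L x = bilin a j x" .
qed

lemma number_energy_eq:
  assumes fock: "fermionic_fock F"
  shows "number_energy F = dirac_sea.energy (fscale F) (c_op F) (c_dag F)"
proof
  fix x
  interpret dirac_sea "fscale F" "fip F" "c_op F" "c_dag F" "vac F" by (rule fermionic_fock_dirac_sea[OF fock])
  show "number_energy F x = energy x"
    unfolding number_energy_def energy_def energy_term_def
    by (rule Sum_any.cong) (auto simp: c_op_def c_dag_def)
qed

lemma admissible_mass: "admissible_theory M bc \<Longrightarrow> M\<^sup>2 < 1 / 4"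
  by (cases bc) (auto simp: power2_eq_square intro: mult_strict_mono'[of M "1/2" M "1/2", simplified])

text \<open>As \<open>Lhat_zero\<close> is half the commutator by definition, the computation lies
  in its identification with the number energy plus a constant. Any realization D, on whatever type,
  has a unit lowest weight vector that generates it, which gives the isomorphism.\<close>

theorem mainTheorem8:
  fixes M :: real and bc :: boundary_condition
  assumes "admissible_theory M bc"
  shows "frequency_spectrum M bc = \<int> \<and>
    (\<forall>bp\<in>{0..<pi}. \<forall>bm\<in>{0..<pi}.
       bp + bm \<in> {0, pi} \<longleftrightarrow> 0 \<in> frequency_spectrum 0 (Angles bp bm)) \<and>
    (\<forall>\<Phi> t. \<forall>F :: 'v::ab_group_add fock. normalized_modes M bc \<Phi> \<and> fermionic_fock F \<longrightarrow>
       comm (Lhat_plus F \<Phi> t) (Lhat_minus F \<Phi> t) = (\<lambda>x. fscale F 2 (Lhat_zero F \<Phi> t x)) \<and>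
       Lhat_zero F \<Phi> t =
         (\<lambda>x. number_energy F x + fscale F (of_real ((1 / 4 - M\<^sup>2) / 2)) x) \<and>
       (\<forall>v\<in>{vac F, cre_a F 0 (vac F)}.
          v \<noteq> 0 \<and> Lhat_minus F \<Phi> t v = 0 \<and>
          Lhat_zero F \<Phi> t v = fscale F (of_real ((1 / 4 - M\<^sup>2) / 2)) v) \<and>
       (\<forall>\<alpha>. cmod \<alpha> \<le> 1 \<longrightarrow>
          fip F (vacuum_state F \<alpha>) (vacuum_state F \<alpha>) = 1 \<and>
          Lhat_minus F \<Phi> t (vacuum_state F \<alpha>) = 0 \<and>
          Lhat_zero F \<Phi> t (vacuum_state F \<alpha>) =
            fscale F (of_real ((1 / 4 - M\<^sup>2) / 2)) (vacuum_state F \<alpha>) \<and>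
          discrete_series_plus ((1 / 4 - M\<^sup>2) / 2) (generated_rep F \<Phi> t (vacuum_state F \<alpha>)) \<and>
          (\<forall>D :: 'w::ab_group_add sl2_rep. discrete_series_plus ((1 / 4 - M\<^sup>2) / 2) D \<longrightarrow>
             isomorphic_reps (generated_rep F \<Phi> t (vacuum_state F \<alpha>)) D)))"
proof (intro conjI allI impI)
  show "frequency_spectrum M bc = \<int>" by (rule frequency_spectrum_Ints[OF assms])
  show "\<forall>bp\<in>{0..<pi}. \<forall>bm\<in>{0..<pi}. bp + bm \<in> {0, pi} \<longleftrightarrow> 0 \<in> frequency_spectrum 0 (Angles bp bm)"
    using zero_frequency_Angles by blast
next
  fix \<Phi> t and F :: "'v fock"
  assume "normalized_modes M bc \<Phi> \<and> fermionic_fock F"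
  then have nm: "normalized_modes M bc \<Phi>" and fock: "fermionic_fock F" by auto
  obtain l where elems: "\<And>n. l n * cnj (l n) = of_real ((of_int n + 1 / 2)\<^sup>2 - M\<^sup>2)"
    "\<And>t m n. spinor_ip t (mode \<Phi> m) (L_plus (mode \<Phi> n)) = (if m = n + 1 then l n else 0)"
    "\<And>t m n. spinor_ip t (mode \<Phi> m) (L_minus (mode \<Phi> n)) = (if n = m + 1 then - cnj (l m) else 0)"
    using ladder_matrix_elements[OF assms nm] by blast
  interpret dirac_sea "fscale F" "fip F" "c_op F" "c_dag F" "vac F" by (rule fermionic_fock_dirac_sea[OF fock])
  interpret sea_charges "fscale F" "fip F" "c_op F" "c_dag F" "vac F" l "M\<^sup>2" by unfold_locales (rule elems(1))
  have Lp: "Lhat_plus F \<Phi> t = P"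
    unfolding Lhat_plus_def P_def by (rule charge_eq_bilin[OF fock elems(2)]) simp
  \<comment> \<open>The matrix elements are labelled by the target mode m = n - 1, which yields the
    coefficient \<open>- cnj (l (n - 1))\<close> in \<open>Q\<close>.\<close>
  have Lm: "Lhat_minus F \<Phi> t = Q"
    unfolding Lhat_minus_def Q_def by (rule charge_eq_bilin[OF fock]) (auto simp: elems(3))
  have Lz: "Lhat_zero F \<Phi> t = Z"
    by (simp add: fun_eq_iff Lhat_zero_def Lp Lm comm_def comm_PQ)
  have w: "cre_a F 0 (vac F) = c_dag F 0 (vac F)" by (simp add: c_dag_def)
  have lam_eq: "(1 / 4 - M\<^sup>2) / 2 = lam" by (simp add: lam_def)
  have lam: "0 < lam" using admissible_mass[OF assms] by (simp add: lam_def)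
  show "comm (Lhat_plus F \<Phi> t) (Lhat_minus F \<Phi> t) = (\<lambda>x. fscale F 2 (Lhat_zero F \<Phi> t x))"
    unfolding Lp Lm Lz comm_def comm_PQ ..
  show "Lhat_zero F \<Phi> t = (\<lambda>x. number_energy F x + fscale F (of_real ((1 / 4 - M\<^sup>2) / 2)) x)"
    unfolding Lz number_energy_eq[OF fock] lam_eq by (simp add: fun_eq_iff Z_def)
  show "\<forall>v\<in>{vac F, cre_a F 0 (vac F)}. v \<noteq> 0 \<and> Lhat_minus F \<Phi> t v = 0 \<and>
      Lhat_zero F \<Phi> t v = fscale F (of_real ((1 / 4 - M\<^sup>2) / 2)) v"
    unfolding w Lm Lz lam_eq using vacua vac_norm Q_vac Z_vac ip_0 by auto
  fix \<alpha> assume \<alpha>: "cmod \<alpha> \<le> 1"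
  let ?v = "vacuum_state F \<alpha>" and ?R = "generated_rep F \<Phi> t (vacuum_state F \<alpha>)"
  define \<beta> where "\<beta> = complex_of_real (sqrt (1 - (cmod \<alpha>)\<^sup>2))"
  have v: "?v = fscale F \<alpha> (vac F) + fscale F \<beta> (c_dag F 0 (vac F))"
    by (simp add: vacuum_state_def w \<beta>_def)
  note vs = vacuum_superposition[OF v]
  have "1 - (cmod \<alpha>)\<^sup>2 \<ge> 0" using \<alpha> by (simp add: power_le_one)
  then have "cnj \<beta> * \<beta> = of_real (1 - (cmod \<alpha>)\<^sup>2)"
    unfolding \<beta>_def by (simp flip: of_real_mult)
  moreover have "cnj \<alpha> * \<alpha> = of_real ((cmod \<alpha>)\<^sup>2)" by (simp add: complex_norm_square mult.commute del: of_real_power)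
  ultimately have norm: "fip F ?v ?v = 1" unfolding vs(1) by simp
  have lw: "lowest_weight ?R ?v lam"
    unfolding generated_rep_def Lp Lm Lz by (rule lowest_weight_generated[OF norm vs(2,3) lam])
  show "fip F ?v ?v = 1" by (rule norm)
  show "Lhat_minus F \<Phi> t ?v = 0" unfolding Lm by (rule vs(2))
  show "Lhat_zero F \<Phi> t ?v = fscale F (of_real ((1 / 4 - M\<^sup>2) / 2)) ?v" unfolding Lz lam_eq by (rule vs(3))
  show "discrete_series_plus ((1 / 4 - M\<^sup>2) / 2) ?R" unfolding lam_eq by (rule lowest_weight.discrete_series[OF lw])
  show "isomorphic_reps ?R D" if "discrete_series_plus ((1 / 4 - M\<^sup>2) / 2) D" for D :: "'w sl2_rep"
    using that unfolding lam_eq by (metis discrete_series_lowest_weight lowest_weight_isomorphic lw)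
qed

end
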